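(* Given $0<\theta\le1$ and $\gamma>0$, there exists $\nu=\nu(\theta,\gamma)\in(0,1)$ such that the following holds for all sufficiently large $x$: if $A,B\subseteq\{1,2,\dots,x\}$ satisfy $|A|,|B|>x^\nu$, then $$\Bigl|\,\#\{(a,b):\ a\in A,\ b\in B,\ a+b\text{ is }x^\theta\text{-smooth}\}-\rho(1/\theta)\,|A|\cdot|B|\,\Bigr|<\gamma\,|A|\cdot|B|.$$ The same result holds for differences $a-b$ in place of sums $a+b$ (with possibly a different value of $\nu$).
   Context: An integer is $y$-smooth if it has no prime divisor greater than $y$ (in particular $0$, which is divisible by every prime, is not $y$-smooth, and a negative integer $n$ is $y$-smooth iff $|n|$ is). $\Psi(x,y)$ denotes the number of $y$-smooth positive integers $\le x$, and Dickman's function is $\rho(u)=\lim_{x\to\infty}\Psi(x,x^{1/u})/x$ (the limit is known to exist). "Sufficiently large" means larger than a bound depending only on $\theta$ and $\gamma$ (and $\nu$), not on $A$ and $B$. *)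

theory Defs
  imports Complex_Main "HOL-Computational_Algebra.Primes"
begin

text \<open>
  Since \<open>0\<close> is divisible by every prime it is not smooth, and only \<open>\<bar>n\<bar>\<close> matters;
  see the two lemmas below.
\<close>

definition smooth :: "real \<Rightarrow> int \<Rightarrow> bool" where
  "smooth y n \<longleftrightarrow> (\<forall>p::int. prime p \<longrightarrow> p dvd n \<longrightarrow> real_of_int p \<le> y)"

definition smooth_count :: "real \<Rightarrow> real \<Rightarrow> nat" where
  "smooth_count x y = card {n::int. 0 < n \<and> real_of_int n \<le> x \<and> smooth y n}"

text \<open>Only meaningful for \<open>u > 0\<close>, where the limit is a classical result.\<close>

definition dickman :: "real \<Rightarrow> real" where
  "dickman u = Lim at_top (\<lambda>x::real. real (smooth_count x (x powr (1 / u))) / x)"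

lemma not_smooth_0: "\<not> smooth y 0"
proof -
  obtain p :: nat where p: "prime p" "p > nat \<lceil>y\<rceil>"
    using bigger_prime by blast
  have "real_of_int (int p) > y"
    using p(2) by linarith
  moreover have "prime (int p)"
    using p(1) by simp
  ultimately show ?thesis
    unfolding smooth_def by (metis dvd_0_right not_le)
qed

lemma smooth_abs: "smooth y \<bar>n\<bar> \<longleftrightarrow> smooth y n"
  by (simp add: smooth_def)

end

theory Submission
  imports Defs "HOL-Number_Theory.Number_Theory" "HOL-Real_Asymp.Real_Asymp"
begin

text \<open>
  Put \<open>R = x\<^sup>1\<^sup>-\<^sup>\<delta>\<close>. By the large sieve, \<open>#{(a, b). d dvd a + b}\<close> equals \<open>|A| |B| / d\<close> up to an error
  which, summed over the \<open>d \<le> R\<close> free of prime factors \<open>\<le> x\<^sup>2\<^sup>\<delta>\<close>, is a negligible fraction of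
  \<open>|A| |B|\<close> as soon as \<open>|A|, |B| > x\<^sup>\<nu>\<close> with \<open>\<nu>\<close> close to 1. Detect smoothness by
  inclusion-exclusion over the primes \<open>> x\<^sup>\<theta>\<close>, truncated to products \<open>\<le> R\<close>. The truncation affects
  only those \<open>n\<close> without prime factors in \<open>(x\<^sup>2\<^sup>\<delta>, x\<^sup>\<theta>]\<close>, and by a second moment argument these are
  rare when \<open>\<delta>\<close> is small. What remains is \<open>|A| |B|\<close> times a main term depending only on \<open>x\<close>, \<open>\<theta>\<close> and
  \<open>\<delta>\<close>; the same argument applied to \<open>{1..x}\<close> identifies this main term with the density of
  smooth numbers, that is, with Dickman's function.
\<close>

section \<open>The large sieve inequality\<close>

text \<open>Moduli with small prime factors must be avoided: \<open>A\<close> may lie in a single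
  class modulo 2. If \<open>d\<close> has no prime factor up to \<open>x^(2\<delta>)\<close>, then
  every fraction \<open>h / d\<close> outside the integers has a reduced denominator above
  \<open>x^(2\<delta>)\<close>. The length term of the large sieve then costs about
  \<open>x^(1-2\<delta>)\<close> and the modulus term about \<open>R = x^(1-\<delta>)\<close>. Both
  save a power of \<open>x\<close>, and this saving is what allows \<open>\<nu> < 1\<close>. If the
  product of the large primes of \<open>n <= 2x\<close> exceeds \<open>R\<close>, its cofactor is
  below \<open>2x^\<delta>\<close>, hence below \<open>x^(2\<delta>)\<close>; this dictates the
  rough moduli. An integer has only boundedly many prime factors above \<open>x^\<theta>\<close>, so
  each failure of the truncation costs a constant, and the proportion of failures is of order
  \<open>1 / ln (1/\<delta>)\<close>. Thus \<open>\<delta>\<close> depends on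
  \<open>\<theta>\<close> and \<open>\<gamma>\<close> only. As \<open>dickman\<close> is a
  \<open>Lim\<close>, convergence has to be established as well. Mertens' estimates and Buchstab's
  identity suffice for this; the prime number theorem does not enter.\<close>

definition ee :: "real \<Rightarrow> complex" where
  "ee t = cis (2 * pi * t)"

lemma norm_ee [simp]: "norm (ee t) = 1"
  by (simp add: ee_def)

lemma ee_0 [simp]: "ee 0 = 1"
  by (simp add: ee_def)

lemma ee_add: "ee (s + t) = ee s * ee t"
  by (simp add: ee_def cis_mult distrib_left)

lemma cnj_ee: "cnj (ee t) = ee (- t)"
  by (simp add: ee_def cis_cnj)

lemma ee_of_int [simp]: "ee (of_int n) = 1"
  by (simp add: ee_def complex_eq_iff)

text \<open>A weak form of Jordan's inequality. Up to \<open>pi / 3\<close> the function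
  \<open>sin u - u / 2\<close> is nondecreasing; beyond, \<open>sin t\<close> is at least
  \<open>sqrt 3 / 2\<close>, which exceeds \<open>pi / 6\<close>.\<close>

lemma sin_ge_third: "t / 3 \<le> sin t" if t: "0 \<le> t" "t \<le> pi / 2" for t :: real
proof (cases "t \<le> pi / 3")
  case True
  have c: "1 / 2 \<le> cos u" if "0 \<le> u" "u \<le> t" for u
    using cos_monotone_0_pi_le[of u "pi/3"] True that by (simp add: cos_60)
  have "sin 0 - 0 / 2 \<le> sin t - t / 2"
  proof (rule DERIV_nonneg_imp_nondecreasing[OF t(1)])
    fix u assume u: "0 \<le> u" "u \<le> t"
    have "((\<lambda>u. sin u - u / 2) has_real_derivative cos u - 1 / 2) (at u)"
      by (auto intro!: derivative_eq_intros)
    then show "\<exists>y. ((\<lambda>u. sin u - u / 2) has_real_derivative y) (at u) \<and> 0 \<le> y"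
      using c[OF u] by auto
  qed
  then show ?thesis using t by simp
next
  case False
  have "sin (pi/3) \<le> sin t"
    using False t by (intro sin_monotone_2pi_le) auto
  moreover have "sin (pi / 3) = sqrt 3 / 2" by (simp add: sin_60)
  moreover have "sqrt 3 \<ge> (1.7::real)" by (rule real_le_rsqrt) (simp add: power2_eq_square)
  ultimately show ?thesis using t pi_less_4 by simp
qed

lemma norm_ee_minus_1: "norm (ee b - 1) = 2 * \<bar>sin (pi * b)\<bar>"
proof -
  have "(norm (ee b - 1))\<^sup>2 = (cos (2 * (pi * b)) - 1)\<^sup>2 + (sin (2 * (pi * b)))\<^sup>2"
    unfolding ee_def by (simp add: cmod_power2 mult.assoc)
  also have "\<dots> = 4 * (sin (pi * b))\<^sup>2 * ((sin (pi * b))\<^sup>2 + (cos (pi * b))\<^sup>2)"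
    unfolding cos_double_sin sin_double by (simp add: power2_eq_square ring_distribs)
  also have "\<dots> = (2 * \<bar>sin (pi * b)\<bar>)\<^sup>2"
    by (simp add: power_mult_distrib)
  finally show ?thesis
    by (rule power2_eq_imp_eq) auto
qed

text \<open>Both ends of the unit interval are integers, and each gets its own term. The two terms
  can then be summed separately over a separated set of points.\<close>

lemma inverse_norm_ee_minus_1_le:
  assumes b: "0 < b" "b < 1"
  shows "1 / norm (ee b - 1) \<le> 1 / b + 1 / (1 - b)"
proof -
  have *: "1 / (2 * sin (pi * c)) \<le> 1 / c" if c: "0 < c" "c \<le> 1 / 2" for c
  proof -
    have "pi * c / 3 \<le> sin (pi * c)" using c by (intro sin_ge_third) auto
    moreover have "2 * c \<le> pi * c" using pi_ge_two c by (intro mult_right_mono) auto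
    ultimately have "c \<le> 2 * sin (pi * c)" using c by linarith
    then show ?thesis using c by (intro divide_left_mono) auto
  qed
  have s: "sin (pi * b) > 0" using b by (intro sin_gt_zero) auto
  have eq: "sin (pi * (1 - b)) = sin (pi * b)"
    by (simp add: right_diff_distrib)
  show ?thesis
    unfolding norm_ee_minus_1
  proof (cases "b \<le> 1 / 2")
    case True
    show "1 / (2 * \<bar>sin (pi * b)\<bar>) \<le> 1 / b + 1 / (1 - b)"
      using *[OF b(1) True] b s divide_nonneg_pos[of 1 "1 - b"] unfolding abs_of_pos[OF s] by linarith
  next
    case False
    show "1 / (2 * \<bar>sin (pi * b)\<bar>) \<le> 1 / b + 1 / (1 - b)"
      using *[of "1 - b"] b False s divide_nonneg_pos[of 1 b] unfolding eq abs_of_pos[OF s] by linarith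
  qed
qed

lemma ee_geometric:
  assumes "n \<ge> -m"
  shows "(\<Sum>k\<in>{-m..n::int}. ee (of_int k * b)) * (ee b - 1) = ee (of_int (n + 1) * b) - ee (of_int (-m) * b)"
  using assms
proof (induction n rule: int_ge_induct)
  case base
  show ?case by (simp add: algebra_simps flip: ee_add)
next
  case (step n)
  have "{-m..n + 1} = insert (n + 1) {-m..n}" using step(1) by auto
  then show ?case
    using step(2) by (simp add: algebra_simps flip: ee_add)
qed

text \<open>The geometric sum times \<open>ee b - 1\<close> is a difference of two numbers of
  modulus 1, so the bound is uniform in \<open>N\<close>.\<close>

lemma norm_ee_sum_le:
  assumes b: "0 < b" "b < 1"
  shows "norm (\<Sum>k\<in>{- int N..int N}. ee (of_int k * b)) \<le> 2 / b + 2 / (1 - b)"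
proof -
  have pos: "norm (ee b - 1) > 0"
    using b sin_gt_zero[of "pi * b"] by (simp add: norm_ee_minus_1)
  have "norm (\<Sum>k\<in>{- int N..int N}. ee (of_int k * b)) * norm (ee b - 1) \<le> 1 + 1"
  proof -
    have "- int N \<le> int N" by simp
    from ee_geometric[OF this, of b] show ?thesis
      unfolding norm_mult[symmetric] by (metis norm_triangle_ineq4 norm_ee)
  qed
  then have "norm (\<Sum>k\<in>{- int N..int N}. ee (of_int k * b)) \<le> 2 * (1 / norm (ee b - 1))"
    using pos by (simp add: field_simps)
  also have "\<dots> \<le> 2 * (1 / b + 1 / (1 - b))"
    using inverse_norm_ee_minus_1_le[OF b] by (intro mult_left_mono) auto
  finally show ?thesis by simp
qed

lemma sum_inverse_le_ln: "(\<Sum>k = 1..n. 1 / real k) \<le> 1 + ln (real (max 1 n))"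
proof (induction n)
  case (Suc n)
  show ?case
  proof (cases "n = 0")
    case False
    have "ln (real n / real (Suc n)) \<le> real n / real (Suc n) - 1"
      using False by (intro ln_le_minus_one) auto
    then have "1 / real (Suc n) \<le> ln (real (Suc n)) - ln (real n)"
      using False by (simp add: ln_div field_simps)
    then show ?thesis using Suc False by simp
  qed auto
qed auto

text \<open>Separation makes the map from \<open>s\<close> to the floor of \<open>s / d\<close>
  injective, with values between 1 and \<open>1 / d\<close>. A harmonic sum divided by
  \<open>d\<close> therefore dominates.\<close>

lemma separated_sum_inverse_le:
  fixes S :: "real set"
  assumes fin: "finite S" and d: "0 < d" "d \<le> 1"
    and S: "\<And>s. s \<in> S \<Longrightarrow> d \<le> s \<and> s \<le> 1"
    and sep: "\<And>s t. s \<in> S \<Longrightarrow> t \<in> S \<Longrightarrow> s \<noteq> t \<Longrightarrow> d \<le> \<bar>s - t\<bar>"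
  shows "(\<Sum>s\<in>S. 1 / s) \<le> (1 + ln (1 / d)) / d"
proof -
  define f where "f s = nat \<lfloor>s / d\<rfloor>" for s
  have f1: "real (f s) * d \<le> s" "1 \<le> f s" "f s \<le> nat \<lfloor>1/d\<rfloor>" if "s \<in> S" for s
  proof -
    have "1 \<le> s / d" using S[OF that] d by simp
    then show "1 \<le> f s" unfolding f_def by linarith
    have "real (f s) \<le> s / d" unfolding f_def using \<open>1 \<le> s / d\<close> by linarith
    then show "real (f s) * d \<le> s" using d by (simp add: field_simps)
    show "f s \<le> nat \<lfloor>1/d\<rfloor>" unfolding f_def
      using S[OF that] d by (intro nat_mono floor_mono divide_right_mono) auto
  qed
  have inj: "inj_on f S"
  proof (rule inj_onI, rule ccontr)
    fix s t assume st: "s \<in> S" "t \<in> S" "f s = f t" "s \<noteq> t"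
    then have "1 \<le> \<bar>s - t\<bar> / d" using sep[of s t] d by simp
    then have "1 \<le> \<bar>s / d - t / d\<bar>" using d by (simp add: diff_divide_distrib[symmetric] abs_divide)
    moreover have "\<lfloor>s / d\<rfloor> = \<lfloor>t / d\<rfloor>"
      using st(3) f1(2)[OF st(1)] f1(2)[OF st(2)] unfolding f_def by linarith
    ultimately show False by linarith
  qed
  have ge1: "1 \<le> nat \<lfloor>1/d\<rfloor>" using d by (simp add: le_nat_iff le_floor_iff)
  have "(\<Sum>s\<in>S. 1 / s) \<le> (\<Sum>s\<in>S. 1 / (real (f s) * d))"
  proof (intro sum_mono divide_left_mono)
    fix s assume s: "s \<in> S"
    then show "real (f s) * d \<le> s" using f1 by blast
    have "0 < s" using S[OF s] d by linarith
    then show "0 < s * (real (f s) * d)"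
      using f1(2)[OF s] d by simp
  qed simp
  also have "\<dots> = (\<Sum>k\<in>f ` S. 1 / (real k * d))"
    using inj by (simp add: sum.reindex)
  also have "\<dots> \<le> (\<Sum>k\<in>{1..nat \<lfloor>1/d\<rfloor>}. 1 / (real k * d))"
    using f1 d by (intro sum_mono2) auto
  also have "\<dots> = (\<Sum>k\<in>{1..nat \<lfloor>1/d\<rfloor>}. 1 / real k) / d"
    by (simp add: sum_divide_distrib)
  also have "\<dots> \<le> (1 + ln (1 / d)) / d"
  proof -
    have "ln (real (max 1 (nat \<lfloor>1/d\<rfloor>))) \<le> ln (1 / d)"
    proof (subst ln_le_cancel_iff)
      show "real (max 1 (nat \<lfloor>1/d\<rfloor>)) \<le> 1 / d" using ge1 d unfolding max_absorb2[OF ge1] by simp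
    qed (use d in auto)
    then show ?thesis
      using sum_inverse_le_ln[of "nat \<lfloor>1/d\<rfloor>"] d by (intro divide_right_mono) linarith+
  qed
  finally show ?thesis .
qed

definition expsum :: "int set \<Rightarrow> real \<Rightarrow> complex" where
  "expsum A \<alpha> = (\<Sum>a\<in>A. ee (of_int a * \<alpha>))"

text \<open>The row sum for Schur's test. The point \<open>s\<close> itself gives
  \<open>2 * N + 1\<close>. The factor 8 is 2 * 2 * 2: two sides of \<open>s\<close>, two ends of
  the unit interval, and the 2 in the kernel bound.\<close>

lemma separated_kernel_sum_le:
  fixes P :: "real set"
  assumes fin: "finite P" and d: "0 < d" "d \<le> 1" and P: "P \<subseteq> {0..<1}"
    and sep: "\<And>s t. s \<in> P \<Longrightarrow> t \<in> P \<Longrightarrow> s < t \<Longrightarrow> d \<le> t - s \<and> d \<le> 1 - (t - s)"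
    and s: "s \<in> P"
  shows "(\<Sum>t\<in>P. norm (\<Sum>k\<in>{- int N..int N}. ee (of_int k * (s - t))))
           \<le> (2 * real N + 1) + 8 * ((1 + ln (1 / d)) / d)"
proof -
  define W where "W b = norm (\<Sum>k\<in>{- int N..int N}. ee (of_int k * b))" for b
  define C where "C = (1 + ln (1 / d)) / d"
  have Wneg: "W (- b) = W b" for b
  proof -
    have "(\<Sum>k\<in>{- int N..int N}. ee (of_int k * - b)) = cnj (\<Sum>k\<in>{- int N..int N}. ee (of_int k * b))"
      unfolding cnj_sum cnj_ee by simp
    then show ?thesis by (simp only: W_def complex_mod_cnj)
  qed
  have half: "(\<Sum>t\<in>Q. W (g t)) \<le> 4 * C"
    if Q: "Q \<subseteq> P" and g: "\<And>t. t \<in> Q \<Longrightarrow> d \<le> g t \<and> d \<le> 1 - g t"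
      and gd: "\<And>t u. t \<in> Q \<Longrightarrow> u \<in> Q \<Longrightarrow> \<bar>g t - g u\<bar> = \<bar>t - u\<bar>" for Q g
  proof -
    have finQ: "finite Q" using Q fin finite_subset by blast
    have inj: "inj_on g Q" using gd by (fastforce intro: inj_onI)
    have sepQ: "d \<le> \<bar>t - u\<bar>" if "t \<in> Q" "u \<in> Q" "t \<noteq> u" for t u
      using sep[of t u] sep[of u t] that Q by (cases "t < u") (auto simp: subset_iff)
    have "(\<Sum>t\<in>Q. W (g t)) \<le> (\<Sum>t\<in>Q. 2 / g t + 2 / (1 - g t))"
      unfolding W_def
    proof (intro sum_mono norm_ee_sum_le)
      fix t assume "t \<in> Q"
      then show "0 < g t" "g t < 1" using g[of t] d by auto
    qed
    also have "\<dots> = 2 * (\<Sum>t\<in>Q. 1 / g t) + 2 * (\<Sum>t\<in>Q. 1 / (1 - g t))"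
      by (simp add: sum.distrib sum_distrib_left)
    also have "(\<Sum>t\<in>Q. 1 / g t) = (\<Sum>u\<in>g ` Q. 1 / u)"
      using inj by (simp add: sum.reindex)
    also have "\<dots> \<le> C" unfolding C_def
    proof (rule separated_sum_inverse_le)
      fix u v assume "u \<in> g ` Q" "v \<in> g ` Q" "u \<noteq> v"
      then obtain t t' where "t \<in> Q" "t' \<in> Q" "u = g t" "v = g t'" "t \<noteq> t'" by blast
      then show "d \<le> \<bar>u - v\<bar>" using gd sepQ by simp
    next
      fix u assume "u \<in> g ` Q"
      then show "d \<le> u \<and> u \<le> 1" using g d by fastforce
    qed (use finQ d in auto)
    also have "(\<Sum>t\<in>Q. 1 / (1 - g t)) = (\<Sum>u\<in>(\<lambda>t. 1 - g t) ` Q. 1 / u)"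
      using inj by (subst sum.reindex) (auto simp: inj_on_def)
    also have "\<dots> \<le> C" unfolding C_def
    proof (rule separated_sum_inverse_le)
      fix u v assume "u \<in> (\<lambda>t. 1 - g t) ` Q" "v \<in> (\<lambda>t. 1 - g t) ` Q" "u \<noteq> v"
      then obtain t t' where "t \<in> Q" "t' \<in> Q" "u = 1 - g t" "v = 1 - g t'" "t \<noteq> t'" by blast
      then show "d \<le> \<bar>u - v\<bar>" using gd[of t t'] sepQ[of t t'] by linarith
    next
      fix u assume "u \<in> (\<lambda>t. 1 - g t) ` Q"
      then show "d \<le> u \<and> u \<le> 1" using g d by fastforce
    qed (use finQ d in auto)
    finally show ?thesis by simp
  qed
  have "P = {s} \<union> ({t\<in>P. t < s} \<union> {t\<in>P. s < t})" using s by auto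
  then have "(\<Sum>t\<in>P. W (s - t)) = (\<Sum>t\<in>{s} \<union> ({t\<in>P. t < s} \<union> {t\<in>P. s < t}). W (s - t))"
    by simp
  also have "\<dots> = W 0 + ((\<Sum>t\<in>{t\<in>P. t < s}. W (s - t)) + (\<Sum>t\<in>{t\<in>P. s < t}. W (- (t - s))))"
    using fin by (subst sum.union_disjoint; (subst sum.union_disjoint)?) auto
  also have "\<dots> \<le> (2 * real N + 1) + (4 * C + 4 * C)"
    unfolding Wneg
  proof (intro add_mono half)
    show "W 0 \<le> 2 * real N + 1"
      unfolding W_def by (rule order_trans[OF norm_sum]) simp
  qed (use sep s in auto)
  finally show ?thesis by (simp add: W_def C_def)
qed

lemma sum_power2_le_card:
  fixes g :: "'a \<Rightarrow> real"
  shows "(\<Sum>a\<in>A. g a)\<^sup>2 \<le> (\<Sum>a\<in>A. 1) * (\<Sum>a\<in>A. (g a)\<^sup>2)"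
proof -
  have "(\<Sum>a\<in>A. g a)\<^sup>2 = (\<Sum>a\<in>A. \<Sum>b\<in>A. g a * g b)"
    by (simp add: power2_eq_square sum_product)
  also have "\<dots> \<le> (\<Sum>a\<in>A. \<Sum>b\<in>A. (g a)\<^sup>2 / 2 + (g b)\<^sup>2 / 2)"
  proof (intro sum_mono)
    fix a b
    have "0 \<le> (g a - g b)\<^sup>2" by simp
    then show "g a * g b \<le> (g a)\<^sup>2 / 2 + (g b)\<^sup>2 / 2" by (simp add: power2_diff)
  qed
  also have "\<dots> = (\<Sum>a\<in>A. 1) * (\<Sum>a\<in>A. (g a)\<^sup>2)"
    by (simp add: sum.distrib flip: sum_divide_distrib sum_distrib_left)
  finally show ?thesis .
qed

text \<open>By duality it suffices to bound a quadratic form in the points of \<open>P\<close>, which Schur's test does.\<close>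

lemma large_sieve:
  fixes P :: "real set" and A :: "int set"
  assumes fin: "finite P" and d: "0 < d" "d \<le> 1" and P: "P \<subseteq> {0..<1}"
    and sep: "\<And>s t. s \<in> P \<Longrightarrow> t \<in> P \<Longrightarrow> s < t \<Longrightarrow> d \<le> t - s \<and> d \<le> 1 - (t - s)"
    and A: "A \<subseteq> {- int N..int N}"
  shows "(\<Sum>\<alpha>\<in>P. (norm (expsum A \<alpha>))\<^sup>2)
           \<le> ((2 * real N + 1) + 8 * ((1 + ln (1 / d)) / d)) * real (card A)"
proof -
  define K where "K = (2 * real N + 1) + 8 * ((1 + ln (1 / d)) / d)"
  define S where "S = expsum A"
  define T where "T = (\<Sum>\<alpha>\<in>P. (norm (S \<alpha>))\<^sup>2)"
  define I where "I = {- int N..int N}"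
  define g where "g k = (\<Sum>\<alpha>\<in>P. cnj (S \<alpha>) * ee (of_int k * \<alpha>))" for k :: int
  define W where "W b = (\<Sum>k\<in>I. ee (of_int k * b))" for b
  have finA: "finite A" and finI: "finite I" using A finite_subset by (auto simp: I_def)
  have T0: "T \<ge> 0" unfolding T_def by (intro sum_nonneg) auto
  have K0: "K \<ge> 0" using d unfolding K_def by simp
  have "complex_of_real T = (\<Sum>\<alpha>\<in>P. cnj (S \<alpha>) * S \<alpha>)"
    unfolding T_def of_real_sum by (intro sum.cong refl) (metis complex_norm_square mult.commute)
  also have "\<dots> = (\<Sum>a\<in>A. g a)"
    unfolding g_def S_def expsum_def sum_distrib_left by (rule sum.swap)
  finally have "T = norm (\<Sum>a\<in>A. g a)" using T0 by (metis norm_of_real abs_of_nonneg)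
  also have "\<dots> \<le> (\<Sum>a\<in>A. 1 * norm (g a))" by (simp add: norm_sum)
  finally have "T\<^sup>2 \<le> (\<Sum>a\<in>A. 1 * norm (g a))\<^sup>2" using T0 by (intro power_mono) auto
  also have "\<dots> \<le> (\<Sum>a\<in>A. 1\<^sup>2) * (\<Sum>a\<in>A. (norm (g a))\<^sup>2)"
    unfolding power_one mult_1_left by (rule sum_power2_le_card)
  \<comment> \<open>Passing from \<open>A\<close> to the whole interval keeps only
    \<open>card A\<close> in the bound and makes the kernel \<open>W\<close> a full geometric
    sum.\<close>
  also have "\<dots> \<le> real (card A) * (\<Sum>k\<in>I. (norm (g k))\<^sup>2)"
    using A finI by (auto simp: I_def intro!: mult_left_mono sum_mono2)
  also have "(\<Sum>k\<in>I. (norm (g k))\<^sup>2) \<le> K * T"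
  proof -
    have "complex_of_real (\<Sum>k\<in>I. (norm (g k))\<^sup>2) = (\<Sum>k\<in>I. g k * cnj (g k))"
      unfolding of_real_sum by (intro sum.cong refl) (metis complex_norm_square)
    also have "\<dots> = (\<Sum>k\<in>I. \<Sum>\<alpha>\<in>P. \<Sum>\<beta>\<in>P. cnj (S \<alpha>) * S \<beta> * ee (of_int k * (\<alpha> - \<beta>)))"
      unfolding g_def cnj_sum sum_product
      by (intro sum.cong refl) (simp add: cnj_ee right_diff_distrib ee_add[of _ "- _", simplified])
    also have "\<dots> = (\<Sum>\<alpha>\<in>P. \<Sum>\<beta>\<in>P. cnj (S \<alpha>) * S \<beta> * W (\<alpha> - \<beta>))"
      unfolding W_def sum_distrib_left by (subst sum.swap) (intro sum.cong refl sum.swap)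
    finally have e: "complex_of_real (\<Sum>k\<in>I. (norm (g k))\<^sup>2)
        = (\<Sum>\<alpha>\<in>P. \<Sum>\<beta>\<in>P. cnj (S \<alpha>) * S \<beta> * W (\<alpha> - \<beta>))" .
    have nn: "0 \<le> (\<Sum>k\<in>I. (norm (g k))\<^sup>2)" by (intro sum_nonneg) auto
    have "(\<Sum>k\<in>I. (norm (g k))\<^sup>2) = norm (\<Sum>\<alpha>\<in>P. \<Sum>\<beta>\<in>P. cnj (S \<alpha>) * S \<beta> * W (\<alpha> - \<beta>))"
      unfolding e[symmetric] norm_of_real using nn by (simp only: abs_of_nonneg)
    also have "\<dots> \<le> (\<Sum>\<alpha>\<in>P. \<Sum>\<beta>\<in>P. norm (S \<alpha>) * norm (S \<beta>) * norm (W (\<alpha> - \<beta>)))"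
      by (intro order_trans[OF norm_sum] sum_mono) (simp add: norm_mult)
    \<comment> \<open>Schur's test: after \<open>u * v <= u^2 / 2 + v^2 / 2\<close> the two halves
      agree, because \<open>W (- b)\<close> is the conjugate of \<open>W b\<close>.\<close>
    also have "\<dots> \<le> (\<Sum>\<alpha>\<in>P. \<Sum>\<beta>\<in>P. ((norm (S \<alpha>))\<^sup>2 / 2 + (norm (S \<beta>))\<^sup>2 / 2) * norm (W (\<alpha> - \<beta>)))"
    proof (intro sum_mono mult_right_mono)
      fix \<alpha> \<beta>
      have "0 \<le> (norm (S \<alpha>) - norm (S \<beta>))\<^sup>2" by simp
      then show "norm (S \<alpha>) * norm (S \<beta>) \<le> (norm (S \<alpha>))\<^sup>2 / 2 + (norm (S \<beta>))\<^sup>2 / 2"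
        by (simp add: power2_diff)
    qed auto
    also have "\<dots> = (\<Sum>\<alpha>\<in>P. \<Sum>\<beta>\<in>P. (norm (S \<alpha>))\<^sup>2 / 2 * norm (W (\<alpha> - \<beta>)))
        + (\<Sum>\<alpha>\<in>P. \<Sum>\<beta>\<in>P. (norm (S \<beta>))\<^sup>2 / 2 * norm (W (\<alpha> - \<beta>)))"
      by (simp add: distrib_right sum.distrib)
    also have "(\<Sum>\<alpha>\<in>P. \<Sum>\<beta>\<in>P. (norm (S \<beta>))\<^sup>2 / 2 * norm (W (\<alpha> - \<beta>)))
        = (\<Sum>\<beta>\<in>P. \<Sum>\<alpha>\<in>P. (norm (S \<beta>))\<^sup>2 / 2 * norm (W (\<beta> - \<alpha>)))"
    proof (subst sum.swap, intro sum.cong refl)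
      fix \<alpha> \<beta>
      have "W (\<alpha> - \<beta>) = cnj (W (\<beta> - \<alpha>))" unfolding W_def cnj_sum cnj_ee
        by (intro sum.cong refl arg_cong[of _ _ ee]) (simp add: algebra_simps)
      then show "(norm (S \<beta>))\<^sup>2 / 2 * norm (W (\<alpha> - \<beta>)) = (norm (S \<beta>))\<^sup>2 / 2 * norm (W (\<beta> - \<alpha>))"
        by simp
    qed
    also have "(\<Sum>\<alpha>\<in>P. \<Sum>\<beta>\<in>P. (norm (S \<alpha>))\<^sup>2 / 2 * norm (W (\<alpha> - \<beta>))) + \<dots>
        = (\<Sum>\<alpha>\<in>P. (norm (S \<alpha>))\<^sup>2 * (\<Sum>\<beta>\<in>P. norm (W (\<alpha> - \<beta>))))"
      by (simp add: sum_distrib_left mult.commute flip: sum.distrib)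
    also have "\<dots> \<le> (\<Sum>\<alpha>\<in>P. (norm (S \<alpha>))\<^sup>2 * K)"
      unfolding K_def W_def I_def
      by (intro sum_mono mult_left_mono separated_kernel_sum_le fin d P sep) auto
    also have "\<dots> = K * T" unfolding T_def sum_distrib_right[symmetric] by (rule mult.commute)
    finally show ?thesis .
  qed
  finally have "T\<^sup>2 \<le> real (card A) * (K * T)"
    by (simp add: mult_left_mono)
  then have "T * T \<le> K * real (card A) * T"
    by (simp add: power2_eq_square mult_ac)
  then have "T \<le> K * real (card A)"
    using T0 K0 by (cases "T = 0") auto
  then show ?thesis by (simp add: T_def S_def K_def)
qed

section \<open>Sums in residue classes\<close>

lemma ee_power: "ee t ^ n = ee (of_nat n * t)"
  by (simp add: ee_def DeMoivre mult_ac)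

lemma ee_eq_1_imp_Ints: "t \<in> \<int>" if "ee t = 1"
proof -
  have "sin (pi * t) = 0" using that norm_ee_minus_1[of t] by simp
  then obtain i where "pi * t = of_int i * pi" by (auto simp: sin_zero_iff_int2)
  then show ?thesis by simp
qed

lemma sum_ee_div:
  fixes n :: int and d :: nat
  assumes d: "d > 0"
  shows "(\<Sum>h<d. ee (of_int n * (of_nat h / of_nat d))) = (if int d dvd n then of_nat d else 0)"
proof -
  define z where "z = ee (of_int n / of_nat d)"
  have eq: "ee (of_int n * (of_nat h / of_nat d)) = z ^ h" for h
    by (simp add: z_def ee_power mult_ac)
  show ?thesis
  proof (cases "int d dvd n")
    case True
    then obtain k where "n = int d * k" by blast
    then have "z = 1" using d by (simp add: z_def)
    then show ?thesis unfolding eq using True by simp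
  next
    case False
    have "z \<noteq> 1"
    proof
      assume "z = 1"
      then obtain k where "of_int n / real d = of_int k"
        unfolding z_def using ee_eq_1_imp_Ints Ints_cases by blast
      then have "real_of_int n = real_of_int (int d * k)" using d by (simp add: field_simps)
      then show False using False by (metis dvd_triv_left of_int_eq_iff)
    qed
    moreover have "z ^ d = 1" using d by (simp add: z_def ee_power)
    ultimately show ?thesis unfolding eq using False by (simp add: geometric_sum)
  qed
qed

lemma card_dvd_sum_eq_expsum:
  fixes A B :: "int set" and d :: nat
  assumes "finite A" "finite B" and d: "d > 0"
  shows "of_nat d * of_nat (card {(a, b). a \<in> A \<and> b \<in> B \<and> int d dvd a + b})
           = (\<Sum>h<d. expsum A (real h / real d) * expsum B (real h / real d))"
proof -
  have "(\<Sum>h<d. expsum A (real h / real d) * expsum B (real h / real d))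
      = (\<Sum>h<d. \<Sum>a\<in>A. \<Sum>b\<in>B. ee (of_int (a + b) * (real h / real d)))"
    unfolding expsum_def sum_product by (simp add: ring_distribs ee_add add_divide_distrib)
  also have "\<dots> = (\<Sum>a\<in>A. \<Sum>h<d. \<Sum>b\<in>B. ee (of_int (a + b) * (real h / real d)))"
    by (rule sum.swap)
  also have "\<dots> = (\<Sum>a\<in>A. \<Sum>b\<in>B. if int d dvd a + b then of_nat d else 0)"
    by (intro sum.cong refl, subst sum.swap, intro sum.cong refl sum_ee_div d)
  also have "\<dots> = (\<Sum>(a,b)\<in>A \<times> B. if int d dvd a + b then of_nat d else 0)"
    by (rule sum.cartesian_product)
  also have "\<dots> = (\<Sum>ab\<in>{ab \<in> A \<times> B. int d dvd fst ab + snd ab}. of_nat d)"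
    using assms by (subst sum.inter_filter) (auto intro!: sum.cong)
  also have "{ab \<in> A \<times> B. int d dvd fst ab + snd ab} = {(a, b). a \<in> A \<and> b \<in> B \<and> int d dvd a + b}"
    by auto
  finally show ?thesis by (simp add: mult.commute)
qed

text \<open>The frequency \<open>h = 0\<close> is the main term. The others are split by
  \<open>2 * u * v <= u^2 + v^2\<close>, which separates \<open>A\<close> from \<open>B\<close> and
  stays additive in \<open>d\<close>, ready for the large sieve. The price is
  \<open>|A| + |B|\<close> in place of a geometric mean, which is harmless when both sets are
  large.\<close>

lemma card_dvd_sum_deviation_le:
  fixes A B :: "int set" and d :: nat
  assumes fin: "finite A" "finite B" and d: "d > 0"
  shows "\<bar>real (card {(a, b). a \<in> A \<and> b \<in> B \<and> int d dvd a + b}) - real (card A) * real (card B) / real d\<bar>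
      \<le> (\<Sum>h\<in>{1..<d}. (norm (expsum A (real h / real d)))\<^sup>2 / real d) / 2
        + (\<Sum>h\<in>{1..<d}. (norm (expsum B (real h / real d)))\<^sup>2 / real d) / 2"
proof -
  define c where "c = real (card {(a, b). a \<in> A \<and> b \<in> B \<and> int d dvd a + b})"
  define a where "a h = expsum A (real h / real d)" for h
  define b where "b h = expsum B (real h / real d)" for h
  have "{..<d} = insert 0 {1..<d}" using d by auto
  then have "complex_of_real (real d * c) = of_nat (card A) * of_nat (card B) + (\<Sum>h\<in>{1..<d}. a h * b h)"
    using card_dvd_sum_eq_expsum[OF fin d] by (simp add: c_def a_def b_def expsum_def)
  then have "complex_of_real (real d * c - real (card A) * real (card B)) = (\<Sum>h\<in>{1..<d}. a h * b h)"
    by simp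
  then have "\<bar>real d * c - real (card A) * real (card B)\<bar> = norm (\<Sum>h\<in>{1..<d}. a h * b h)"
    by (metis norm_of_real)
  also have "\<dots> \<le> (\<Sum>h\<in>{1..<d}. (norm (a h))\<^sup>2 / 2 + (norm (b h))\<^sup>2 / 2)"
  proof (intro order_trans[OF norm_sum] sum_mono)
    fix h
    have "0 \<le> (norm (a h) - norm (b h))\<^sup>2" by simp
    then show "norm (a h * b h) \<le> (norm (a h))\<^sup>2 / 2 + (norm (b h))\<^sup>2 / 2"
      by (simp add: power2_diff norm_mult)
  qed
  finally have "\<bar>real d * c - real (card A) * real (card B)\<bar> / real d
      \<le> (\<Sum>h\<in>{1..<d}. (norm (a h))\<^sup>2 / 2 + (norm (b h))\<^sup>2 / 2) / real d"
    by (intro divide_right_mono) auto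
  also have "\<bar>real d * c - real (card A) * real (card B)\<bar> / real d = \<bar>c - real (card A) * real (card B) / real d\<bar>"
    using d by (simp add: field_simps flip: abs_div_pos)
  finally show ?thesis
    by (simp add: c_def a_def b_def sum.distrib sum_divide_distrib add_divide_distrib mult_ac)
qed

text \<open>A positive difference has an integer numerator, at least 1, over the denominator
  \<open>q * q'\<close>. Numerators are unrestricted, so that it also applies to a fraction shifted
  by 1.\<close>

lemma fractions_separated:
  fixes q q' h h' Q :: nat
  assumes "real h / real q < real h' / real q'" "0 < q" "q \<le> Q" "0 < q'" "q' \<le> Q"
  shows "1 / (real Q)\<^sup>2 \<le> real h' / real q' - real h / real q"
proof -
  have "h * q' < h' * q" using assms by (simp add: field_simps flip: of_nat_mult)
  then have "1 \<le> real h' * real q - real h * real q'"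
    by (simp flip: of_nat_mult)
  then have "1 / (real q * real q') \<le> (real h' * real q - real h * real q') / (real q * real q')"
    using assms by (intro divide_right_mono) auto
  also have "\<dots> = real h' / real q' - real h / real q" using assms by (simp add: field_simps)
  finally have "1 / (real q * real q') \<le> real h' / real q' - real h / real q" .
  moreover have "1 / (real Q)\<^sup>2 \<le> 1 / (real q * real q')"
    unfolding power2_eq_square using assms by (intro divide_left_mono mult_mono) auto
  ultimately show ?thesis by linarith
qed

lemma large_sieve_fractions:
  fixes A :: "int set"
  assumes A: "A \<subseteq> {- int N..int N}" and Q: "Q \<ge> 1"
  shows "(\<Sum>q\<in>{1..Q}. \<Sum>h\<in>{h. h < q \<and> coprime h q}. (norm (expsum A (real h / real q)))\<^sup>2)
           \<le> ((2 * real N + 1) + 8 * ((1 + 2 * ln (real Q)) * (real Q)\<^sup>2)) * real (card A)"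
proof -
  define I where "I = (SIGMA q:{1..Q}. {h. h < q \<and> coprime h q})"
  define v where "v = (\<lambda>(q, h). real h / real q)"
  have inj: "inj_on v I"
  proof (rule inj_onI)
    fix x y assume xy: "x \<in> I" "y \<in> I" "v x = v y"
    obtain q h q' h' where [simp]: "x = (q, h)" "y = (q', h')" by fastforce
    have "h * q' = h' * q" using xy by (simp add: v_def I_def field_simps flip: of_nat_mult)
    then show "x = y" using xy coprime_crossproduct_nat[of h q h' q']
      by (auto simp: I_def coprime_commute)
  qed
  have "(\<Sum>q\<in>{1..Q}. \<Sum>h\<in>{h. h < q \<and> coprime h q}. (norm (expsum A (real h / real q)))\<^sup>2)
      = (\<Sum>x\<in>I. (norm (expsum A (v x)))\<^sup>2)"
    unfolding I_def by (subst sum.Sigma) (auto simp: v_def intro!: sum.cong)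
  also have "\<dots> = (\<Sum>\<alpha>\<in>v ` I. (norm (expsum A \<alpha>))\<^sup>2)"
    using inj by (simp add: sum.reindex)
  also have "\<dots> \<le> ((2 * real N + 1) + 8 * ((1 + ln (1 / (1 / (real Q)\<^sup>2))) / (1 / (real Q)\<^sup>2))) * real (card A)"
  proof (rule large_sieve[OF _ _ _ _ _ A])
    show "finite (v ` I)" unfolding I_def by auto
    show "v ` I \<subseteq> {0..<1}" by (auto simp: I_def v_def)
    fix s t assume "s \<in> v ` I" "t \<in> v ` I" and lt: "s < t"
    then obtain q h q' h' where st: "s = real h / real q" "t = real h' / real q'"
      "0 < q" "q \<le> Q" "0 < q'" "q' \<le> Q" "h < q" "h' < q'"
      unfolding I_def v_def by auto
    have "real h' / real q' < 1" "0 \<le> real h / real q" using st by auto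
    \<comment> \<open>For the distance around the circle: \<open>s + 1\<close> is the fraction
      \<open>(h + q) / q\<close>, with the same denominator.\<close>
    then have "real h' / real q' < real h / real q + 1" by linarith
    then have "real h' / real q' < real (h + q) / real q" using st by (simp add: add_divide_distrib)
    from fractions_separated[OF this, of Q] st have "1 / (real Q)\<^sup>2 \<le> 1 - (t - s)"
      by (simp add: add_divide_distrib algebra_simps)
    moreover have "1 / (real Q)\<^sup>2 \<le> t - s"
      using fractions_separated[of h q h' q' Q] lt st by simp
    ultimately show "1 / (real Q)\<^sup>2 \<le> t - s \<and> 1 / (real Q)\<^sup>2 \<le> 1 - (t - s)" by blast
  qed (use Q in auto)
  finally show ?thesis using Q by (simp add: ln_realpow)
qed

text \<open>Partial summation: \<open>1 / q\<close> is \<open>1 / (R + 1)\<close> plus the sum of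
  \<open>1 / (Q * (Q + 1))\<close> over \<open>Q = q..R\<close>.\<close>

lemma sum_over_index_eq:
  fixes f :: "nat \<Rightarrow> real"
  assumes "1 \<le> m" "m \<le> R"
  shows "(\<Sum>q=m..R. f q / real q)
       = (\<Sum>q=m..R. f q) / (real R + 1) + (\<Sum>Q=m..R. (\<Sum>q=m..Q. f q) / (real Q * (real Q + 1)))"
  using assms(2)
proof (induction R rule: dec_induct)
  case base
  then show ?case using assms(1) by (simp add: divide_simps) (simp add: algebra_simps)
next
  case (step R)
  have R: "real R > 0" using step assms by simp
  define F where "F = (\<Sum>q=m..R. f q)"
  have "F / (real R + 1) = F / (real R + 2) + F / ((real R + 1) * (real R + 2))"
    using R by (simp add: divide_simps) (simp add: algebra_simps)
  moreover have "f (Suc R) / (real R + 1) = f (Suc R) / (real R + 2) + f (Suc R) / ((real R + 1) * (real R + 2))"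
    using R by (simp add: divide_simps) (simp add: algebra_simps)
  ultimately show ?case
    using step by (simp add: F_def[symmetric] add_divide_distrib add_ac)
qed

text \<open>The hypothesis \<open>F\<close> has the shape of the large sieve bound. Starting at
  \<open>m\<close> is what reduces the contribution of the constant \<open>a\<close> to order
  \<open>a / m\<close>; the part \<open>b * Q^2\<close> contributes \<open>b\<close> for each
  \<open>Q\<close>, hence order \<open>b * R\<close>.\<close>

lemma sum_over_index_le:
  fixes f :: "nat \<Rightarrow> real"
  assumes m: "1 \<le> m" "m \<le> R" and f: "\<And>q. 0 \<le> f q" and ab: "0 \<le> a" "0 \<le> b"
    and F: "\<And>Q. Q \<in> {1..R} \<Longrightarrow> (\<Sum>q=1..Q. f q) \<le> a + b * (real Q)\<^sup>2"
  shows "(\<Sum>q=m..R. f q / real q) \<le> 2 * a / real m + 2 * b * real R"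
proof -
  have F': "(\<Sum>q=m..Q. f q) \<le> a + b * (real Q)\<^sup>2" if "Q \<in> {m..R}" for Q
    by (rule order_trans[OF sum_mono2 F]) (use that m f in auto)
  have tel: "(\<Sum>Q=m..R. 1 / (real Q * (real Q + 1))) = 1 / real m - 1 / (real R + 1)"
    using m(2)
  proof (induction R rule: dec_induct)
    case base
    then show ?case using m by (simp add: field_simps)
  next
    case (step R)
    have "1 / (real (Suc R) * (real (Suc R) + 1)) = 1 / (real R + 1) - 1 / (real (Suc R) + 1)"
      by (simp add: divide_simps)
    with step show ?case by simp
  qed
  have "(\<Sum>q=m..R. f q) / (real R + 1) \<le> (a + b * (real R)\<^sup>2) / (real R + 1)"
    using F'[of R] m by (intro divide_right_mono) auto
  also have "\<dots> \<le> a / (real R + 1) + b * real R"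
  proof -
    have "b * (real R)\<^sup>2 \<le> b * real R * (real R + 1)"
      using ab by (simp add: power2_eq_square algebra_simps)
    then have "b * (real R)\<^sup>2 / (real R + 1) \<le> b * real R" by (subst pos_divide_le_eq) auto
    then show ?thesis by (simp add: add_divide_distrib)
  qed
  finally have 1: "(\<Sum>q=m..R. f q) / (real R + 1) \<le> a / (real R + 1) + b * real R" .
  have "(\<Sum>Q=m..R. (\<Sum>q=m..Q. f q) / (real Q * (real Q + 1)))
      \<le> (\<Sum>Q=m..R. a * (1 / (real Q * (real Q + 1))) + b)"
  proof (rule sum_mono)
    fix Q assume Q: "Q \<in> {m..R}"
    have "(\<Sum>q=m..Q. f q) / (real Q * (real Q + 1)) \<le> (a + b * (real Q)\<^sup>2) / (real Q * (real Q + 1))"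
      using F'[OF Q] by (intro divide_right_mono) auto
    also have "\<dots> \<le> (a + b * (real Q * (real Q + 1))) / (real Q * (real Q + 1))"
      using ab by (intro divide_right_mono add_mono mult_left_mono) (auto simp: power2_eq_square algebra_simps)
    also have "\<dots> = a * (1 / (real Q * (real Q + 1))) + b"
      using Q m by (simp add: add_divide_distrib)
    finally show "(\<Sum>q=m..Q. f q) / (real Q * (real Q + 1)) \<le> a * (1 / (real Q * (real Q + 1))) + b" .
  qed
  also have "\<dots> = a * (1 / real m - 1 / (real R + 1)) + b * (real R - real m + 1)"
    unfolding sum.distrib sum_distrib_left[symmetric] tel using m by (simp add: of_nat_diff)
  also have "\<dots> \<le> a * (1 / real m - 1 / (real R + 1)) + b * real R"
    using m ab by (intro add_left_mono mult_left_mono) auto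
  finally have "(\<Sum>q=m..R. f q / real q) \<le> a / real m + 2 * b * real R"
    using 1 sum_over_index_eq[OF m, of f] by (simp add: algebra_simps)
  moreover have "a / real m \<ge> 0" using ab by simp
  ultimately show ?thesis by simp
qed

text \<open>Write \<open>h / d\<close> in lowest terms \<open>h' / q\<close> with
  \<open>d = e * q\<close>. Since \<open>0 < h < d\<close>, the denominator \<open>q\<close> is not
  1; any prime factor of \<open>q\<close> divides \<open>d\<close> and so is at least
  \<open>m\<close>, whence \<open>m \<le> q\<close>. Letting \<open>e\<close> run freely costs one
  harmonic sum.\<close>

lemma sum_fractions_le:
  fixes G :: "real \<Rightarrow> real" and D :: "nat set"
  assumes G: "\<And>t. 0 \<le> G t" and m: "1 \<le> m" and D: "D \<subseteq> {1..R}"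
    and primes: "\<And>d p. d \<in> D \<Longrightarrow> prime p \<Longrightarrow> p dvd d \<Longrightarrow> m \<le> p"
  shows "(\<Sum>d\<in>D. \<Sum>h\<in>{1..<d}. G (real h / real d) / real d)
    \<le> (\<Sum>e=1..R. 1 / real e) * (\<Sum>q=m..R. (\<Sum>h\<in>{h. h < q \<and> coprime h q}. G (real h / real q)) / real q)"
proof -
  define I where "I = (SIGMA d:D. {1..<d})"
  define J where "J = {1..R} \<times> (SIGMA q:{m..R}. {h. h < q \<and> coprime h q})"
  define \<phi> where "\<phi> = (\<lambda>(d::nat, h::nat). (gcd h d, d div gcd h d, h div gcd h d))"
  have finD: "finite D" using D finite_subset by blast
  have "(\<Sum>d\<in>D. \<Sum>h\<in>{1..<d}. G (real h / real d) / real d)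
      = (\<Sum>(d, h)\<in>I. G (real h / real d) / real d)"
    unfolding I_def using finD by (subst sum.Sigma) auto
  also have "\<dots> \<le> (\<Sum>(e, q, h)\<in>J. G (real h / real q) / (real e * real q))"
  proof (rule sum_le_included[where i = "\<lambda>(e, q, h). (e * q, e * h)"])
    show "finite I" "finite J" using finD by (auto simp: I_def J_def)
    show "\<forall>y\<in>J. 0 \<le> (case y of (e, q, h) \<Rightarrow> G (real h / real q) / (real e * real q))"
      using G by auto
    show "\<forall>x\<in>I. \<exists>y\<in>J. (case y of (e, q, h) \<Rightarrow> (e * q, e * h)) = x \<and>
        (case x of (d, h) \<Rightarrow> G (real h / real d) / real d)
          \<le> (case y of (e, q, h) \<Rightarrow> G (real h / real q) / (real e * real q))"
    proof
      fix x assume x: "x \<in> I"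
      obtain d h where xdh: "x = (d, h)" by fastforce
      have d: "d \<in> D" "0 < h" "h < d" "d \<le> R" using x D by (auto simp: xdh I_def)
      define e where "e = gcd h d"
      obtain q where q: "d = e * q" unfolding e_def by (meson dvdE gcd_dvd2)
      obtain h' where h': "h = e * h'" unfolding e_def by (meson dvdE gcd_dvd1)
      have e0: "e > 0" using d by (simp add: e_def)
      have "e * gcd h' q = e * 1"
        unfolding gcd_mult_distrib_nat q[symmetric] h'[symmetric] e_def[symmetric] by simp
      then have "gcd h' q = 1" using e0 by (simp only: mult_cancel1) simp
      then have cop: "coprime h' q" by (simp only: coprime_iff_gcd_eq_1)
      have hq: "h' < q" "0 < h'" using d(2,3) e0 by (auto simp: q h')
      then have "q \<noteq> 1" by simp
      then obtain p where p: "prime p" "p dvd q" using prime_factor_nat by blast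
      have "m \<le> p" using primes[OF d(1) p(1)] p(2) by (simp add: q)
      also have "p \<le> q" using p hq by (auto intro: dvd_imp_le)
      finally have "m \<le> q" .
      moreover have "q \<le> d" "e \<le> d" using e0 hq by (auto simp: q)
      ultimately have "(e, q, h') \<in> J" using d(4) e0 hq cop by (auto simp: J_def)
      moreover have "G (real h / real d) / real d = G (real h' / real q) / (real e * real q)"
        using e0 by (simp add: q h')
      ultimately show "\<exists>y\<in>J. (case y of (e, q, h) \<Rightarrow> (e * q, e * h)) = x \<and>
        (case x of (d, h) \<Rightarrow> G (real h / real d) / real d)
          \<le> (case y of (e, q, h) \<Rightarrow> G (real h / real q) / (real e * real q))"
        by (intro bexI[of _ "(e, q, h')"]) (auto simp: xdh q h')
    qed
  qed
  also have "\<dots> = (\<Sum>e=1..R. \<Sum>q=m..R. \<Sum>h\<in>{h. h < q \<and> coprime h q}. G (real h / real q) / (real e * real q))"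
    unfolding J_def
    by (subst sum.Sigma, simp, simp, subst sum.cartesian_product) (auto intro!: sum.cong)
  also have "\<dots> = (\<Sum>e=1..R. 1 / real e) * (\<Sum>q=m..R. (\<Sum>h\<in>{h. h < q \<and> coprime h q}. G (real h / real q)) / real q)"
    unfolding sum_product sum_divide_distrib by (intro sum.cong refl) (simp add: sum_distrib_left)
  finally show ?thesis .
qed

text \<open>Equidistribution on average over rough moduli. For \<open>m\<close> a small power of
  \<open>N\<close> and \<open>R\<close> slightly below \<open>N\<close>, both terms in the bracket
  save a power of \<open>N\<close>.\<close>

lemma sum_card_dvd_deviation_le:
  fixes A B :: "int set" and D :: "nat set"
  assumes A: "A \<subseteq> {- int N..int N}" and B: "B \<subseteq> {- int N..int N}"
    and m: "1 \<le> m" "m \<le> R" and D: "D \<subseteq> {1..R}"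
    and primes: "\<And>d p. d \<in> D \<Longrightarrow> prime p \<Longrightarrow> p dvd d \<Longrightarrow> m \<le> p"
  shows "(\<Sum>d\<in>D. \<bar>real (card {(a, b). a \<in> A \<and> b \<in> B \<and> int d dvd a + b})
             - real (card A) * real (card B) / real d\<bar>)
    \<le> (1 + ln (real R)) * ((2 * real N + 1) / real m + 8 * (1 + 2 * ln (real R)) * real R)
        * (real (card A) + real (card B))"
proof -
  define K where "K = (1 + ln (real R)) * ((2 * real N + 1) / real m + 8 * (1 + 2 * ln (real R)) * real R)"
  have fin: "finite A" "finite B" using A B finite_subset by auto
  have lnR: "ln (real R) \<ge> 0" using m by simp
  have half: "(\<Sum>d\<in>D. \<Sum>h\<in>{1..<d}. (norm (expsum C (real h / real d)))\<^sup>2 / real d) \<le> 2 * K * real (card C)"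
    if C: "C \<subseteq> {- int N..int N}" for C
  proof -
    define f where "f q = (\<Sum>h\<in>{h. h < q \<and> coprime h q}. (norm (expsum C (real h / real q)))\<^sup>2)" for q :: nat
    have "(\<Sum>d\<in>D. \<Sum>h\<in>{1..<d}. (norm (expsum C (real h / real d)))\<^sup>2 / real d)
        \<le> (\<Sum>e=1..R. 1 / real e) * (\<Sum>q=m..R. f q / real q)"
      unfolding f_def by (rule sum_fractions_le[OF _ m(1) D primes]) auto
    also have "\<dots> \<le> (1 + ln (real R)) * (2 * ((2 * real N + 1) * real (card C)) / real m
        + 2 * (8 * (1 + 2 * ln (real R)) * real (card C)) * real R)"
    proof (rule mult_mono)
      show "(\<Sum>e=1..R. 1 / real e) \<le> 1 + ln (real R)"
        using sum_inverse_le_ln[of R] m by (simp add: max_def split: if_splits)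
      show "(\<Sum>q=m..R. f q / real q) \<le> 2 * ((2 * real N + 1) * real (card C)) / real m
        + 2 * (8 * (1 + 2 * ln (real R)) * real (card C)) * real R"
      proof (rule sum_over_index_le[OF m])
        fix Q assume Q: "Q \<in> {1..R}"
        have "(\<Sum>q=1..Q. f q) \<le> ((2 * real N + 1) + 8 * ((1 + 2 * ln (real Q)) * (real Q)\<^sup>2)) * real (card C)"
          unfolding f_def using Q by (intro large_sieve_fractions C) auto
        also have "\<dots> \<le> ((2 * real N + 1) + 8 * ((1 + 2 * ln (real R)) * (real Q)\<^sup>2)) * real (card C)"
          using Q by (intro mult_right_mono add_mono mult_left_mono) auto
        finally show "(\<Sum>q=1..Q. f q) \<le> (2 * real N + 1) * real (card C) + 8 * (1 + 2 * ln (real R)) * real (card C) * (real Q)\<^sup>2"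
          by (simp add: algebra_simps)
      qed (use lnR in \<open>auto simp: f_def intro!: sum_nonneg\<close>)
    qed (use lnR in \<open>auto simp: f_def intro!: sum_nonneg divide_nonneg_nonneg\<close>)
    also have "\<dots> = 2 * K * real (card C)"
      by (simp add: K_def field_simps)
    finally show ?thesis .
  qed
  have "(\<Sum>d\<in>D. \<bar>real (card {(a, b). a \<in> A \<and> b \<in> B \<and> int d dvd a + b})
             - real (card A) * real (card B) / real d\<bar>)
    \<le> (\<Sum>d\<in>D. (\<Sum>h\<in>{1..<d}. (norm (expsum A (real h / real d)))\<^sup>2 / real d) / 2
        + (\<Sum>h\<in>{1..<d}. (norm (expsum B (real h / real d)))\<^sup>2 / real d) / 2)"
    using D by (intro sum_mono card_dvd_sum_deviation_le fin) auto
  also have "\<dots> = (\<Sum>d\<in>D. \<Sum>h\<in>{1..<d}. (norm (expsum A (real h / real d)))\<^sup>2 / real d) / 2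
      + (\<Sum>d\<in>D. \<Sum>h\<in>{1..<d}. (norm (expsum B (real h / real d)))\<^sup>2 / real d) / 2"
    by (simp add: sum.distrib sum_divide_distrib)
  also have "\<dots> \<le> (2 * K * real (card A)) / 2 + (2 * K * real (card B)) / 2"
    by (intro add_mono divide_right_mono half A B) auto
  also have "\<dots> = K * (real (card A) + real (card B))" by (simp add: algebra_simps)
  finally show ?thesis unfolding K_def .
qed

section \<open>The truncated sieve\<close>

lemma prod_primes_dvd_iff:
  fixes n :: nat
  assumes "finite T" "\<And>p. p \<in> T \<Longrightarrow> prime p"
  shows "\<Prod>T dvd n \<longleftrightarrow> (\<forall>p\<in>T. p dvd n)"
  using assms
proof (induction T rule: finite_induct)
  case (insert p T)
  have "coprime p (\<Prod>T)"
    using insert by (intro prod_coprime_right) (metis insertCI primes_coprime)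
  then show ?case
    using insert by (auto simp: divides_mult dest: dvd_mult_left dvd_mult_right)
qed auto

lemma prod_primes_inj:
  fixes T U :: "nat set"
  assumes "finite T" "\<And>p. p \<in> T \<Longrightarrow> prime p" "finite U" "\<And>p. p \<in> U \<Longrightarrow> prime p" "\<Prod>T = \<Prod>U"
  shows "T = U"
proof -
  have *: "p \<in> T'" if h: "p \<in> U'" "\<Prod>T' = \<Prod>U'" "finite T'" "\<And>p. p \<in> T' \<Longrightarrow> prime p" "finite U'" "\<And>p. p \<in> U' \<Longrightarrow> prime p"
    for p and T' U' :: "nat set"
  proof -
    have "p dvd \<Prod>T'" using h(1,2,5,6) prod_primes_dvd_iff[of U' "\<Prod>U'"] by simp
    then obtain r where "r \<in> T'" "p dvd r"
      using h(3) h(6)[OF h(1)] prime_dvd_prod_iff[of T' p "\<lambda>x. x"] by auto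
    then show ?thesis using h(4)[of r] h(6)[OF h(1)] primes_dvd_imp_eq by metis
  qed
  have "U \<subseteq> T" using *[OF _ assms(5,1,2,3,4)] by blast
  moreover have "T \<subseteq> U" using *[OF _ assms(5)[symmetric] assms(3,4,1,2)] by blast
  ultimately show ?thesis by blast
qed

lemma sum_Pow_minus_one:
  assumes "finite P"
  shows "(\<Sum>T\<in>Pow P. (- 1) ^ card T) = (if P = {} then 1 else 0 :: real)"
proof (cases "P = {}")
  case False
  then obtain p where p: "p \<in> P" by blast
  define Q where "Q = P - {p}"
  have P: "P = insert p Q" "p \<notin> Q" "finite Q" using p assms by (auto simp: Q_def)
  have "(\<Sum>T\<in>Pow P. (- 1) ^ card T) = (\<Sum>T\<in>Pow Q. (- 1) ^ card T) + (\<Sum>T\<in>insert p ` Pow Q. (- 1) ^ card T :: real)"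
    unfolding P(1) Pow_insert using P by (intro sum.union_disjoint) auto
  also have "(\<Sum>T\<in>insert p ` Pow Q. (- 1) ^ card T :: real) = (\<Sum>T\<in>Pow Q. (- 1) ^ card (insert p T))"
    using P by (subst sum.reindex) (auto simp: inj_on_def)
  also have "\<dots> = (\<Sum>T\<in>Pow Q. - ((- 1) ^ card T))"
    using P by (intro sum.cong refl) (auto simp: card_insert_if finite_subset)
  finally show ?thesis using False by (simp add: sum_negf)
qed auto

text \<open>A set \<open>T\<close> of primes stands for the squarefree number
  \<open>\<Prod>T\<close>, whose Moebius value is \<open>(- 1) ^ card T\<close>. The empty set
  stands for 1.\<close>

definition sieve_sets :: "real \<Rightarrow> real \<Rightarrow> nat set set" where
  "sieve_sets y R = {T. finite T \<and> (\<forall>p\<in>T. prime p \<and> y < real p) \<and> real (\<Prod>T) \<le> R}"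

text \<open>The sum of mu(d) / d over \<open>d <= R\<close> with all prime factors above
  \<open>y\<close>. Its value is never computed, only compared between two applications of the
  sieve.\<close>

definition sieve_main :: "real \<Rightarrow> real \<Rightarrow> real" where
  "sieve_main y R = (\<Sum>T\<in>sieve_sets y R. (- 1) ^ card T / real (\<Prod>T))"

text \<open>One family of moduli for all purposes: it contains 1, the products of the sieve, and the
  primes and products of two primes of the second moment. A single error bound over it therefore
  serves everywhere.\<close>

definition rough_upto :: "real \<Rightarrow> real \<Rightarrow> nat set" where
  "rough_upto z R = {d. 0 < d \<and> real d \<le> R \<and> (\<forall>p. prime p \<longrightarrow> p dvd d \<longrightarrow> z < real p)}"

lemma finite_rough_upto: "finite (rough_upto z R)"
  by (rule finite_subset[of _ "{..nat \<lfloor>R\<rfloor>}"]) (auto simp: rough_upto_def le_nat_floor)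

lemma sieve_sets_inj: "inj_on Prod (sieve_sets y R)"
  by (rule inj_onI, rule prod_primes_inj) (auto simp: sieve_sets_def)

lemma sieve_sets_image: "z \<le> y \<Longrightarrow> Prod ` sieve_sets y R \<subseteq> rough_upto z R"
proof safe
  fix T assume zy: "z \<le> y" and T: "T \<in> sieve_sets y R"
  have "z < real q" if q: "prime q" "q dvd \<Prod>T" for q
  proof -
    obtain p where "p \<in> T" "q dvd p"
      using q T prime_dvd_prod_iff[of T q "\<lambda>x. x"] by (auto simp: sieve_sets_def)
    then have "q = p" "y < real p" using q T primes_dvd_imp_eq[of q p] by (auto simp: sieve_sets_def)
    then show ?thesis using zy by simp
  qed
  then show "\<Prod>T \<in> rough_upto z R" using T
    by (auto simp: rough_upto_def sieve_sets_def prime_gt_0_nat intro!: prod_pos)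
qed

lemma finite_sieve_sets: "finite (sieve_sets y R)"
  using finite_imageD[OF finite_subset[OF sieve_sets_image[OF order_refl] finite_rough_upto] sieve_sets_inj] .

text \<open>
  The truncation is harmless for \<open>n\<close> unless the product of the large primes of \<open>n\<close> exceeds \<open>R\<close>;
  then the complementary divisor of \<open>n\<close> is so small that \<open>n\<close> has no prime factor between
  it and \<open>y\<close>.
\<close>

lemma truncated_sieve:
  fixes n :: nat and y R z x :: real and K :: nat
  assumes n: "0 < n" "real n \<le> x" and y: "1 \<le> y" and R: "0 < R" "x / R \<le> z"
    and K: "x < y ^ (K + 1)"
  shows "\<bar>(if \<forall>p. prime p \<longrightarrow> p dvd n \<longrightarrow> real p \<le> y then 1 else 0 :: real)
          - (\<Sum>T\<in>{T\<in>sieve_sets y R. \<Prod>T dvd n}. (- 1) ^ card T)\<bar>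
       \<le> (if \<exists>p. prime p \<and> p dvd n \<and> z < real p \<and> real p \<le> y then 0 else 1 + 2 ^ K)"
proof -
  define P where "P = {p. prime p \<and> p dvd n \<and> y < real p}"
  have finP: "finite P" unfolding P_def by (rule finite_subset[of _ "{..n}"]) (use n in \<open>auto dest: dvd_imp_le\<close>)
  have Pdvd: "\<Prod>P dvd n" using finP by (subst prod_primes_dvd_iff) (auto simp: P_def)
  then obtain m where m: "n = \<Prod>P * m" by (rule dvdE)
  have m0: "0 < m" "0 < \<Prod>P" using n m by auto
  have smooth: "(\<forall>p. prime p \<longrightarrow> p dvd n \<longrightarrow> real p \<le> y) \<longleftrightarrow> P = {}"
    unfolding P_def by (auto simp: not_less)
  have sub: "{T\<in>sieve_sets y R. \<Prod>T dvd n} = {T\<in>Pow P. real (\<Prod>T) \<le> R}"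
  proof (rule equalityI; rule subsetI)
    fix T assume T: "T \<in> {T\<in>sieve_sets y R. \<Prod>T dvd n}"
    then have "\<forall>p\<in>T. p dvd n" using prod_primes_dvd_iff[of T n] by (simp add: sieve_sets_def)
    then show "T \<in> {T\<in>Pow P. real (\<Prod>T) \<le> R}" using T by (auto simp: sieve_sets_def P_def)
  next
    fix T assume T: "T \<in> {T\<in>Pow P. real (\<Prod>T) \<le> R}"
    then have fT: "finite T" using finP finite_subset by blast
    have pr: "prime p \<and> p dvd n \<and> y < real p" if "p \<in> T" for p using T that by (auto simp: P_def)
    show "T \<in> {T\<in>sieve_sets y R. \<Prod>T dvd n}"
      using T fT pr prod_primes_dvd_iff[OF fT, of n] by (auto simp: sieve_sets_def)
  qed
  \<comment> \<open>More than \<open>K\<close> primes above \<open>y\<close> would force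
    \<open>n\<close> beyond \<open>x\<close>. So at most \<open>2 ^ K\<close> terms survive a
    truncation.\<close>
  have card: "card P \<le> K"
  proof (rule ccontr)
    assume "\<not> card P \<le> K"
    then have "y ^ (K + 1) \<le> y ^ card P" using y by (intro power_increasing) auto
    also have "\<dots> = (\<Prod>p\<in>P. y)" by simp
    also have "\<dots> \<le> (\<Prod>p\<in>P. real p)" using y by (intro prod_mono) (auto simp: P_def)
    also have "\<dots> = real (\<Prod>P)" by simp
    also have "\<dots> \<le> real n" using n Pdvd by (intro of_nat_mono dvd_imp_le)
    finally show False using n K by linarith
  qed
  show ?thesis
  proof (cases "real (\<Prod>P) \<le> R")
    case True
    have "{T\<in>Pow P. real (\<Prod>T) \<le> R} = Pow P"
    proof -
      have "real (\<Prod>T) \<le> R" if "T \<subseteq> P" for T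
      proof -
        have "\<Prod>T dvd \<Prod>P" using that finP by (intro prod_dvd_prod_subset)
        then have "\<Prod>T \<le> \<Prod>P" using m0 by (intro dvd_imp_le)
        then show ?thesis using True by linarith
      qed
      then show ?thesis by blast
    qed
    then show ?thesis unfolding sub smooth using sum_Pow_minus_one[OF finP] by simp
  next
    case False
    have "\<not> (\<exists>p. prime p \<and> p dvd n \<and> z < real p \<and> real p \<le> y)"
    proof safe
      fix p assume p: "prime p" "p dvd n" "z < real p" "real p \<le> y"
      have "\<not> p dvd \<Prod>P"
      proof
        assume "p dvd \<Prod>P"
        then obtain q where "q \<in> P" "p dvd q"
          using prime_dvd_prod_iff[of P p "\<lambda>x. x"] finP p by auto
        then have "p = q" using p primes_dvd_imp_eq[of p q] by (auto simp: P_def)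
        then show False using \<open>q \<in> P\<close> p by (auto simp: P_def)
      qed
      then have "p dvd m" using p m prime_dvd_mult_iff by blast
      then have pm: "real p \<le> real m" using m0 by (intro of_nat_mono dvd_imp_le)
      have "real m * R < real m * real (\<Prod>P)" using False m0 by (intro mult_strict_left_mono) auto
      moreover have "real m * real (\<Prod>P) = real n" by (subst m) (simp add: mult.commute)
      ultimately have "real m * R < x" using n by linarith
      then have "real m < x / R" using R by (simp add: field_simps)
      then show False using pm p R by linarith
    qed
    moreover have "\<bar>\<Sum>T\<in>{T\<in>Pow P. real (\<Prod>T) \<le> R}. (- 1) ^ card T\<bar> \<le> (2::real) ^ K"
    proof -
      have "\<bar>\<Sum>T\<in>{T\<in>Pow P. real (\<Prod>T) \<le> R}. (- 1) ^ card T\<bar>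
          \<le> (\<Sum>T\<in>{T\<in>Pow P. real (\<Prod>T) \<le> R}. \<bar>(- 1) ^ card T :: real\<bar>)" by (rule sum_abs)
      also have "\<dots> = real (card {T\<in>Pow P. real (\<Prod>T) \<le> R})" by (simp add: power_abs)
      also have "\<dots> \<le> real (card (Pow P))" using finP by (intro of_nat_mono card_mono) auto
      also have "\<dots> = 2 ^ card P" using finP by (simp add: card_Pow)
      also have "\<dots> \<le> 2 ^ K" using card by (intro power_increasing) auto
      finally show ?thesis .
    qed
    ultimately show ?thesis unfolding sub by (auto simp del: Pow_iff)
  qed
qed

section \<open>The second moment method and the transfer to arbitrary families of integers\<close>

text \<open>Turan's method: the number \<open>w s\<close> of primes of \<open>Q\<close> dividing
  \<open>f s\<close> has mean about \<open>L\<close> and variance about \<open>L\<close>, while the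
  counted elements have \<open>w s = 0\<close> and hence deviate by exactly \<open>L\<close>. The
  factor 2 in \<open>E3\<close> reflects ordered pairs.\<close>

lemma second_moment_bound:
  fixes f :: "'a \<Rightarrow> nat" and Q :: "nat set" and X E :: real
  assumes fin: "finite S" "finite Q" and Q: "\<And>p. p \<in> Q \<Longrightarrow> prime p" and X: "0 \<le> X"
    and E1: "\<bar>real (card S) - X\<bar> \<le> E"
    and E2: "(\<Sum>p\<in>Q. \<bar>real (card {s\<in>S. p dvd f s}) - X / real p\<bar>) \<le> E"
    and E3: "(\<Sum>p\<in>Q. \<Sum>q\<in>Q - {p}. \<bar>real (card {s\<in>S. p * q dvd f s}) - X / real (p * q)\<bar>) \<le> 2 * E"
    and L: "L = (\<Sum>p\<in>Q. 1 / real p)" "0 < L"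
  shows "real (card {s\<in>S. \<forall>p\<in>Q. \<not> p dvd f s}) \<le> X / L + (1 + 2 / L + 3 / L\<^sup>2) * E"
proof -
  define c where "c d = real (card {s\<in>S. d dvd f s})" for d
  define w where "w s = (\<Sum>p\<in>Q. if p dvd f s then 1 else 0 :: real)" for s
  have cs: "(\<Sum>s\<in>S. if d dvd f s then 1 else 0) = c d" for d
    using fin by (simp add: c_def sum.If_cases Int_def)
  have "L\<^sup>2 * real (card {s\<in>S. \<forall>p\<in>Q. \<not> p dvd f s}) = (\<Sum>s\<in>{s\<in>S. \<forall>p\<in>Q. \<not> p dvd f s}. (w s - L)\<^sup>2)"
    by (simp add: w_def)
  also have "\<dots> \<le> (\<Sum>s\<in>S. (w s - L)\<^sup>2)" using fin by (intro sum_mono2) auto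
  also have "\<dots> = (\<Sum>s\<in>S. (w s)\<^sup>2) - 2 * L * (\<Sum>s\<in>S. w s) + L\<^sup>2 * real (card S)"
  proof -
    have "(\<Sum>s\<in>S. (w s - L)\<^sup>2) = (\<Sum>s\<in>S. (w s)\<^sup>2 - 2 * L * w s + L\<^sup>2)"
      by (intro sum.cong refl) (simp add: power2_diff)
    then show ?thesis by (simp add: sum.distrib sum_subtractf flip: sum_distrib_left)
  qed
  also have "(\<Sum>s\<in>S. w s) = (\<Sum>p\<in>Q. c p)"
    unfolding w_def by (subst sum.swap) (simp add: cs)
  also have "(\<Sum>s\<in>S. (w s)\<^sup>2) = (\<Sum>p\<in>Q. c p) + (\<Sum>p\<in>Q. \<Sum>q\<in>Q - {p}. c (p * q))"
  proof -
    have "(\<Sum>s\<in>S. (w s)\<^sup>2) = (\<Sum>s\<in>S. \<Sum>p\<in>Q. \<Sum>q\<in>Q. (if p dvd f s \<and> q dvd f s then 1 else 0))"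
      unfolding w_def power2_eq_square sum_product by (intro sum.cong refl) auto
    also have "\<dots> = (\<Sum>p\<in>Q. \<Sum>q\<in>Q. \<Sum>s\<in>S. (if p dvd f s \<and> q dvd f s then 1 else 0))"
      by (subst sum.swap, intro sum.cong refl, rule sum.swap)
    also have "\<dots> = (\<Sum>p\<in>Q. c p + (\<Sum>q\<in>Q - {p}. c (p * q)))"
    proof (intro sum.cong refl)
      fix p assume p: "p \<in> Q"
      have "(\<Sum>q\<in>Q. \<Sum>s\<in>S. (if p dvd f s \<and> q dvd f s then 1 else 0 :: real))
          = (\<Sum>s\<in>S. (if p dvd f s \<and> p dvd f s then 1 else 0)) + (\<Sum>q\<in>Q - {p}. \<Sum>s\<in>S. (if p dvd f s \<and> q dvd f s then 1 else 0))"
        using p fin by (intro sum.remove)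
      also have "(\<Sum>q\<in>Q - {p}. \<Sum>s\<in>S. (if p dvd f s \<and> q dvd f s then 1 else 0 :: real)) = (\<Sum>q\<in>Q - {p}. c (p * q))"
      proof (intro sum.cong refl)
        fix q assume q: "q \<in> Q - {p}"
        have "p dvd n \<and> q dvd n \<longleftrightarrow> p * q dvd n" for n
          using p q Q primes_coprime[of p q] by (auto simp: divides_mult dest: dvd_mult_left dvd_mult_right)
        then show "(\<Sum>s\<in>S. (if p dvd f s \<and> q dvd f s then 1 else 0 :: real)) = c (p * q)"
          by (simp add: cs)
      qed
      finally show "(\<Sum>q\<in>Q. \<Sum>s\<in>S. (if p dvd f s \<and> q dvd f s then 1 else 0)) = c p + (\<Sum>q\<in>Q - {p}. c (p * q))"
        by (simp add: cs)
    qed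
    finally show ?thesis by (simp add: sum.distrib)
  qed
  finally have main: "L\<^sup>2 * real (card {s\<in>S. \<forall>p\<in>Q. \<not> p dvd f s})
     \<le> (\<Sum>p\<in>Q. c p) + (\<Sum>p\<in>Q. \<Sum>q\<in>Q - {p}. c (p * q)) - 2 * L * (\<Sum>p\<in>Q. c p) + L\<^sup>2 * real (card S)" .
  have XL: "(\<Sum>p\<in>Q. X / real p) = X * L" by (simp add: L sum_distrib_left)
  have a1: "\<bar>(\<Sum>p\<in>Q. c p) - X * L\<bar> \<le> E"
    unfolding XL[symmetric] sum_subtractf[symmetric] using E2 unfolding c_def
    by (rule order_trans[OF sum_abs])
  have a2: "(\<Sum>p\<in>Q. \<Sum>q\<in>Q - {p}. c (p * q)) \<le> X * L\<^sup>2 + 2 * E"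
  proof -
    have "(\<Sum>p\<in>Q. \<Sum>q\<in>Q - {p}. c (p * q))
        \<le> (\<Sum>p\<in>Q. \<Sum>q\<in>Q - {p}. X / real (p * q) + \<bar>c (p * q) - X / real (p * q)\<bar>)"
      by (intro sum_mono) auto
    also have "\<dots> \<le> (\<Sum>p\<in>Q. \<Sum>q\<in>Q - {p}. X / real (p * q)) + 2 * E"
      using E3 by (simp add: sum.distrib c_def)
    \<comment> \<open>Adding the diagonal, which is nonnegative, completes the square
      \<open>X * L^2\<close>.\<close>
    also have "(\<Sum>p\<in>Q. \<Sum>q\<in>Q - {p}. X / real (p * q)) \<le> (\<Sum>p\<in>Q. \<Sum>q\<in>Q. X / real (p * q))"
      using fin X by (intro sum_mono sum_mono2) auto
    also have "\<dots> = X * L\<^sup>2"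
      by (simp add: L power2_eq_square sum_product sum_distrib_left sum_divide_distrib mult.commute)
    finally show ?thesis by simp
  qed
  \<comment> \<open>The three terms \<open>X * L^2\<close> have coefficients 1, -2 and 1 and cancel;
    the only main term left is the variance \<open>X * L\<close>.\<close>
  have "L\<^sup>2 * real (card {s\<in>S. \<forall>p\<in>Q. \<not> p dvd f s})
      \<le> (X * L + E) + (X * L\<^sup>2 + 2 * E) - 2 * L * (X * L - E) + L\<^sup>2 * (X + E)"
  proof -
    have "2 * L * (X * L - E) \<le> 2 * L * (\<Sum>p\<in>Q. c p)"
      using a1 L by (intro mult_left_mono) auto
    moreover have "L\<^sup>2 * real (card S) \<le> L\<^sup>2 * (X + E)"
      using E1 by (intro mult_left_mono) auto
    ultimately show ?thesis using main a1 a2 by linarith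
  qed
  also have "\<dots> = L\<^sup>2 * (X / L + (1 + 2 / L + 3 / L\<^sup>2) * E)"
    using L(2) by (simp add: field_simps power2_eq_square)
  finally show ?thesis using L(2) by simp
qed

text \<open>\<open>S\<close> and \<open>f\<close> stay abstract because the lemma is used twice, for
  sums of two elements and for the integers up to \<open>x\<close>. With \<open>v^2 <= R\<close>,
  products of two primes up to \<open>v\<close> remain admissible moduli. The truncated sieve can
  fail only on elements without a prime factor in \<open>(z, v]\<close>, and the second moment
  counts those.\<close>

lemma sieve_transfer:
  fixes f :: "'a \<Rightarrow> nat" and x y z v R X E L :: real and K :: nat
  assumes fin: "finite S" and X: "0 \<le> X"
    and f: "\<And>s. s \<in> S \<Longrightarrow> 0 < f s \<and> real (f s) \<le> x"
    and y: "1 \<le> y" and z: "0 < z" "z \<le> v" and v: "v \<le> y" "v \<^sup>2 \<le> R" and R: "1 \<le> R" "x / R \<le> z"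
    and K: "x < y ^ (K + 1)"
    and dev: "(\<Sum>d\<in>rough_upto z R. \<bar>real (card {s\<in>S. d dvd f s}) - X / real d\<bar>) \<le> E"
    and L: "L = (\<Sum>p\<in>{p. prime p \<and> z < real p \<and> real p \<le> v}. 1 / real p)" "0 < L"
  shows "\<bar>real (card {s\<in>S. \<forall>p. prime p \<longrightarrow> p dvd f s \<longrightarrow> real p \<le> y}) - X * sieve_main y R\<bar>
           \<le> (1 + 2 ^ K) * (X / L + (1 + 2 / L + 3 / L\<^sup>2) * E) + E"
proof -
  define c where "c d = real (card {s\<in>S. d dvd f s})" for d
  define Q where "Q = {p. prime p \<and> z < real p \<and> real p \<le> v}"
  define D where "D = rough_upto z R"
  have finQ: "finite Q" unfolding Q_def
    by (rule finite_subset[of _ "{..nat \<lfloor>v\<rfloor>}"]) (auto simp: le_nat_floor)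
  have finD: "finite D" unfolding D_def by (rule finite_rough_upto)
  have v1: "1 \<le> v" if "p \<in> Q" for p
    using that prime_ge_1_nat[of p] by (auto simp: Q_def)
  have vR: "v \<le> R" if "1 \<le> v"
    using v(2) that by (metis dual_order.trans one_le_power power2_eq_square mult_left_mono mult_1_right order_trans zero_le_one)
  have dev': "(\<Sum>d\<in>D'. \<bar>c d - X / real d\<bar>) \<le> E" if "D' \<subseteq> D" for D'
  proof -
    have "(\<Sum>d\<in>D'. \<bar>c d - X / real d\<bar>) \<le> (\<Sum>d\<in>D. \<bar>c d - X / real d\<bar>)"
      using that finD by (intro sum_mono2) auto
    also have "\<dots> \<le> E" using dev by (simp add: c_def D_def)
    finally show ?thesis .
  qed
  define bad where "bad = {s\<in>S. \<forall>p\<in>Q. \<not> p dvd f s}"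
  have "1 \<in> D" using R by (auto simp: D_def rough_upto_def)
  then have E1: "\<bar>c 1 - X\<bar> \<le> E" using dev'[of "{1}"] by simp
  have E2: "(\<Sum>p\<in>Q. \<bar>c p - X / real p\<bar>) \<le> E"
  proof (rule dev', rule subsetI)
    fix p assume p: "p \<in> Q"
    then have "real p \<le> R" using vR[OF v1[OF p]] by (auto simp: Q_def)
    then show "p \<in> D" using p primes_dvd_imp_eq[of _ p] by (auto simp: D_def Q_def rough_upto_def prime_gt_0_nat)
  qed
  \<comment> \<open>Each product of two distinct primes comes from exactly two ordered pairs; the
    pairs with \<open>p < q\<close> yield distinct moduli and cost \<open>E\<close> once.\<close>
  have E3: "(\<Sum>p\<in>Q. \<Sum>q\<in>Q - {p}. \<bar>c (p * q) - X / real (p * q)\<bar>) \<le> 2 * E"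
  proof -
    define g where "g d = \<bar>c d - X / real d\<bar>" for d
    define I where "I = {(p, q). p \<in> Q \<and> q \<in> Q \<and> p < q}"
    have finI: "finite I" unfolding I_def
      by (rule finite_subset[of _ "Q \<times> Q"]) (use finQ in auto)
    have inj: "inj_on (\<lambda>(p, q). p * q) I"
    proof (rule inj_onI)
      fix s t assume st: "s \<in> I" "t \<in> I" "(case s of (p, q) \<Rightarrow> p * q) = (case t of (p, q) \<Rightarrow> p * q)"
      obtain p q p' q' where [simp]: "s = (p, q)" "t = (p', q')" by fastforce
      have pr: "prime p" "prime q" "prime p'" "prime q'" "p < q" "p' < q'" using st by (auto simp: I_def Q_def)
      have "\<Prod>{p, q} = \<Prod>{p', q'}" using st pr by simp
      then have "{p, q} = {p', q'}" using pr by (intro prod_primes_inj) auto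
      then show "s = t" using pr by (auto simp: doubleton_eq_iff)
    qed
    have half: "(\<Sum>(p, q)\<in>I. g (p * q)) \<le> E"
    proof -
      have "(\<Sum>(p, q)\<in>I. g (p * q)) = (\<Sum>d\<in>(\<lambda>(p, q). p * q) ` I. g d)"
        using inj by (subst sum.reindex) (auto intro!: sum.cong)
      also have "\<dots> \<le> E"
        unfolding g_def
      proof (rule dev', safe)
        fix p q assume pq: "(p, q) \<in> I"
        then have pr: "prime p" "prime q" "z < real p" "z < real q" "real p \<le> v" "real q \<le> v" by (auto simp: I_def Q_def)
        have "real p * real q \<le> v * v" using pr z by (intro mult_mono) auto
        then have "real (p * q) \<le> R" using v(2) by (simp add: power2_eq_square)
        moreover have "z < real r" if "prime r" "r dvd p * q" for r
          using that pr primes_dvd_imp_eq[of r p] primes_dvd_imp_eq[of r q] by (auto simp: prime_dvd_mult_iff)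
        ultimately show "p * q \<in> D" using pr by (auto simp: D_def rough_upto_def prime_gt_0_nat)
      qed
      finally show ?thesis .
    qed
    have "(\<Sum>p\<in>Q. \<Sum>q\<in>Q - {p}. g (p * q)) = (\<Sum>(p, q)\<in>(SIGMA p:Q. Q - {p}). g (p * q))"
      using finQ by (subst sum.Sigma) auto
    also have "(SIGMA p:Q. Q - {p}) = I \<union> prod.swap ` I" by (force simp: I_def image_iff)
    also have "(\<Sum>(p, q)\<in>I \<union> prod.swap ` I. g (p * q)) = (\<Sum>(p, q)\<in>I. g (p * q)) + (\<Sum>(p, q)\<in>prod.swap ` I. g (p * q))"
      using finI by (intro sum.union_disjoint) (auto simp: I_def)
    also have "(\<Sum>(p, q)\<in>prod.swap ` I. g (p * q)) = (\<Sum>(p, q)\<in>I. g (p * q))"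
      by (subst sum.reindex) (auto intro!: sum.cong simp: mult.commute)
    finally show ?thesis using half by (simp add: g_def)
  qed
  have bad: "real (card bad) \<le> X / L + (1 + 2 / L + 3 / L\<^sup>2) * E"
    unfolding bad_def using fin finQ X E1 E2 E3 L
    by (intro second_moment_bound[where Q = Q]) (auto simp: c_def Q_def)
  define \<Theta> where "\<Theta> = sieve_sets y R"
  have fin\<Theta>: "finite \<Theta>" unfolding \<Theta>_def by (rule finite_sieve_sets)
  have sw: "(\<Sum>s\<in>S. \<Sum>T\<in>{T\<in>\<Theta>. \<Prod>T dvd f s}. (- 1) ^ card T) = (\<Sum>T\<in>\<Theta>. (- 1) ^ card T * c (\<Prod>T))"
  proof -
    have "(\<Sum>s\<in>S. \<Sum>T\<in>{T\<in>\<Theta>. \<Prod>T dvd f s}. (- 1) ^ card T)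
        = (\<Sum>s\<in>S. \<Sum>T\<in>\<Theta>. if \<Prod>T dvd f s then (- 1) ^ card T else 0 :: real)"
      using fin\<Theta> by (intro sum.cong refl sum.inter_filter)
    also have "\<dots> = (\<Sum>T\<in>\<Theta>. \<Sum>s\<in>S. if \<Prod>T dvd f s then (- 1) ^ card T else 0)"
      by (rule sum.swap)
    also have "\<dots> = (\<Sum>T\<in>\<Theta>. (- 1) ^ card T * c (\<Prod>T))"
      using fin by (intro sum.cong refl) (simp add: c_def sum.If_cases Int_def mult.commute del: of_nat_prod)
    finally show ?thesis .
  qed
  have A: "\<bar>real (card {s\<in>S. \<forall>p. prime p \<longrightarrow> p dvd f s \<longrightarrow> real p \<le> y}) - (\<Sum>T\<in>\<Theta>. (- 1) ^ card T * c (\<Prod>T))\<bar>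
      \<le> (1 + 2 ^ K) * real (card bad)"
  proof -
    have "real (card {s\<in>S. \<forall>p. prime p \<longrightarrow> p dvd f s \<longrightarrow> real p \<le> y})
        = (\<Sum>s\<in>S. if \<forall>p. prime p \<longrightarrow> p dvd f s \<longrightarrow> real p \<le> y then 1 else 0)"
      using fin by (simp add: sum.If_cases Int_def)
    then have "\<bar>real (card {s\<in>S. \<forall>p. prime p \<longrightarrow> p dvd f s \<longrightarrow> real p \<le> y}) - (\<Sum>T\<in>\<Theta>. (- 1) ^ card T * c (\<Prod>T))\<bar>
        = \<bar>\<Sum>s\<in>S. (if \<forall>p. prime p \<longrightarrow> p dvd f s \<longrightarrow> real p \<le> y then 1 else 0) - (\<Sum>T\<in>{T\<in>\<Theta>. \<Prod>T dvd f s}. (- 1) ^ card T)\<bar>"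
      unfolding sw[symmetric] by (simp only: sum_subtractf)
    also have "\<dots> \<le> (\<Sum>s\<in>S. if s \<in> bad then 1 + 2 ^ K else 0)"
    proof (intro order_trans[OF sum_abs] sum_mono)
      fix s assume s: "s \<in> S"
      have "\<bar>(if \<forall>p. prime p \<longrightarrow> p dvd f s \<longrightarrow> real p \<le> y then 1 else 0) - (\<Sum>T\<in>{T\<in>\<Theta>. \<Prod>T dvd f s}. (- 1) ^ card T)\<bar>
          \<le> (if \<exists>p. prime p \<and> p dvd f s \<and> z < real p \<and> real p \<le> y then 0 else 1 + 2 ^ K :: real)"
        unfolding \<Theta>_def using f[OF s] y R K by (intro truncated_sieve[of _ x]) auto
      also have "\<dots> \<le> (if s \<in> bad then 1 + 2 ^ K else (0::real))"
        using s v by (auto simp: bad_def Q_def)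
      finally show "\<bar>(if \<forall>p. prime p \<longrightarrow> p dvd f s \<longrightarrow> real p \<le> y then 1 else 0) - (\<Sum>T\<in>{T\<in>\<Theta>. \<Prod>T dvd f s}. (- 1) ^ card T)\<bar>
          \<le> (if s \<in> bad then 1 + 2 ^ K else (0::real))" .
    qed
    also have "\<dots> = (1 + 2 ^ K) * real (card bad)"
    proof -
      have "S \<inter> {s. s \<in> bad} = bad" by (auto simp: bad_def)
      then show ?thesis using fin by (simp add: sum.If_cases mult.commute)
    qed
    finally show ?thesis .
  qed
  have B: "\<bar>(\<Sum>T\<in>\<Theta>. (- 1) ^ card T * c (\<Prod>T)) - X * sieve_main y R\<bar> \<le> E"
  proof -
    have "(\<Sum>T\<in>\<Theta>. (- 1) ^ card T * c (\<Prod>T)) - X * sieve_main y R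
        = (\<Sum>T\<in>\<Theta>. (- 1) ^ card T * (c (\<Prod>T) - X / real (\<Prod>T)))"
      unfolding sieve_main_def \<Theta>_def sum_distrib_left sum_subtractf[symmetric]
      by (intro sum.cong refl) (simp add: right_diff_distrib)
    also have "\<bar>\<dots>\<bar> \<le> (\<Sum>T\<in>\<Theta>. \<bar>c (\<Prod>T) - X / real (\<Prod>T)\<bar>)"
      by (intro order_trans[OF sum_abs] sum_mono) (simp add: abs_mult power_abs)
    also have "\<dots> = (\<Sum>d\<in>Prod ` \<Theta>. \<bar>c d - X / real d\<bar>)"
      unfolding \<Theta>_def by (subst sum.reindex[OF sieve_sets_inj]) simp
    also have "\<dots> \<le> E" unfolding \<Theta>_def D_def[symmetric]
      by (rule dev') (use sieve_sets_image[of z y R] z v in \<open>auto simp: D_def\<close>)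
    finally show ?thesis .
  qed
  have "(1 + 2 ^ K) * real (card bad) \<le> (1 + 2 ^ K) * (X / L + (1 + 2 / L + 3 / L\<^sup>2) * E)"
    using bad by (intro mult_left_mono) auto
  then show ?thesis using A B by linarith
qed

section \<open>Sums over primes\<close>

text \<open>Chebyshev's function, not to be confused with the two-variable count of smooth
  numbers.\<close>

definition psi :: "nat \<Rightarrow> real" where
  "psi n = (\<Sum>d=1..n. mangoldt d)"

lemma card_multiples:
  fixes d n :: nat
  assumes "0 < d"
  shows "card {k \<in> {1..n}. d dvd k} = n div d"
proof -
  have "{k \<in> {1..n}. d dvd k} = (\<lambda>j. d * j) ` {1..n div d}"
  proof (rule equalityI; rule subsetI)
    fix k assume k: "k \<in> {k \<in> {1..n}. d dvd k}"
    then obtain j where j: "k = d * j" by (auto elim: dvdE)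
    have "j \<in> {1..n div d}" using k assms by (auto simp: j less_eq_div_iff_mult_less_eq mult.commute Suc_le_eq)
    then show "k \<in> (\<lambda>j. d * j) ` {1..n div d}" using j by blast
  next
    fix k assume "k \<in> (\<lambda>j. d * j) ` {1..n div d}"
    then obtain j where "k = d * j" "j \<in> {1..n div d}" by (rule imageE)
    then have j: "k = d * j" "1 \<le> j" "j \<le> n div d" by auto
    have "d * j \<le> n" using j(3) assms by (simp add: less_eq_div_iff_mult_less_eq mult.commute)
    then show "k \<in> {k \<in> {1..n}. d dvd k}" using j assms by (auto simp: Suc_le_eq)
  qed
  then show ?thesis using assms by (simp add: card_image inj_on_def)
qed

lemma divide_le_real_div_plus_1:
  fixes d n :: nat
  assumes d: "0 < d"
  shows "real n / real d \<le> real (n div d) + 1"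
proof -
  have "n mod d < d" using d by simp
  moreover have "d * (n div d) + n mod d = n" by simp
  ultimately have "n \<le> d * (n div d + 1)" unfolding distrib_left by linarith
  then have "real n \<le> real d * (real (n div d) + 1)" by (metis of_nat_1 of_nat_add of_nat_le_iff of_nat_mult)
  then show ?thesis using d by (simp add: field_simps)
qed

text \<open>Legendre's formula. Terms with \<open>d > n\<close> vanish; the free upper limit
  \<open>N\<close> lets two factorials be compared over the same range.\<close>

lemma ln_fact_eq_sum_mangoldt:
  assumes "n \<le> N"
  shows "ln (fact n) = (\<Sum>d=1..N. mangoldt d * real (n div d))"
proof -
  have "ln (fact n :: real) = (\<Sum>k=1..n. ln (real k))"
    by (induction n) (simp_all add: ln_mult)
  also have "\<dots> = (\<Sum>k=1..n. \<Sum>d=1..N. if d dvd k then mangoldt d else 0)"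
  proof (intro sum.cong refl)
    fix k assume k: "k \<in> {1..n}"
    have "(\<Sum>d | d dvd k. mangoldt d :: real) = ln (real k)"
      using mangoldt_sum[of k, where ?'a = real] k by simp
    moreover have "{d. d dvd k} = {d \<in> {1..N}. d dvd k}"
    proof -
      have "d \<in> {1..N}" if "d dvd k" for d
        using dvd_imp_le[OF that] dvd_pos_nat[OF _ that] k assms by auto
      then show ?thesis by blast
    qed
    ultimately show "ln (real k) = (\<Sum>d=1..N. if d dvd k then mangoldt d else 0)"
      by (subst sum.inter_filter[symmetric]) simp_all
  qed
  also have "\<dots> = (\<Sum>d=1..N. \<Sum>k=1..n. if d dvd k then mangoldt d else 0)"
    by (rule sum.swap)
  also have "\<dots> = (\<Sum>d=1..N. mangoldt d * real (n div d))"
  proof (intro sum.cong refl)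
    fix d assume d: "d \<in> {1..N}"
    have "card {k \<in> {1..n}. d dvd k} = n div d" using d by (intro card_multiples) auto
    moreover have "(\<Sum>k=1..n. if d dvd k then mangoldt d else 0 :: real) = (\<Sum>k\<in>{k \<in> {1..n}. d dvd k}. mangoldt d)"
      by (rule sum.inter_filter[symmetric]) simp
    ultimately show "(\<Sum>k=1..n. if d dvd k then mangoldt d else 0) = mangoldt d * real (n div d)"
      by (simp add: mult.commute)
  qed
  finally show ?thesis .
qed

text \<open>Chebyshev's argument with the central binomial coefficient, at most
  \<open>4 ^ n\<close>. In its logarithm \<open>mangoldt d\<close> has weight
  \<open>2 * n div d - 2 * (n div d)\<close>, which is nonnegative, and at least 1 for
  \<open>n < d \<le> 2 * n\<close>.\<close>

lemma psi_double: "psi (2 * n) - psi n \<le> real n * ln 4"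
proof -
  have "fact (2 * n) = fact n * fact n * (2 * n choose n :: nat)"
    using binomial_fact_lemma[of n "2 * n"] by (simp add: mult_ac)
  then have "ln (fact (2 * n)) = 2 * ln (fact n) + ln (real (2 * n choose n))"
  proof -
    have "0 < 2 * n choose n" by simp
    moreover have "(fact (2 * n) :: real) = fact n * fact n * real (2 * n choose n)"
      using arg_cong[OF \<open>fact (2 * n) = fact n * fact n * (2 * n choose n :: nat)\<close>, of real]
      by (simp only: of_nat_fact of_nat_mult)
    ultimately show ?thesis by (simp add: ln_mult)
  qed
  moreover have "real (2 * n choose n) \<le> 4 ^ n"
  proof -
    have "2 * n choose n \<le> 2 ^ (2 * n)" by (rule binomial_le_pow2)
    then have "real (2 * n choose n) \<le> real (2 ^ (2 * n))" by (rule of_nat_mono)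
    then show ?thesis by (simp add: power_mult)
  qed
  then have "ln (real (2 * n choose n)) \<le> ln (4 ^ n)" by (intro ln_mono) auto
  then have "ln (real (2 * n choose n)) \<le> real n * ln 4" by (simp add: ln_realpow)
  moreover have "psi (2 * n) - psi n \<le> ln (fact (2 * n)) - 2 * ln (fact n)"
  proof -
    have "ln (fact (2 * n)) - 2 * ln (fact n)
        = (\<Sum>d=1..2*n. mangoldt d * (real (2 * n div d) - 2 * real (n div d)))"
      unfolding ln_fact_eq_sum_mangoldt[of "2 * n" "2 * n", OF order_refl]
        ln_fact_eq_sum_mangoldt[of n "2 * n", OF le_add2[of n n, folded mult_2]]
        sum_distrib_left sum_subtractf[symmetric]
      by (auto intro!: sum.cong simp: right_diff_distrib)
    also have "\<dots> \<ge> (\<Sum>d=1..2*n. if n < d then mangoldt d else 0)"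
    proof (rule sum_mono)
      fix d assume d: "d \<in> {1..2*n}"
      have "2 * (n div d) \<le> 2 * n div d"
        using d by (simp add: less_eq_div_iff_mult_less_eq)
      then have "0 \<le> real (2 * n div d) - 2 * real (n div d)" by linarith
      moreover have "1 \<le> real (2 * n div d) - 2 * real (n div d)" if "n < d"
      proof -
        have "1 \<le> 2 * n div d" using d by (simp add: less_eq_div_iff_mult_less_eq)
        then show ?thesis using that by simp
      qed
      ultimately show "(if n < d then mangoldt d else 0) \<le> mangoldt d * (real (2 * n div d) - 2 * real (n div d))"
        using mult_left_mono[OF _ mangoldt_nonneg[of d], of 1 "real (2 * n div d) - 2 * real (n div d)"]
          mult_nonneg_nonneg[OF mangoldt_nonneg[of d], of "real (2 * n div d) - 2 * real (n div d)"]
        by (cases "n < d") (simp_all only: mult_1_right if_True if_False)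
    qed
    also have "(\<Sum>d=1..2*n. if n < d then mangoldt d else 0 :: real) = (\<Sum>d\<in>{n<..2*n}. mangoldt d)"
      by (subst sum.inter_filter[symmetric]) (auto intro!: sum.cong)
    also have "\<dots> = psi (2 * n) - psi n"
    proof -
      have "{1..2*n} = {1..n} \<union> {n<..2*n}" by auto
      then have "psi (2 * n) = psi n + (\<Sum>d\<in>{n<..2*n}. mangoldt d)"
        unfolding psi_def by (simp only:) (rule sum.union_disjoint, auto)
      then show ?thesis by simp
    qed
    finally show ?thesis .
  qed
  ultimately show ?thesis by linarith
qed

text \<open>Induction by halving: with \<open>m = n div 2\<close>, the parts are at most
  \<open>8 * m\<close> by induction, \<open>3 * m\<close> by doubling, and
  \<open>ln n <= n - 1 <= 2 * m\<close> for a possible odd last term; 13 is below 16.\<close>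

lemma psi_le: "psi n \<le> 8 * real n"
proof (induction n rule: less_induct)
  case (less n)
  have ln4: "ln 4 \<le> (3::real)" using ln_le_minus_one[of "4::real"] by simp
  show ?case
  proof (cases "n \<le> 1")
    case True
    then show ?thesis by (cases n) (auto simp: psi_def)
  next
    case False
    define m where "m = n div 2"
    have m: "n = 2 * m \<or> n = 2 * m + 1" "m < n" "1 \<le> m" using False by (auto simp: m_def)
    have "psi n \<le> psi (2 * m) + ln (real n)"
      using m(1) mangoldt_le[of n] False mangoldt_nonneg by (auto simp: psi_def)
    moreover have "psi (2 * m) \<le> psi m + real m * 3"
      using psi_double[of m] ln4 mult_left_mono[OF ln4, of "real m"] by linarith
    moreover have "psi m \<le> 8 * real m" by (rule less.IH) (use m in auto)
    moreover have "ln (real n) \<le> real n - 1" using False by (intro ln_le_minus_one) auto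
    moreover have "real n \<le> 2 * real m + 1" "2 * real m \<le> real n" using m(1) by auto
    ultimately show ?thesis using m(3) by linarith
  qed
qed

text \<open>Replace \<open>n div d\<close> by \<open>n / d\<close> in the formula for
  \<open>ln (fact n)\<close>. The error is at most \<open>psi n\<close>, and Chebyshev's bound turns
  it into the constant 8.\<close>

lemma sum_mangoldt_over_index:
  assumes "1 \<le> n"
  shows "\<bar>(\<Sum>d=1..n. mangoldt d / real d) - ln (real n)\<bar> \<le> 8"
proof -
  have n: "0 < real n" using assms by simp
  have f: "real n * ln (real n) - real n \<le> ln (fact n)" "ln (fact n :: real) \<le> real n * ln (real n)"
  proof -
    show "ln (fact n :: real) \<le> real n * ln (real n)"
    proof -
      have "fact n \<le> (real n) ^ n" using fact_le_power[of n] by (metis of_nat_fact of_nat_le_iff of_nat_power le_refl)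
      then have "ln (fact n) \<le> ln (real n ^ n)" by (intro ln_mono) auto
      then show ?thesis using n by (simp add: ln_realpow)
    qed
    show "real n * ln (real n) - real n \<le> ln (fact n)"
      using assms
    proof (induction n rule: dec_induct)
      case base
      then show ?case by simp
    next
      case (step k)
      have k: "0 < real k" using step by simp
      have "ln (real (Suc k) / real k) \<le> real (Suc k) / real k - 1"
        using k by (intro ln_le_minus_one) auto
      then have "ln (real (Suc k)) - ln (real k) \<le> 1 / real k"
        using k by (simp add: ln_div field_simps)
      then have "real k * (ln (real (Suc k)) - ln (real k)) \<le> 1"
        using k by (simp add: field_simps)
      then have "real k * ln (real (Suc k)) \<le> real k * ln (real k) + 1"
        by (simp add: algebra_simps)
      then have "real (Suc k) * ln (real (Suc k)) - real (Suc k) \<le> ln (real (Suc k)) + (real k * ln (real k) - real k)"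
        by (simp add: algebra_simps)
      also have "\<dots> \<le> ln (real (Suc k)) + ln (fact k)" using step by simp
      also have "\<dots> = ln (fact (Suc k))" by (simp add: ln_mult)
      finally show ?case .
    qed
  qed
  have "ln (fact n) \<le> real n * (\<Sum>d=1..n. mangoldt d / real d)"
    unfolding ln_fact_eq_sum_mangoldt[OF order_refl] sum_distrib_left
  proof (rule sum_mono)
    fix d assume d: "d \<in> {1..n}"
    have "real (n div d) \<le> real n / real d" by (rule of_nat_div_le_of_nat)
    then show "mangoldt d * real (n div d) \<le> real n * (mangoldt d / real d)"
      using mult_left_mono[OF _ mangoldt_nonneg[of d], of "real (n div d)" "real n / real d"] by (simp add: mult.commute)
  qed
  moreover have "real n * (\<Sum>d=1..n. mangoldt d / real d) \<le> ln (fact n) + psi n"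
    unfolding ln_fact_eq_sum_mangoldt[OF order_refl] sum_distrib_left psi_def sum.distrib[symmetric]
  proof (rule sum_mono)
    fix d assume d: "d \<in> {1..n}"
    have "real n / real d \<le> real (n div d) + 1" using d by (intro divide_le_real_div_plus_1) auto
    from mult_left_mono[OF this mangoldt_nonneg[of d]]
    show "real n * (mangoldt d / real d) \<le> mangoldt d * real (n div d) + mangoldt d"
      by (simp add: algebra_simps)
  qed
  ultimately have "real n * (ln (real n) - 1) \<le> real n * (\<Sum>d=1..n. mangoldt d / real d)"
    "real n * (\<Sum>d=1..n. mangoldt d / real d) \<le> real n * (ln (real n) + 8)"
    using f psi_le[of n] by (auto simp: algebra_simps)
  then show ?thesis using n by (simp add: abs_le_iff)
qed

text \<open>The right-hand side is chosen so that its increments dominate the summands.\<close>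

lemma sum_ln_over_square_le:
  assumes "1 \<le> n"
  shows "(\<Sum>p=2..n. ln (real p) / (real p * (real p - 1))) \<le> 2 - (ln (real n) + 2) / real n"
  using assms
proof (induction n rule: dec_induct)
  case base
  then show ?case by simp
next
  case (step n)
  have n: "1 \<le> real n" using step by simp
  have "ln (real (Suc n) / real n) \<le> real (Suc n) / real n - 1"
    using n by (intro ln_le_minus_one) auto
  then have "ln (real (Suc n)) - ln (real n) \<le> 1 / real n"
    using n by (simp add: ln_div field_simps)
  then have "(real n + 1) * (ln (real (Suc n)) - ln (real n)) \<le> (real n + 1) * (1 / real n)"
    using n by (intro mult_left_mono) auto
  also have "\<dots> \<le> 2" using n by (simp add: field_simps)
  finally have *: "(real n + 1) * (ln (real (Suc n)) - ln (real n)) \<le> 2" .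
  have "ln (real (Suc n)) / (real (Suc n) * (real (Suc n) - 1))
      \<le> (ln (real n) + 2) / real n - (ln (real (Suc n)) + 2) / real (Suc n)"
  proof -
    have "(ln (real n) + 2) / real n - (ln (real (Suc n)) + 2) / real (Suc n)
       = ((real n + 1) * (ln (real n) + 2) - real n * (ln (real (Suc n)) + 2)) / (real (Suc n) * real n)"
      using n by (simp add: diff_divide_eq_iff divide_diff_eq_iff field_simps)
    moreover have "ln (real (Suc n)) \<le> (real n + 1) * (ln (real n) + 2) - real n * (ln (real (Suc n)) + 2)"
      using * by (simp add: algebra_simps)
    ultimately show ?thesis using n by (simp add: divide_right_mono)
  qed
  moreover have "{2..Suc n} = insert (Suc n) {2..n}" using step by auto
  ultimately show ?case using step by simp
qed

text \<open>A prime power that is not prime has exponent at least 2, and the geometric series over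
  these exponents is at most \<open>ln p / (p * (p - 1))\<close>.\<close>

lemma sum_proper_prime_powers_le:
  "(\<Sum>d\<in>{d\<in>{1..n}. \<not> prime d}. mangoldt d / real d) \<le> 2"
proof -
  define I where "I = {(p, k). prime p \<and> p \<in> {2..n} \<and> k \<in> {2..n}}"
  have finI: "finite I" unfolding I_def
    by (rule finite_subset[of _ "{2..n} \<times> {2..n}"]) auto
  have "(\<Sum>d\<in>{d\<in>{1..n}. \<not> prime d}. mangoldt d / real d)
      = (\<Sum>d\<in>{d\<in>{1..n}. \<not> prime d \<and> primepow d}. mangoldt d / real d)"
    by (rule sum.mono_neutral_right) (auto simp: mangoldt_def)
  also have "\<dots> \<le> (\<Sum>(p, k)\<in>I. ln (real p) / real p ^ k)"
  proof (rule sum_le_included[where i = "\<lambda>(p, k). p ^ k"])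
    show "\<forall>y\<in>I. 0 \<le> (case y of (p, k) \<Rightarrow> ln (real p) / real p ^ k)"
      by (auto simp: I_def)
    show "\<forall>d\<in>{d\<in>{1..n}. \<not> prime d \<and> primepow d}. \<exists>y\<in>I. (case y of (p, k) \<Rightarrow> p ^ k) = d \<and>
        mangoldt d / real d \<le> (case y of (p, k) \<Rightarrow> ln (real p) / real p ^ k)"
    proof
      fix d assume d: "d \<in> {d\<in>{1..n}. \<not> prime d \<and> primepow d}"
      then obtain p k where pk: "prime p" "0 < k" "d = p ^ k" by (auto simp: primepow_def)
      have k2: "2 \<le> k" using d pk by (cases "k = 1") auto
      have p2: "2 \<le> p" using pk prime_ge_2_nat by blast
      have "p ^ 1 \<le> p ^ k" using pk p2 by (intro power_increasing) auto
      moreover have "k < p ^ k" using p2 by (intro less_le_trans[OF less_exp power_mono]) auto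
      ultimately have "(p, k) \<in> I" using d pk k2 p2 by (auto simp: I_def)
      then show "\<exists>y\<in>I. (case y of (p, k) \<Rightarrow> p ^ k) = d \<and>
        mangoldt d / real d \<le> (case y of (p, k) \<Rightarrow> ln (real p) / real p ^ k)"
        using pk by (intro bexI[of _ "(p, k)"]) auto
    qed
  qed (use finI in auto)
  also have "\<dots> \<le> (\<Sum>(p, k)\<in>{2..n} \<times> {2..n}. ln (real p) / real p ^ k)"
    by (rule sum_mono2) (auto simp: I_def)
  also have "\<dots> = (\<Sum>p=2..n. \<Sum>k=2..n. ln (real p) / real p ^ k)"
    by (simp add: sum.cartesian_product)
  also have "\<dots> \<le> (\<Sum>p=2..n. ln (real p) / (real p * (real p - 1)))"
  proof (rule sum_mono)
    fix p assume p: "p \<in> {2..n}"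
    have geo: "(\<Sum>k=2..m. 1 / real p ^ k) \<le> 1 / (real p * (real p - 1)) - 1 / (real p ^ m * (real p - 1))" if "1 \<le> m" for m
      using that
    proof (induction m rule: dec_induct)
      case (step m)
      have "{2..Suc m} = insert (Suc m) {2..m}" using step by auto
      moreover have "1 / real p ^ Suc m = 1 / (real p ^ m * (real p - 1)) - 1 / (real p ^ Suc m * (real p - 1))"
        using p by (simp add: divide_simps)
      ultimately show ?case using step by simp
    qed auto
    have "(\<Sum>k=2..n. 1 / real p ^ k) \<le> 1 / (real p * (real p - 1))"
      using geo[of n] p by (auto intro: order_trans)
    from mult_left_mono[OF this, of "ln (real p)"]
    show "(\<Sum>k=2..n. ln (real p) / real p ^ k) \<le> ln (real p) / (real p * (real p - 1))"
      using p by (simp add: sum_distrib_left)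
  qed
  also have "\<dots> \<le> 2"
  proof (cases "1 \<le> n")
    case True
    have "0 \<le> (ln (real n) + 2) / real n" using True by simp
    then show ?thesis using sum_ln_over_square_le[OF True] by linarith
  qed auto
  finally show ?thesis .
qed

definition log_prime_sum :: "real \<Rightarrow> real" where
  "log_prime_sum v = (\<Sum>p\<in>{p. prime p \<and> real p \<le> v}. ln (real p) / real p)"

lemma finite_primes_le: "finite {p::nat. prime p \<and> real p \<le> v}"
  by (rule finite_subset[of _ "{..nat \<lfloor>v\<rfloor>}"]) (auto simp: le_nat_floor)

text \<open>Mertens' first theorem. The constant is 8 + 2 + 1: the sum over \<open>mangoldt\<close>,
  the proper prime powers, and \<open>ln 2 <= 1\<close> for rounding \<open>v\<close> down.\<close>

lemma log_prime_sum_bound: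
  assumes v: "1 \<le> v"
  shows "\<bar>log_prime_sum v - ln v\<bar> \<le> 11"
proof -
  define n where "n = nat \<lfloor>v\<rfloor>"
  have n: "1 \<le> n" "real n \<le> v" "v \<le> 2 * real n"
  proof -
    show "1 \<le> n" using v by (auto simp: n_def le_nat_iff le_floor_iff)
    show "real n \<le> v" using v by (simp add: n_def)
    have "v < real n + 1" using v unfolding n_def by linarith
    then show "v \<le> 2 * real n" using \<open>1 \<le> n\<close> by linarith
  qed
  have set: "{p. prime p \<and> real p \<le> v} = {d\<in>{1..n}. prime d}"
    using v by (auto simp: n_def le_nat_floor Suc_le_eq prime_gt_0_nat) (metis (no_types) n_def n(2) of_nat_mono order_trans)
  have "(\<Sum>d=1..n. mangoldt d / real d) = (\<Sum>d\<in>{d\<in>{1..n}. prime d}. mangoldt d / real d)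
      + (\<Sum>d\<in>{d\<in>{1..n}. \<not> prime d}. mangoldt d / real d)"
    by (subst sum.union_disjoint[symmetric]) (auto intro!: sum.cong)
  also have "(\<Sum>d\<in>{d\<in>{1..n}. prime d}. mangoldt d / real d) = log_prime_sum v"
    unfolding log_prime_sum_def set by (intro sum.cong refl) auto
  finally have "(\<Sum>d=1..n. mangoldt d / real d) = log_prime_sum v
      + (\<Sum>d\<in>{d\<in>{1..n}. \<not> prime d}. mangoldt d / real d)" .
  moreover have "0 \<le> (\<Sum>d\<in>{d\<in>{1..n}. \<not> prime d}. mangoldt d / real d)"
    by (intro sum_nonneg divide_nonneg_nonneg mangoldt_nonneg) auto
  moreover have "ln (real n) \<le> ln v" using n by (intro ln_mono) auto
  moreover have "ln v \<le> ln (2 * real n)" using n v by (intro ln_mono) auto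
  moreover have "ln (2 * real n) = ln 2 + ln (real n)" using n by (simp add: ln_mult)
  moreover have "ln (2::real) \<le> 1" using ln_le_minus_one[of "2::real"] by simp
  ultimately show ?thesis
    using sum_mangoldt_over_index[OF n(1)] sum_proper_prime_powers_le[of n] by linarith
qed

section \<open>Reciprocals of primes in intervals given by powers of x\<close>

definition prime_recip_sum :: "real \<Rightarrow> real \<Rightarrow> real" where
  "prime_recip_sum u v = (\<Sum>p\<in>{p. prime p \<and> u < real p \<and> real p \<le> v}. 1 / real p)"

lemma finite_primes_between: "finite {p::nat. prime p \<and> u < real p \<and> real p \<le> v}"
  by (rule finite_subset[OF _ finite_primes_le[of v]]) auto

lemma prime_recip_sum_nonneg: "0 \<le> prime_recip_sum u v"
  unfolding prime_recip_sum_def by (intro sum_nonneg) auto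

lemma prime_recip_sum_add:
  assumes "u \<le> v" "v \<le> w"
  shows "prime_recip_sum u w = prime_recip_sum u v + prime_recip_sum v w"
proof -
  have "{p::nat. prime p \<and> u < real p \<and> real p \<le> w}
      = {p. prime p \<and> u < real p \<and> real p \<le> v} \<union> {p. prime p \<and> v < real p \<and> real p \<le> w}"
    using assms by auto
  then show ?thesis unfolding prime_recip_sum_def
    by (simp only:) (intro sum.union_disjoint finite_primes_between, auto)
qed

text \<open>On the interval the weight \<open>ln p\<close> lies between \<open>ln u\<close> and
  \<open>ln v\<close>, and 22 is twice the error 11 of Mertens' theorem. The two bounds are close
  only when \<open>ln v / ln u\<close> is close to 1.\<close>

lemma prime_recip_sum_bounds:
  assumes u: "1 < u" "u \<le> v"
  shows "(ln v - ln u - 22) / ln v \<le> prime_recip_sum u v"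
    and "prime_recip_sum u v \<le> (ln v - ln u + 22) / ln u"
proof -
  define S where "S = (\<Sum>p\<in>{p. prime p \<and> u < real p \<and> real p \<le> v}. ln (real p) / real p)"
  have "{p::nat. prime p \<and> real p \<le> v} = {p. prime p \<and> real p \<le> u} \<union> {p. prime p \<and> u < real p \<and> real p \<le> v}"
    using u by auto
  then have "log_prime_sum v = log_prime_sum u + S" unfolding log_prime_sum_def S_def
    by (simp only:) (intro sum.union_disjoint finite_primes_between finite_primes_le, auto)
  then have S: "ln v - ln u - 22 \<le> S" "S \<le> ln v - ln u + 22"
    using log_prime_sum_bound[of u] log_prime_sum_bound[of v] u by auto
  have lnu: "0 < ln u" "ln u \<le> ln v" "0 < ln v" using u by auto
  have "S \<le> (\<Sum>p\<in>{p. prime p \<and> u < real p \<and> real p \<le> v}. ln v * (1 / real p))"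
    unfolding S_def using u by (intro sum_mono) (auto intro!: divide_right_mono)
  then have "S \<le> ln v * prime_recip_sum u v" by (simp only: prime_recip_sum_def sum_distrib_left)
  then show "(ln v - ln u - 22) / ln v \<le> prime_recip_sum u v"
    using S lnu by (simp add: field_simps)
  have "(\<Sum>p\<in>{p. prime p \<and> u < real p \<and> real p \<le> v}. ln u * (1 / real p)) \<le> S"
    unfolding S_def using u by (intro sum_mono) (auto intro!: divide_right_mono)
  then have "ln u * prime_recip_sum u v \<le> S" by (simp only: prime_recip_sum_def sum_distrib_left)
  then show "prime_recip_sum u v \<le> (ln v - ln u + 22) / ln u"
    using S lnu by (simp add: field_simps)
qed

text \<open>The range of exponents is cut into \<open>m\<close> pieces of ratio \<open>r\<close>, so
  that on each piece the preceding bounds lose little. All pieces have exponent at least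
  \<open>a\<close>, which bounds each error by \<open>22 / (a * ln x)\<close>.\<close>

lemma prime_recip_sum_powr_bounds:
  fixes x a r :: real and m :: nat
  assumes x: "1 < x" and a: "0 < a" and r: "1 < r"
  shows "real m * (1 - 1 / r) - real m * (22 / (a * ln x)) \<le> prime_recip_sum (x powr a) (x powr (a * r ^ m))"
    and "prime_recip_sum (x powr a) (x powr (a * r ^ m)) \<le> real m * (r - 1) + real m * (22 / (a * ln x))"
proof (induction m)
  case 0
  { case 1 show ?case by (simp add: prime_recip_sum_nonneg) }
  { case 2
    have "{p::nat. prime p \<and> x powr a < real p \<and> real p \<le> x powr a} = {}" by auto
    then show ?case unfolding prime_recip_sum_def by (simp del: Collect_empty_eq) }
next
  case (Suc m)
  define b where "b = a * r ^ m"
  have b: "a \<le> b" "0 < b" using a r by (auto simp: b_def)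
  have br: "b \<le> b * r" using b r by simp
  have lnx: "0 < ln x" using x by simp
  have split: "prime_recip_sum (x powr a) (x powr (a * r ^ Suc m))
      = prime_recip_sum (x powr a) (x powr b) + prime_recip_sum (x powr b) (x powr (b * r))"
    using x b br by (subst prime_recip_sum_add[symmetric, of _ "x powr b"]) (auto simp: b_def mult_ac)
  have gt: "1 < x powr b" using x b by (metis powr_less_mono powr_zero_eq_one less_numeral_extra(1) order.strict_trans neq0_conv less_irrefl zero_less_one)
  have le: "x powr b \<le> x powr (b * r)" using x br by (intro powr_mono) auto
  have lo: "1 - 1 / r - 22 / (a * ln x) \<le> prime_recip_sum (x powr b) (x powr (b * r))"
  proof -
    have "(ln (x powr (b * r)) - ln (x powr b) - 22) / ln (x powr (b * r)) = 1 - 1 / r - 22 / (b * r * ln x)"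
      using x b r lnx by (simp add: ln_powr field_simps)
    moreover have "22 / (b * r * ln x) \<le> 22 / (a * ln x)"
      using a b br lnx r by (intro divide_left_mono mult_right_mono mult_pos_pos) linarith+
    ultimately show ?thesis using prime_recip_sum_bounds(1)[OF gt le] by linarith
  qed
  have hi: "prime_recip_sum (x powr b) (x powr (b * r)) \<le> r - 1 + 22 / (a * ln x)"
  proof -
    have "(ln (x powr (b * r)) - ln (x powr b) + 22) / ln (x powr b) = r - 1 + 22 / (b * ln x)"
      using x b r lnx by (simp add: ln_powr field_simps)
    moreover have "22 / (b * ln x) \<le> 22 / (a * ln x)"
      using a b br lnx by (intro divide_left_mono mult_right_mono mult_pos_pos) auto
    ultimately show ?thesis using prime_recip_sum_bounds(2)[OF gt le] by linarith
  qed
  have Suc_mult: "real (Suc m) * t = real m * t + t" for t by (simp add: distrib_right)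
  { case 1 show ?case using Suc(1) lo unfolding split Suc_mult b_def by linarith }
  { case 2 show ?case using Suc(2) hi unfolding split Suc_mult b_def by linarith }
qed

text \<open>Geometric partitions \<open>a r\<^sup>j\<close> of the exponents take the place of partial summation.\<close>

lemma prime_recip_sum_tendsto:
  fixes a b :: real
  assumes a: "0 < a" and ab: "a < b"
  shows "((\<lambda>x. prime_recip_sum (x powr a) (x powr b)) \<longlongrightarrow> ln (b / a)) at_top"
proof (rule tendstoI)
  fix e :: real assume e: "0 < e"
  define c where "c = b / a"
  have c: "1 < c" using a ab by (simp add: c_def)
  \<comment> \<open>These are the upper and lower main terms for \<open>m\<close> pieces of ratio
    \<open>c powr (1 / m)\<close>. First \<open>m\<close> is fixed, and only then \<open>x\<close>
    grows.\<close>
  have "((\<lambda>m::real. m * (c powr (1 / m) - 1)) \<longlongrightarrow> ln c) at_top"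
    and "((\<lambda>m::real. m * (1 - 1 / c powr (1 / m))) \<longlongrightarrow> ln c) at_top"
    using c by real_asymp+
  then have lims: "(\<lambda>m::nat. real m * (c powr (1 / real m) - 1)) \<longlonglongrightarrow> ln c"
    "(\<lambda>m::nat. real m * (1 - 1 / c powr (1 / real m))) \<longlonglongrightarrow> ln c"
    by (auto intro: filterlim_compose[OF _ filterlim_real_sequentially])
  have "eventually (\<lambda>m::nat. real m * (c powr (1 / real m) - 1) < ln c + e / 2) sequentially"
    using lims(1) e by (intro order_tendstoD) auto
  moreover have "eventually (\<lambda>m::nat. real m * (1 - 1 / c powr (1 / real m)) > ln c - e / 2) sequentially"
    using lims(2) e by (intro order_tendstoD) auto
  moreover have "eventually (\<lambda>m::nat. 1 \<le> m) sequentially" by (rule eventually_ge_at_top)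
  ultimately have "eventually (\<lambda>m::nat. real m * (c powr (1 / real m) - 1) < ln c + e / 2 \<and>
      real m * (1 - 1 / c powr (1 / real m)) > ln c - e / 2 \<and> 1 \<le> m) sequentially"
    by eventually_elim auto
  then obtain m :: nat where m: "real m * (c powr (1 / real m) - 1) < ln c + e / 2"
      "real m * (1 - 1 / c powr (1 / real m)) > ln c - e / 2" "1 \<le> m"
    by (auto simp: eventually_sequentially)
  define r where "r = c powr (1 / real m)"
  have r: "1 < r" "a * r ^ m = b"
  proof -
    show "1 < r" using c m powr_less_mono[of 0 "1 / real m" c] by (simp add: r_def)
    have "r ^ m = c powr (real m * (1 / real m))" unfolding r_def using c by (simp add: powr_powr flip: powr_realpow)
    then show "a * r ^ m = b" using c m a by (simp add: c_def)
  qed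
  have "((\<lambda>x. real m * (22 / (a * ln x))) \<longlongrightarrow> 0) at_top" using a by real_asymp
  then have "eventually (\<lambda>x. real m * (22 / (a * ln x)) < e / 2) at_top"
    using e by (intro order_tendstoD) auto
  then show "eventually (\<lambda>x. dist (prime_recip_sum (x powr a) (x powr b)) (ln (b / a)) < e) at_top"
    using eventually_gt_at_top[of 1]
  proof eventually_elim
    case (elim x)
    then show ?case
      using prime_recip_sum_powr_bounds[OF elim(2) a r(1), of m] m(1,2) unfolding r(2)
      unfolding r_def[symmetric] c_def[symmetric] dist_real_def by linarith
  qed
qed

section \<open>Existence of Dickman's function\<close>

lemma smooth_int_iff: "smooth y (int n) \<longleftrightarrow> (\<forall>p. prime p \<longrightarrow> p dvd n \<longrightarrow> real p \<le> y)"
proof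
  assume s: "smooth y (int n)"
  show "\<forall>p. prime p \<longrightarrow> p dvd n \<longrightarrow> real p \<le> y"
  proof safe
    fix p :: nat assume "prime p" "p dvd n"
    then have "prime (int p)" "int p dvd int n" by auto
    from s[unfolded smooth_def, rule_format, OF this] show "real p \<le> y" by simp
  qed
next
  assume s: "\<forall>p. prime p \<longrightarrow> p dvd n \<longrightarrow> real p \<le> y"
  show "smooth y (int n)"
    unfolding smooth_def
  proof safe
    fix p :: int assume p: "prime p" "p dvd int n"
    then obtain q where q: "p = int q" by (metis prime_ge_0_int nonneg_int_cases)
    then show "real_of_int p \<le> y" using s p by simp
  qed
qed

lemma smooth_count_eq:
  "smooth_count x y = card {n::nat. 0 < n \<and> real n \<le> x \<and> (\<forall>p. prime p \<longrightarrow> p dvd n \<longrightarrow> real p \<le> y)}"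
proof -
  have "{n::int. 0 < n \<and> real_of_int n \<le> x \<and> smooth y n}
      = int ` {n::nat. 0 < n \<and> real n \<le> x \<and> (\<forall>p. prime p \<longrightarrow> p dvd n \<longrightarrow> real p \<le> y)}"
  proof (rule equalityI; rule subsetI)
    fix n :: int assume n: "n \<in> {n::int. 0 < n \<and> real_of_int n \<le> x \<and> smooth y n}"
    then obtain k where k: "n = int k" by (metis (mono_tags, lifting) mem_Collect_eq order_less_imp_le nonneg_int_cases)
    then show "n \<in> int ` {n::nat. 0 < n \<and> real n \<le> x \<and> (\<forall>p. prime p \<longrightarrow> p dvd n \<longrightarrow> real p \<le> y)}"
      using n smooth_int_iff[of y k] by auto
  next
    fix n :: int assume "n \<in> int ` {n::nat. 0 < n \<and> real n \<le> x \<and> (\<forall>p. prime p \<longrightarrow> p dvd n \<longrightarrow> real p \<le> y)}"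
    then obtain k where k: "n = int k" "0 < k" "real k \<le> x" "\<forall>p. prime p \<longrightarrow> p dvd k \<longrightarrow> real p \<le> y" by blast
    then show "n \<in> {n::int. 0 < n \<and> real_of_int n \<le> x \<and> smooth y n}"
      using smooth_int_iff[of y k] by simp
  qed
  then show ?thesis unfolding smooth_count_def by (simp add: card_image)
qed

lemma finite_nat_le_real: "finite {n::nat. 0 < n \<and> real n \<le> x \<and> P n}"
  by (rule finite_subset[of _ "{..nat \<lfloor>x\<rfloor>}"]) (auto simp: le_nat_floor)

lemma smooth_count_mono: "y \<le> y' \<Longrightarrow> smooth_count x y \<le> smooth_count x y'"
  unfolding smooth_count_eq by (intro card_mono finite_nat_le_real) (auto intro: order_trans)

lemma card_nat_le_real:
  assumes "0 \<le> x"
  shows "card {n::nat. 0 < n \<and> real n \<le> x} = nat \<lfloor>x\<rfloor>"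
proof -
  have "{n::nat. 0 < n \<and> real n \<le> x} = {1..nat \<lfloor>x\<rfloor>}"
    using assms by (auto simp: le_nat_floor Suc_le_eq) (simp add: le_floor_iff le_nat_iff)
  then show ?thesis by simp
qed

lemma smooth_count_le:
  assumes "0 \<le> x"
  shows "real (smooth_count x y) \<le> x"
proof -
  have "smooth_count x y \<le> card {n::nat. 0 < n \<and> real n \<le> x \<and> True}"
    unfolding smooth_count_eq by (intro card_mono finite_nat_le_real) auto
  then have "smooth_count x y \<le> nat \<lfloor>x\<rfloor>" using card_nat_le_real[OF assms] by simp
  then show ?thesis using assms by (metis of_nat_floor of_nat_mono order_trans)
qed

lemma smooth_count_self:
  assumes "0 \<le> x" "x \<le> y"
  shows "smooth_count x y = nat \<lfloor>x\<rfloor>"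
proof -
  have "{n::nat. 0 < n \<and> real n \<le> x \<and> (\<forall>p. prime p \<longrightarrow> p dvd n \<longrightarrow> real p \<le> y)} = {n::nat. 0 < n \<and> real n \<le> x}"
    using assms by (auto dest!: dvd_imp_le)
  then show ?thesis unfolding smooth_count_eq using card_nat_le_real[OF assms(1)] by simp
qed

text \<open>Buchstab's identity: sort the integers that are not \<open>y\<close>-smooth by their largest prime factor.\<close>

lemma buchstab:
  assumes x: "0 \<le> x"
  shows "nat \<lfloor>x\<rfloor> = smooth_count x y + (\<Sum>p\<in>{p. prime p \<and> y < real p \<and> real p \<le> x}. smooth_count (x / real p) (real p))"
proof -
  define Q where "Q = {p::nat. prime p \<and> y < real p \<and> real p \<le> x}"
  define N where "N z w = {n::nat. 0 < n \<and> real n \<le> z \<and> (\<forall>p. prime p \<longrightarrow> p dvd n \<longrightarrow> real p \<le> w)}" for z w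
  have finN: "finite (N z w)" for z w unfolding N_def by (rule finite_nat_le_real)
  have finQ: "finite Q" unfolding Q_def by (rule finite_primes_between)
  have U: "{n::nat. 0 < n \<and> real n \<le> x} = N x y \<union> (\<Union>p\<in>Q. (\<lambda>m. p * m) ` N (x / real p) (real p))"
  proof (rule equalityI; rule subsetI)
    fix n assume n: "n \<in> {n::nat. 0 < n \<and> real n \<le> x}"
    show "n \<in> N x y \<union> (\<Union>p\<in>Q. (\<lambda>m. p * m) ` N (x / real p) (real p))"
    proof (cases "n \<in> N x y")
      case False
      define P where "P = {p. prime p \<and> p dvd n}"
      have finP: "finite P" unfolding P_def
        by (rule finite_subset[of _ "{..n}"]) (use n in \<open>auto dest: dvd_imp_le\<close>)
      obtain q where q: "q \<in> P" "y < real q" using False n by (auto simp: N_def P_def not_le)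
      define p where "p = Max P"
      have p: "p \<in> P" using Max_in finP q unfolding p_def by blast
      have qp: "q \<le> p" unfolding p_def using finP q by simp
      obtain m where m: "n = p * m" using p by (auto simp: P_def elim: dvdE)
      have pos: "0 < p" "0 < m" using n m by auto
      have "p \<le> n" using m pos by simp
      then have "p \<in> Q" using p qp q n by (auto simp: Q_def P_def)
      moreover have "m \<in> N (x / real p) (real p)"
      proof -
        have "real r \<le> real p" if r: "prime r" "r dvd m" for r
        proof -
          have "r \<in> P" using r by (simp add: P_def m)
          then have "r \<le> p" unfolding p_def using finP by (rule Max_ge[rotated])
          then show ?thesis by simp
        qed
        moreover have "real m \<le> x / real p" using n m pos by (simp add: field_simps)
        ultimately show ?thesis using pos by (auto simp: N_def)
      qed
      ultimately show ?thesis using m by blast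
    qed simp
  next
    fix n assume "n \<in> N x y \<union> (\<Union>p\<in>Q. (\<lambda>m. p * m) ` N (x / real p) (real p))"
    then show "n \<in> {n::nat. 0 < n \<and> real n \<le> x}"
    proof
      assume "n \<in> (\<Union>p\<in>Q. (\<lambda>m. p * m) ` N (x / real p) (real p))"
      then obtain p m where pm: "p \<in> Q" "n = p * m" "m \<in> N (x / real p) (real p)" by blast
      have "0 < p" using pm by (auto simp: Q_def prime_gt_0_nat)
      then show ?thesis using pm by (auto simp: N_def field_simps)
    qed (auto simp: N_def)
  qed
  have disj1: "N x y \<inter> (\<Union>p\<in>Q. (\<lambda>m. p * m) ` N (x / real p) (real p)) = {}"
  proof -
    have False if "p \<in> Q" "p * m \<in> N x y" for p m
      using that by (auto simp: N_def Q_def)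
    then show ?thesis by blast
  qed
  have disj2: "(\<lambda>m. p * m) ` N (x / real p) (real p) \<inter> (\<lambda>m. q * m) ` N (x / real q) (real q) = {}"
    if pq: "p \<in> Q" "q \<in> Q" "p \<noteq> q" for p q
  proof -
    \<comment> \<open>Every prime factor of \<open>b * k\<close> is at most \<open>b\<close>, as
      \<open>k\<close> is \<open>b\<close>-smooth. Applied in both directions, this makes the two
      primes equal.\<close>
    have le: "a \<le> b" if ab: "a \<in> Q" "b \<in> Q" "a * m = b * k" "k \<in> N (x / real b) (real b)" for a b m k
    proof -
      have "a dvd b * k" using ab(3) by (metis dvd_triv_left)
      then have "a dvd b \<or> a dvd k" using ab(1) prime_dvd_mult_iff by (auto simp: Q_def)
      then show ?thesis
      proof
        assume "a dvd b" then show ?thesis using ab by (auto simp: Q_def prime_gt_0_nat intro: dvd_imp_le)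
      next
        assume "a dvd k" then show ?thesis using ab by (auto simp: Q_def N_def)
      qed
    qed
    show ?thesis
    proof (rule ccontr)
      assume "\<not> ?thesis"
      then obtain m k where "p * m = q * k" "m \<in> N (x / real p) (real p)" "k \<in> N (x / real q) (real q)" by blast
      then have "p \<le> q" "q \<le> p" using le[of p q m k] le[of q p k m] pq by auto
      then show False using pq by simp
    qed
  qed
  have "nat \<lfloor>x\<rfloor> = card (N x y) + card (\<Union>p\<in>Q. (\<lambda>m. p * m) ` N (x / real p) (real p))"
    unfolding card_nat_le_real[OF x, symmetric] U using finN finQ disj1 by (intro card_Un_disjoint) auto
  also have "card (\<Union>p\<in>Q. (\<lambda>m. p * m) ` N (x / real p) (real p)) = (\<Sum>p\<in>Q. card ((\<lambda>m. p * m) ` N (x / real p) (real p)))"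
    using finN finQ disj2 by (intro card_UN_disjoint) auto
  also have "\<dots> = (\<Sum>p\<in>Q. smooth_count (x / real p) (real p))"
  proof (intro sum.cong refl)
    fix p assume "p \<in> Q"
    then have "0 < p" by (auto simp: Q_def prime_gt_0_nat)
    then show "card ((\<lambda>m. p * m) ` N (x / real p) (real p)) = smooth_count (x / real p) (real p)"
      unfolding smooth_count_eq N_def by (intro card_image) (auto simp: inj_on_def)
  qed
  finally show ?thesis unfolding N_def[of x y] smooth_count_eq[symmetric] Q_def .
qed

section \<open>Convergence of the density of smooth numbers\<close>

text \<open>The exponent \<open>s\<close> is the reciprocal of the argument of Dickman's
  function.\<close>

definition smooth_density :: "real \<Rightarrow> real \<Rightarrow> real" where
  "smooth_density s x = real (smooth_count x (x powr s)) / x"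

lemma smooth_density_bounds:
  assumes "0 < x"
  shows "0 \<le> smooth_density s x" "smooth_density s x \<le> 1"
  using assms smooth_count_le[of x] by (auto simp: smooth_density_def)

text \<open>The portion of Buchstab's sum in which the largest prime factor has exponent between
  \<open>v\<close> and \<open>w\<close>, normalised by \<open>x\<close>.\<close>

definition prime_slice :: "real \<Rightarrow> real \<Rightarrow> real \<Rightarrow> real" where
  "prime_slice v w x = (\<Sum>p\<in>{p. prime p \<and> x powr v < real p \<and> real p \<le> x powr w}.
      real (smooth_count (x / real p) (real p)) / x)"

lemma prime_slice_bounds:
  assumes x: "1 < x"
  shows "0 \<le> prime_slice v w x" "prime_slice v w x \<le> prime_recip_sum (x powr v) (x powr w)"
proof -
  show "0 \<le> prime_slice v w x" using x by (auto simp: prime_slice_def intro!: sum_nonneg)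
  show "prime_slice v w x \<le> prime_recip_sum (x powr v) (x powr w)"
    unfolding prime_slice_def prime_recip_sum_def
  proof (rule sum_mono)
    fix p :: nat assume "p \<in> {p. prime p \<and> x powr v < real p \<and> real p \<le> x powr w}"
    then have "0 < real p" by (auto simp: prime_gt_0_nat)
    then show "real (smooth_count (x / real p) (real p)) / x \<le> 1 / real p"
      using smooth_count_le[of "x / real p" "real p"] x by (simp add: field_simps)
  qed
qed

lemma prime_slice_add:
  assumes x: "1 < x" and "u \<le> v" "v \<le> w"
  shows "prime_slice u w x = prime_slice u v x + prime_slice v w x"
proof -
  have "x powr u \<le> x powr v" "x powr v \<le> x powr w" using assms by (auto intro: powr_mono)
  then have "{p::nat. prime p \<and> x powr u < real p \<and> real p \<le> x powr w}
      = {p. prime p \<and> x powr u < real p \<and> real p \<le> x powr v} \<union> {p. prime p \<and> x powr v < real p \<and> real p \<le> x powr w}"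
    by auto
  then show ?thesis unfolding prime_slice_def
    by (simp only:) (intro sum.union_disjoint finite_primes_between, auto)
qed

lemma smooth_density_eq:
  assumes x: "1 < x"
  shows "smooth_density s x = real (nat \<lfloor>x\<rfloor>) / x - prime_slice s 1 x"
proof -
  have "real (nat \<lfloor>x\<rfloor>) = real (smooth_count x (x powr s))
      + (\<Sum>p\<in>{p. prime p \<and> x powr s < real p \<and> real p \<le> x}. real (smooth_count (x / real p) (real p)))"
    using buchstab[of x "x powr s"] x by (simp flip: of_nat_sum of_nat_add)
  then show ?thesis using x
    by (simp add: smooth_density_def prime_slice_def add_divide_distrib sum_divide_distrib)
qed

text \<open>A prime \<open>p = x\<^sup>v\<close> is the power \<open>(x / p)\<^sup>u\<close> with \<open>u = v / (1 - v)\<close>.\<close>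

lemma smooth_count_quotient_bounds:
  assumes x: "1 < x" and vw: "0 < v" "v < w" "w < 1"
    and p: "prime p" "x powr v < real p" "real p \<le> x powr w"
  defines "X \<equiv> x / real p"
  shows "x powr (1 - w) \<le> X"
    and "smooth_count X (X powr (v / (1 - v))) \<le> smooth_count X (real p)"
    and "smooth_count X (real p) \<le> smooth_count X (X powr (w / (1 - w)))"
proof -
  have p0: "0 < real p" using p by (simp add: prime_gt_0_nat)
  have "x powr (1 - w) = x / x powr w" using x by (simp add: powr_diff)
  also have "\<dots> \<le> X" unfolding X_def using x p p0 by (intro divide_left_mono) auto
  finally show 1: "x powr (1 - w) \<le> X" .
  have X0: "0 < X" using 1 x powr_gt_zero[of x "1 - w"] by linarith
  have "X \<le> x / x powr v" unfolding X_def using x p p0 by (intro divide_left_mono) auto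
  also have "\<dots> = x powr (1 - v)" using x by (simp add: powr_diff)
  finally have "X powr (v / (1 - v)) \<le> (x powr (1 - v)) powr (v / (1 - v))"
    using X0 vw by (intro powr_mono2) auto
  also have "\<dots> = x powr v" using vw by (simp add: powr_powr)
  finally show "smooth_count X (X powr (v / (1 - v))) \<le> smooth_count X (real p)"
    using p by (intro smooth_count_mono) auto
  have "x powr w = (x powr (1 - w)) powr (w / (1 - w))" using vw by (simp add: powr_powr)
  also have "\<dots> \<le> X powr (w / (1 - w))" using 1 vw by (intro powr_mono2) auto
  finally show "smooth_count X (real p) \<le> smooth_count X (X powr (w / (1 - w)))"
    using p by (intro smooth_count_mono) auto
qed

text \<open>Each summand is \<open>1 / p\<close> times a density at \<open>x / p\<close>, squeezed
  between the densities with exponents \<open>v / (1 - v)\<close> and \<open>w / (1 - w)\<close>. As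
  \<open>w < 1\<close>, the point \<open>x / p\<close> is at least \<open>x powr (1 - w)\<close>, so
  the two limits apply uniformly in \<open>p\<close>; the weights \<open>1 / p\<close> add up to
  \<open>ln (w / v)\<close> in the limit.\<close>

lemma prime_slice_asymp:
  assumes vw: "0 < v" "v < w" "w < 1"
    and a: "(smooth_density (v / (1 - v)) \<longlongrightarrow> a) at_top"
    and b: "(smooth_density (w / (1 - w)) \<longlongrightarrow> b) at_top"
    and e: "0 < e"
  shows "eventually (\<lambda>x. a * ln (w / v) - e \<le> prime_slice v w x \<and> prime_slice v w x \<le> b * ln (w / v) + e) at_top"
proof -
  define l where "l = ln (w / v)"
  have l: "0 < l" using vw by (simp add: l_def)
  define d where "d = e / (2 * l)"
  have d: "0 < d" "d * l < e" using e l by (auto simp: d_def)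
  have PR: "((\<lambda>x. prime_recip_sum (x powr v) (x powr w)) \<longlongrightarrow> l) at_top"
    unfolding l_def using vw by (intro prime_recip_sum_tendsto) auto
  have pw: "filterlim (\<lambda>x::real. x powr (1 - w)) at_top at_top" using vw by real_asymp
  have "eventually (\<lambda>X. a - d < smooth_density (v / (1 - v)) X) at_top"
    using a d by (intro order_tendstoD) auto
  moreover have "eventually (\<lambda>X. smooth_density (w / (1 - w)) X < b + d) at_top"
    using b d by (intro order_tendstoD) auto
  ultimately have "eventually (\<lambda>X. a - d < smooth_density (v / (1 - v)) X \<and> smooth_density (w / (1 - w)) X < b + d) at_top"
    by eventually_elim auto
  then obtain X0 where X0: "\<And>X. X0 \<le> X \<Longrightarrow> a - d < smooth_density (v / (1 - v)) X \<and> smooth_density (w / (1 - w)) X < b + d"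
    by (auto simp: eventually_at_top_linorder)
  have "((\<lambda>x. (a - d) * prime_recip_sum (x powr v) (x powr w)) \<longlongrightarrow> (a - d) * l) at_top"
    by (intro tendsto_intros PR)
  then have "eventually (\<lambda>x. a * l - e < (a - d) * prime_recip_sum (x powr v) (x powr w)) at_top"
    using d by (intro order_tendstoD) (auto simp: algebra_simps)
  moreover have "((\<lambda>x. (b + d) * prime_recip_sum (x powr v) (x powr w)) \<longlongrightarrow> (b + d) * l) at_top"
    by (intro tendsto_intros PR)
  then have "eventually (\<lambda>x. (b + d) * prime_recip_sum (x powr v) (x powr w) < b * l + e) at_top"
    using d by (intro order_tendstoD) (auto simp: algebra_simps)
  moreover have "eventually (\<lambda>x. X0 \<le> x powr (1 - w)) at_top"
    using pw by (simp add: filterlim_at_top)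
  ultimately show ?thesis
    using eventually_gt_at_top[of 1]
  proof eventually_elim
    case (elim x)
    have *: "(a - d) * (1 / real p) \<le> real (smooth_count (x / real p) (real p)) / x \<and>
        real (smooth_count (x / real p) (real p)) / x \<le> (b + d) * (1 / real p)"
      if p: "p \<in> {p. prime p \<and> x powr v < real p \<and> real p \<le> x powr w}" for p
    proof -
      define X where "X = x / real p"
      have p0: "0 < real p" using p by (auto simp: prime_gt_0_nat)
      have pp: "prime p" "x powr v < real p" "real p \<le> x powr w" using p by auto
      note q = smooth_count_quotient_bounds[OF elim(4) vw pp, folded X_def]
      have X: "X0 \<le> X" "0 < X" using q(1) elim p0 by (auto simp: X_def)
      have "(a - d) * X \<le> real (smooth_count X (real p))"
      proof -
        have "(a - d) * X \<le> real (smooth_count X (X powr (v / (1 - v))))"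
          using X0[OF X(1)] X(2) by (simp add: smooth_density_def field_simps)
        also have "\<dots> \<le> real (smooth_count X (real p))" using q(2) by simp
        finally show ?thesis .
      qed
      moreover have "real (smooth_count X (real p)) \<le> (b + d) * X"
      proof -
        have "real (smooth_count X (real p)) \<le> real (smooth_count X (X powr (w / (1 - w))))" using q(3) by simp
        also have "\<dots> \<le> (b + d) * X"
          using X0[OF X(1)] X(2) by (simp add: smooth_density_def field_simps)
        finally show ?thesis .
      qed
      ultimately have "(a - d) * X / x \<le> real (smooth_count X (real p)) / x" "real (smooth_count X (real p)) / x \<le> (b + d) * X / x"
        using elim(4) by (auto intro: divide_right_mono)
      then show ?thesis using elim(4) p0 by (simp add: X_def)
    qed
    have "(a - d) * prime_recip_sum (x powr v) (x powr w) \<le> prime_slice v w x"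
      unfolding prime_recip_sum_def prime_slice_def sum_distrib_left using * by (intro sum_mono) blast
    moreover have "prime_slice v w x \<le> (b + d) * prime_recip_sum (x powr v) (x powr w)"
      unfolding prime_recip_sum_def prime_slice_def sum_distrib_left using * by (intro sum_mono) blast
    ultimately show ?case using elim unfolding l_def by linarith
  qed
qed

text \<open>Lower and upper Riemann sums, with densities taken at the left and right ends of the
  pieces, each of weight \<open>ln r\<close>. The induction keeps \<open>e\<close> arbitrary and
  gives half of it to the last piece.\<close>

lemma prime_slice_geometric_asymp:
  assumes s: "0 < s" and r: "1 < r" and m: "s * r ^ m < 1"
    and g: "\<And>j. j \<le> m \<Longrightarrow> (smooth_density (s * r ^ j / (1 - s * r ^ j)) \<longlongrightarrow> g j) at_top"
    and e: "0 < e"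
  shows "eventually (\<lambda>x. ln r * (\<Sum>j<m. g j) - e \<le> prime_slice s (s * r ^ m) x
      \<and> prime_slice s (s * r ^ m) x \<le> ln r * (\<Sum>j<m. g (Suc j)) + e) at_top"
  using m g e
proof (induction m arbitrary: e)
  case 0
  have "{p::nat. prime p \<and> x powr s < real p \<and> real p \<le> x powr s} = {}" for x by auto
  then have "prime_slice s s x = 0" for x unfolding prime_slice_def by (simp del: Collect_empty_eq)
  then show ?case using 0 by simp
next
  case (Suc m)
  have lt: "s * r ^ m < s * r ^ Suc m" using s r by simp
  then have m1: "s * r ^ m < 1" using Suc.prems by linarith
  have sm: "s \<le> s * r ^ m" "0 < s * r ^ m" using s r by auto
  have ratio: "s * r ^ Suc m / (s * r ^ m) = r" using s r by simp
  have "eventually (\<lambda>x. ln r * (\<Sum>j<m. g j) - e / 2 \<le> prime_slice s (s * r ^ m) x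
      \<and> prime_slice s (s * r ^ m) x \<le> ln r * (\<Sum>j<m. g (Suc j)) + e / 2) at_top"
    using Suc.prems m1 by (intro Suc.IH) auto
  moreover have "eventually (\<lambda>x. g m * ln (s * r ^ Suc m / (s * r ^ m)) - e / 2 \<le> prime_slice (s * r ^ m) (s * r ^ Suc m) x
      \<and> prime_slice (s * r ^ m) (s * r ^ Suc m) x \<le> g (Suc m) * ln (s * r ^ Suc m / (s * r ^ m)) + e / 2) at_top"
    using Suc.prems(1,3) lt sm Suc.prems(2)[of m] Suc.prems(2)[of "Suc m"]
    by (intro prime_slice_asymp) (auto simp del: power_Suc)
  ultimately show ?case
    using eventually_gt_at_top[of 1]
  proof eventually_elim
    case (elim x)
    have "prime_slice s (s * r ^ Suc m) x = prime_slice s (s * r ^ m) x + prime_slice (s * r ^ m) (s * r ^ Suc m) x"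
      using elim sm lt by (intro prime_slice_add) auto
    then show ?case using elim(1,2) unfolding ratio by (simp add: distrib_left mult.commute)
  qed
qed

text \<open>The limit is the supremum of all eventual lower bounds: every eventual upper bound lies
  above it, so it stays within each narrow band.\<close>

lemma tendsto_if_sandwiched:
  fixes f :: "real \<Rightarrow> real"
  assumes "\<And>e. 0 < e \<Longrightarrow> \<exists>lo up. up - lo \<le> e \<and> eventually (\<lambda>x. lo \<le> f x \<and> f x \<le> up) at_top"
  shows "\<exists>l. (f \<longlongrightarrow> l) at_top"
proof -
  define S where "S = {lo. eventually (\<lambda>x. lo \<le> f x) at_top}"
  have le_up: "lo \<le> up" if "lo \<in> S" "eventually (\<lambda>x. f x \<le> up) at_top" for lo up
  proof -
    have "eventually (\<lambda>x. lo \<le> up) (at_top :: real filter)"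
      using that unfolding S_def mem_Collect_eq by eventually_elim auto
    then show ?thesis by simp
  qed
  obtain lo1 up1 where 1: "eventually (\<lambda>x. lo1 \<le> f x \<and> f x \<le> up1) at_top"
    using assms[of 1] by auto
  have S: "lo1 \<in> S" "bdd_above S"
  proof -
    show "lo1 \<in> S" using 1 by (auto simp: S_def elim: eventually_mono)
    have "eventually (\<lambda>x. f x \<le> up1) at_top" using 1 by (auto elim: eventually_mono)
    then show "bdd_above S" using le_up by (intro bdd_aboveI) auto
  qed
  have "(f \<longlongrightarrow> Sup S) at_top"
  proof (rule tendstoI)
    fix e :: real assume e: "0 < e"
    obtain lo up where lu: "up - lo \<le> e / 2" and ev: "eventually (\<lambda>x. lo \<le> f x \<and> f x \<le> up) at_top"
      using assms[of "e / 2"] e by auto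
    have "lo \<in> S" using ev by (auto simp: S_def elim: eventually_mono)
    then have "lo \<le> Sup S" using S by (intro cSup_upper)
    moreover have "eventually (\<lambda>x. f x \<le> up) at_top" using ev by (auto elim: eventually_mono)
    then have "Sup S \<le> up" using S le_up by (intro cSup_least) auto
    ultimately show "eventually (\<lambda>x. dist (f x) (Sup S) < e) at_top"
      using ev lu e by (auto simp: dist_real_def elim!: eventually_mono)
  qed
  then show ?thesis by blast
qed

lemma floor_ratio_tendsto: "((\<lambda>x::real. real (nat \<lfloor>x\<rfloor>) / x) \<longlongrightarrow> 1) at_top"
proof (rule tendsto_sandwich)
  show "eventually (\<lambda>x::real. 1 - 1 / x \<le> real (nat \<lfloor>x\<rfloor>) / x) at_top"
    using eventually_gt_at_top[of 1]
  proof eventually_elim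
    case (elim x)
    have "x - 1 \<le> real (nat \<lfloor>x\<rfloor>)" using elim by linarith
    then have "(x - 1) / x \<le> real (nat \<lfloor>x\<rfloor>) / x" using elim by (intro divide_right_mono) auto
    then show ?case using elim by (simp add: diff_divide_distrib)
  qed
  show "eventually (\<lambda>x::real. real (nat \<lfloor>x\<rfloor>) / x \<le> 1) at_top"
    using eventually_gt_at_top[of 1] by eventually_elim simp
  show "((\<lambda>x::real. 1 - 1 / x) \<longlongrightarrow> 1) at_top" by real_asymp
qed auto

text \<open>
  Buchstab's identity expresses the density at the exponent \<open>s\<close> through densities at exponents
  \<open>\<ge> s / (1 - s)\<close>. As these are monotone in the exponent, the upper and lower sums over a
  geometric partition differ by at most about \<open>ln r\<close>.
\<close>

lemma smooth_density_converges_step: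
  assumes s0: "0 < s0" and conv: "\<And>s. s0 \<le> s \<Longrightarrow> \<exists>l. (smooth_density s \<longlongrightarrow> l) at_top"
    and s: "s0 / (1 + s0) \<le> s" "s < 1"
  shows "\<exists>l. (smooth_density s \<longlongrightarrow> l) at_top"
proof (rule tendsto_if_sandwiched)
  fix e' :: real assume e': "0 < e'"
  \<comment> \<open>The final gap is at most \<open>6 * e\<close>: three from the Riemann sums, two
    from the primes beyond \<open>x powr t\<close>, one from the floor of \<open>x\<close>.\<close>
  define e where "e = e' / 8"
  have e: "0 < e" using e' by (simp add: e_def)
  have spos: "0 < s" using s s0 by (smt (verit) divide_pos_pos)
  \<comment> \<open>The Riemann sums must stop before exponent 1, where \<open>x / p\<close> no
    longer tends to infinity. The second entry makes the remaining primes contribute at most about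
    \<open>e\<close>, the first keeps \<open>t\<close> above \<open>s\<close>.\<close>
  define t where "t = max ((1 + s) / 2) (exp (- e))"
  have t: "s < t" "t < 1" "ln (1 / t) \<le> e"
  proof -
    show "s < t" "t < 1" using s e by (auto simp: t_def max_def)
    have "exp (- e) \<le> t" by (simp add: t_def)
    then have "ln (exp (- e)) \<le> ln t" using \<open>s < t\<close> spos by (intro ln_mono) auto
    then show "ln (1 / t) \<le> e" using \<open>s < t\<close> spos by (simp add: ln_div)
  qed
  obtain m :: nat where m: "ln (t / s) / e \<le> real m" "0 < m"
    using real_arch_simple[of "max 1 (ln (t / s) / e)"] by fastforce
  define r where "r = (t / s) powr (1 / real m)"
  have ts: "1 < t / s" using t spos by simp
  have r: "1 < r" "s * r ^ m = t" "ln r \<le> e"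
  proof -
    show "1 < r" using ts m powr_less_mono[of 0 "1 / real m" "t / s"] by (simp add: r_def)
    have "r ^ m = (t / s) powr (real m * (1 / real m))"
      unfolding r_def using ts by (subst powr_realpow[symmetric]) (auto simp: powr_powr)
    then show "s * r ^ m = t" using ts m spos by simp
    have "ln r = ln (t / s) / real m" using ts spos t by (simp add: r_def ln_powr)
    moreover have "ln (t / s) \<le> e * real m" using m e by (simp add: field_simps)
    ultimately show "ln r \<le> e" using m by (simp add: pos_divide_le_eq)
  qed
  define \<sigma> where "\<sigma> j = s * r ^ j / (1 - s * r ^ j)" for j
  \<comment> \<open>The hypothesis on \<open>s\<close> amounts to \<open>s / (1 - s) >= s0\<close>,
    and larger exponents only increase this quotient. So convergence is known at every
    \<open>\<sigma> j\<close>.\<close>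
  have \<sigma>: "s0 \<le> \<sigma> j" if "j \<le> m" for j
  proof -
    have "r ^ j \<le> r ^ m" using r that by (intro power_increasing) auto
    then have v: "s * r ^ j \<le> t" using spos r by (metis mult_left_mono order_less_imp_le)
    have "1 \<le> r ^ j" using r by simp
    then have sv: "s \<le> s * r ^ j" using spos by simp
    have "s0 \<le> s * (1 + s0)" using s s0 by (simp add: field_simps)
    also have "\<dots> \<le> s * r ^ j * (1 + s0)" using sv s0 by (intro mult_right_mono) auto
    finally have "s0 * (1 - s * r ^ j) \<le> s * r ^ j" by (simp add: algebra_simps)
    then show ?thesis unfolding \<sigma>_def using v t by (simp add: field_simps)
  qed
  have "\<exists>l. (smooth_density (\<sigma> j) \<longlongrightarrow> l) at_top" if "j \<le> m" for j using conv \<sigma> that by blast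
  then obtain g where g: "\<And>j. j \<le> m \<Longrightarrow> (smooth_density (\<sigma> j) \<longlongrightarrow> g j) at_top" by metis
  have g01: "0 \<le> g j" "g j \<le> 1" if "j \<le> m" for j
  proof -
    have "eventually (\<lambda>x. 0 \<le> smooth_density (\<sigma> j) x) at_top"
      "eventually (\<lambda>x. smooth_density (\<sigma> j) x \<le> 1) at_top"
      using eventually_gt_at_top[of "0::real"] by (eventually_elim, simp add: smooth_density_bounds)+
    then show "0 \<le> g j" "g j \<le> 1"
      by (auto intro: tendsto_lowerbound[OF g[OF that]] tendsto_upperbound[OF g[OF that]])
  qed
  define a where "a = ln r * (\<Sum>j<m. g j) - e"
  define b where "b = ln r * (\<Sum>j<m. g (Suc j)) + e"
  have slice: "eventually (\<lambda>x. a \<le> prime_slice s t x \<and> prime_slice s t x \<le> b) at_top"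
    unfolding a_def b_def r(2)[symmetric]
    by (rule prime_slice_geometric_asymp) (use spos r t e g in \<open>auto simp: \<sigma>_def\<close>)
  \<comment> \<open>The upper and lower Riemann sums telescope: they differ by
    \<open>ln r * (g m - g 0)\<close>, and densities lie in the unit interval.\<close>
  have ba: "b - a \<le> 3 * e"
  proof -
    have "(\<Sum>j<m. g (Suc j)) - (\<Sum>j<m. g j) = g m - g 0"
      by (simp add: sum_lessThan_telescope flip: sum_subtractf)
    then have "b - a = ln r * (g m - g 0) + 2 * e" unfolding a_def b_def by (simp flip: right_diff_distrib)
    moreover have "ln r * (g m - g 0) \<le> ln r * 1" using g01[of m] g01[of 0] r by (intro mult_left_mono) auto
    ultimately show ?thesis using r by linarith
  qed
  have "((\<lambda>x. prime_recip_sum (x powr t) (x powr 1)) \<longlongrightarrow> ln (1 / t)) at_top"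
    using t spos by (intro prime_recip_sum_tendsto) auto
  then have tail: "eventually (\<lambda>x. prime_recip_sum (x powr t) (x powr 1) < 2 * e) at_top"
    using t e by (intro order_tendstoD) auto
  have fl: "eventually (\<lambda>x::real. 1 - e < real (nat \<lfloor>x\<rfloor>) / x) at_top"
    using floor_ratio_tendsto e by (intro order_tendstoD) auto
  have "eventually (\<lambda>x. 1 - e - b - 2 * e \<le> smooth_density s x \<and> smooth_density s x \<le> 1 - a) at_top"
    using slice tail fl eventually_gt_at_top[of 1]
  proof eventually_elim
    case (elim x)
    have "smooth_density s x = real (nat \<lfloor>x\<rfloor>) / x - prime_slice s t x - prime_slice t 1 x"
      using smooth_density_eq[OF elim(4), of s] prime_slice_add[OF elim(4), of s t 1] t by simp
    moreover have "real (nat \<lfloor>x\<rfloor>) / x \<le> 1" using elim by simp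
    ultimately show ?case
      using elim prime_slice_bounds[OF elim(4), of t 1] by linarith
  qed
  moreover have "(1 - a) - (1 - e - b - 2 * e) \<le> e'" using ba e' by (simp add: e_def)
  ultimately show "\<exists>lo up. up - lo \<le> e' \<and> eventually (\<lambda>x. lo \<le> smooth_density s x \<and> smooth_density s x \<le> up) at_top"
    by blast
qed

lemma smooth_density_tendsto_1:
  assumes "1 \<le> s"
  shows "(smooth_density s \<longlongrightarrow> 1) at_top"
proof (rule Lim_transform_eventually[OF floor_ratio_tendsto])
  show "eventually (\<lambda>x. real (nat \<lfloor>x\<rfloor>) / x = smooth_density s x) at_top"
    using eventually_gt_at_top[of 1]
  proof eventually_elim
    case (elim x)
    have "x powr 1 \<le> x powr s" using elim assms by (intro powr_mono) auto
    then show ?case using elim by (simp add: smooth_density_def smooth_count_self)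
  qed
qed

text \<open>With \<open>s0 = 1 / n\<close> the threshold \<open>s0 / (1 + s0)\<close> is
  \<open>1 / (n + 1)\<close>, so each step extends the range of exponents and every positive
  \<open>s\<close> is reached. The start \<open>s \<ge> 1\<close> is trivial.\<close>

lemma smooth_density_converges:
  assumes "0 < s"
  shows "\<exists>l. (smooth_density s \<longlongrightarrow> l) at_top"
proof -
  have *: "\<exists>l. (smooth_density s \<longlongrightarrow> l) at_top" if "1 / real (Suc N) \<le> s" for N s
    using that
  proof (induction N arbitrary: s)
    case 0
    then show ?case using smooth_density_tendsto_1 by auto
  next
    case (Suc N)
    show ?case
    proof (cases "s < 1")
      case True
      have "1 / real (Suc N) / (1 + 1 / real (Suc N)) = 1 / real (Suc (Suc N))"
        by (simp add: field_simps)
      then have "1 / real (Suc N) / (1 + 1 / real (Suc N)) \<le> s" using Suc.prems by (simp only:)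
      from smooth_density_converges_step[OF _ Suc.IH this True] show ?thesis by simp
    next
      case False
      then show ?thesis using smooth_density_tendsto_1[of s] by auto
    qed
  qed
  obtain N where "inverse (real (Suc N)) < s" using reals_Archimedean[OF assms] by blast
  then show ?thesis using *[of N s] by (simp add: inverse_eq_divide)
qed

text \<open>\<open>Lim\<close> says nothing without existence of the limit, which is why convergence
  had to come first.\<close>

lemma smooth_density_tendsto_dickman:
  assumes "0 < s"
  shows "(smooth_density s \<longlongrightarrow> dickman (1 / s)) at_top"
proof -
  obtain l where l: "(smooth_density s \<longlongrightarrow> l) at_top" using smooth_density_converges[OF assms] by blast
  have "dickman (1 / s) = Lim at_top (smooth_density s)"
    using assms by (simp add: dickman_def smooth_density_def[abs_def])
  also have "\<dots> = l" using l by (intro tendsto_Lim) auto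
  finally show ?thesis using l by simp
qed

section \<open>Smooth sums\<close>

lemma card_rough_upto_le:
  assumes "0 \<le> R"
  shows "real (card (rough_upto z R)) \<le> R"
proof -
  have "rough_upto z R \<subseteq> {n. 0 < n \<and> real n \<le> R}" by (auto simp: rough_upto_def)
  then have "card (rough_upto z R) \<le> nat \<lfloor>R\<rfloor>"
    using card_mono[OF finite_nat_le_real[of R "\<lambda>_. True"], of "rough_upto z R"] card_nat_le_real[OF assms] by simp
  then show ?thesis using assms by (metis of_nat_floor of_nat_mono order_trans)
qed

text \<open>All constants are fixed here, from \<open>\<theta>\<close> and \<open>\<gamma>\<close>
  alone. Everything that varies with the sets sits inside the \<open>eventually\<close>, so the
  bound on \<open>x\<close> is independent of \<open>A\<close> and \<open>B\<close>.\<close>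

lemma sieve_transfer_eventually:
  fixes \<theta> \<gamma> :: real
  assumes \<theta>: "0 < \<theta>" "\<theta> \<le> 1" and \<gamma>: "0 < \<gamma>"
  obtains \<delta> \<eta> where "0 < \<delta>" "\<delta> \<le> 1 / 8" "0 < \<eta>"
    "eventually (\<lambda>x::real. \<forall>(S :: (int \<times> int) set) f X. finite S \<longrightarrow> 0 \<le> X
        \<longrightarrow> (\<forall>s\<in>S. 0 < f s \<and> real (f s) \<le> 2 * x)
        \<longrightarrow> (\<Sum>d\<in>rough_upto (x powr (2 * \<delta>)) (x powr (1 - \<delta>)).
              \<bar>real (card {s\<in>S. d dvd f s}) - X / real d\<bar>) \<le> \<eta> * X
        \<longrightarrow> \<bar>real (card {s\<in>S. \<forall>p. prime p \<longrightarrow> p dvd f s \<longrightarrow> real p \<le> x powr \<theta>})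
              - X * sieve_main (x powr \<theta>) (x powr (1 - \<delta>))\<bar> \<le> \<gamma> * X) at_top"
proof -
  \<comment> \<open>The primes of the second moment go up to \<open>x powr \<phi>\<close>. The cap
    \<open>1 / 4\<close> keeps their pairwise products below
    \<open>x powr (1 - \<delta>)\<close>.\<close>
  define \<phi> where "\<phi> = min \<theta> (1 / 4)"
  have \<phi>: "0 < \<phi>" "\<phi> \<le> \<theta>" "\<phi> \<le> 1 / 4" using \<theta> by (auto simp: \<phi>_def)
  define K where "K = nat \<lceil>1 / \<theta>\<rceil>"
  have "1 / \<theta> \<le> real K" unfolding K_def by linarith
  then have "1 \<le> \<theta> * real K" using \<theta> by (simp add: field_simps)
  then have K: "1 < \<theta> * real (K + 1)" using \<theta> by (simp add: algebra_simps)
  define C where "C = (1 + 2 ^ K :: real)"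
  have C: "1 \<le> C" by (simp add: C_def)
  \<comment> \<open>A lower bound for the reciprocal sum \<open>L\<close> that makes the elements
    missed by the truncation, about \<open>X / L\<close> with weight \<open>C\<close>, cost at most
    half of \<open>\<gamma> * X\<close>.\<close>
  define l where "l = max 1 (2 * C / \<gamma>)"
  have l: "1 \<le> l" "C / l \<le> \<gamma> / 2"
  proof -
    show "1 \<le> l" by (simp add: l_def)
    have "2 * C / \<gamma> \<le> l" by (simp add: l_def)
    then show "C / l \<le> \<gamma> / 2" using \<gamma> \<open>1 \<le> l\<close> by (simp add: field_simps)
  qed
  \<comment> \<open>Chosen so that the sum of \<open>1 / p\<close> between
    \<open>x powr (2 * \<delta>)\<close> and \<open>x powr \<phi>\<close> tends to
    \<open>l + 1\<close>, and hence eventually exceeds \<open>l\<close>.\<close>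
  define \<delta> where "\<delta> = \<phi> / 2 * exp (- (l + 1))"
  have "exp (- (l + 1)) < 1" using l by simp
  then have \<delta>: "0 < \<delta>" "2 * \<delta> < \<phi>" using \<phi> by (auto simp: \<delta>_def)
  have ln\<delta>: "ln (\<phi> / (2 * \<delta>)) = l + 1"
    using \<phi> by (simp add: \<delta>_def ln_div ln_mult)
  \<comment> \<open>The other half of \<open>\<gamma>\<close>; the 6 bounds
    \<open>1 + 2 / L + 3 / L^2\<close> for \<open>L >= 1\<close>.\<close>
  define \<eta> where "\<eta> = \<gamma> / (2 * (6 * C + 1))"
  have \<eta>: "0 < \<eta>" "C * (6 * \<eta>) + \<eta> = \<gamma> / 2" 
  proof -
    show "0 < \<eta>" using \<gamma> C by (simp add: \<eta>_def)
    have "C * (6 * \<eta>) + \<eta> = (6 * C + 1) * \<eta>" by (simp add: algebra_simps)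
    also have "(6 * C + 1) * \<eta> = \<gamma> / 2"
    proof -
      have k: "k * (\<gamma> / (2 * k)) = \<gamma> / 2" if "0 < k" for k using that by simp
      show ?thesis unfolding \<eta>_def by (rule k) (use C in linarith)
    qed
    finally show "C * (6 * \<eta>) + \<eta> = \<gamma> / 2" .
  qed
  have "eventually (\<lambda>x. l < prime_recip_sum (x powr (2 * \<delta>)) (x powr \<phi>)) at_top"
    using prime_recip_sum_tendsto[of "2 * \<delta>" \<phi>] \<delta> ln\<delta> by (intro order_tendstoD[of _ "l + 1"]) auto
  moreover have "eventually (\<lambda>x::real. 2 * x < x powr (\<theta> * real (K + 1))) at_top"
    using K by real_asymp
  \<comment> \<open>The cofactor bound is \<open>2 * x powr \<delta>\<close>; the roughness exponent
    \<open>2 * \<delta>\<close> leaves room for the factor 2.\<close>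
  moreover have "eventually (\<lambda>x::real. 2 * x / x powr (1 - \<delta>) \<le> x powr (2 * \<delta>)) at_top"
    using \<delta> by real_asymp
  ultimately have "eventually (\<lambda>x::real. \<forall>(S :: (int \<times> int) set) f X. finite S \<longrightarrow> 0 \<le> X
        \<longrightarrow> (\<forall>s\<in>S. 0 < f s \<and> real (f s) \<le> 2 * x)
        \<longrightarrow> (\<Sum>d\<in>rough_upto (x powr (2 * \<delta>)) (x powr (1 - \<delta>)).
              \<bar>real (card {s\<in>S. d dvd f s}) - X / real d\<bar>) \<le> \<eta> * X
        \<longrightarrow> \<bar>real (card {s\<in>S. \<forall>p. prime p \<longrightarrow> p dvd f s \<longrightarrow> real p \<le> x powr \<theta>})
              - X * sieve_main (x powr \<theta>) (x powr (1 - \<delta>))\<bar> \<le> \<gamma> * X) at_top"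
    using eventually_gt_at_top[of "1::real"]
  proof eventually_elim
    case (elim x)
    define L where "L = prime_recip_sum (x powr (2 * \<delta>)) (x powr \<phi>)"
    have L: "l < L" "0 < L" "1 \<le> L" using elim(1) l by (auto simp: L_def)
    show ?case
    proof (intro allI impI)
      fix S :: "(int \<times> int) set" and f X
      assume S: "finite S" and X: "0 \<le> X" and f: "\<forall>s\<in>S. 0 < f s \<and> real (f s) \<le> 2 * x"
        and dev: "(\<Sum>d\<in>rough_upto (x powr (2 * \<delta>)) (x powr (1 - \<delta>)).
              \<bar>real (card {s\<in>S. d dvd f s}) - X / real d\<bar>) \<le> \<eta> * X"
      have "\<bar>real (card {s\<in>S. \<forall>p. prime p \<longrightarrow> p dvd f s \<longrightarrow> real p \<le> x powr \<theta>})
              - X * sieve_main (x powr \<theta>) (x powr (1 - \<delta>))\<bar>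
           \<le> (1 + 2 ^ K) * (X / L + (1 + 2 / L + 3 / L\<^sup>2) * (\<eta> * X)) + \<eta> * X"
      proof (rule sieve_transfer[OF S X _ _ _ _ _ _ _ _ _ dev])
        show "0 < f s \<and> real (f s) \<le> 2 * x" if "s \<in> S" for s using f that by blast
        show "1 \<le> x powr \<theta>" "1 \<le> x powr (1 - \<delta>)"
          using elim(4) \<theta> \<phi> \<delta> by (auto intro!: ge_one_powr_ge_zero)
        show "0 < x powr (2 * \<delta>)" using elim(4) by simp
        show "x powr (2 * \<delta>) \<le> x powr \<phi>" "x powr \<phi> \<le> x powr \<theta>"
          using elim(4) \<phi> \<delta> by (auto intro!: powr_mono)
        have "(x powr \<phi>)\<^sup>2 = x powr (2 * \<phi>)"
          using elim(4) by (simp add: power2_eq_square flip: powr_add)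
        also have "\<dots> \<le> x powr (1 - \<delta>)" using elim(4) \<phi> \<delta> by (intro powr_mono) auto
        finally show "(x powr \<phi>)\<^sup>2 \<le> x powr (1 - \<delta>)" .
        show "2 * x / x powr (1 - \<delta>) \<le> x powr (2 * \<delta>)" by (rule elim(3))
        have "(x powr \<theta>) ^ (K + 1) = x powr (\<theta> * real (K + 1))"
          using elim(4) by (subst powr_realpow[symmetric]) (simp_all add: powr_powr)
        then show "2 * x < (x powr \<theta>) ^ (K + 1)" using elim(2) by simp
      qed (use L in \<open>auto simp: L_def prime_recip_sum_def\<close>)
      also have "\<dots> \<le> C * (X / l + 6 * (\<eta> * X)) + \<eta> * X"
        unfolding C_def[symmetric]
      proof (intro add_right_mono mult_left_mono add_mono mult_right_mono)
        show "X / L \<le> X / l" using L l X by (intro divide_left_mono) auto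
        have "1 \<le> L\<^sup>2" using L(3) by simp
        then have "2 / L \<le> 2" "3 / L\<^sup>2 \<le> 3" using L by (auto simp: divide_le_eq)
        then show "1 + 2 / L + 3 / L\<^sup>2 \<le> 6" by linarith
      qed (use C X \<eta> in auto)
      also have "\<dots> = (C / l + (C * (6 * \<eta>) + \<eta>)) * X" by (simp add: algebra_simps)
      also have "\<dots> \<le> (\<gamma> / 2 + \<gamma> / 2) * X"
        using l(2) \<eta>(2) X by (intro mult_right_mono add_mono) auto
      finally show "\<bar>real (card {s\<in>S. \<forall>p. prime p \<longrightarrow> p dvd f s \<longrightarrow> real p \<le> x powr \<theta>})
              - X * sieve_main (x powr \<theta>) (x powr (1 - \<delta>))\<bar> \<le> \<gamma> * X" by simp
    qed
  qed
  moreover have "\<delta> \<le> 1 / 8" using \<delta> \<phi> by linarith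
  ultimately show ?thesis using that \<delta> \<eta> by blast
qed

lemma card_multiples_deviation:
  fixes d n :: nat
  assumes d: "0 < d"
  shows "\<bar>real (card {k \<in> {1..n}. d dvd k}) - real n / real d\<bar> \<le> 1"
  unfolding card_multiples[OF d]
  using of_nat_div_le_of_nat[of n d, where ?'a = real] divide_le_real_div_plus_1[OF d, of n] by linarith

text \<open>Pairs with \<open>a + b = 0\<close> are removed, since the sieve needs positive
  integers. Each \<open>a\<close> has at most one partner, so this costs at most
  \<open>card A\<close> per modulus and gives the last term.\<close>

lemma pair_deviation_le:
  fixes A B :: "int set" and n :: nat
  assumes A: "A \<subseteq> {- int n..int n}" and B: "B \<subseteq> {- int n..int n}"
    and \<delta>: "0 < \<delta>" "\<delta> \<le> 1 / 8" and n: "1 < n"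
    and mR: "\<lceil>real n powr (2 * \<delta>)\<rceil> \<le> \<lfloor>real n powr (1 - \<delta>)\<rfloor>"
  shows "(\<Sum>d\<in>rough_upto (real n powr (2 * \<delta>)) (real n powr (1 - \<delta>)).
      \<bar>real (card {s \<in> {(a, b). a \<in> A \<and> b \<in> B \<and> a + b \<noteq> 0}. d dvd nat \<bar>fst s + snd s\<bar>})
        - real (card A) * real (card B) / real d\<bar>)
    \<le> (1 + ln (real n)) * (3 + 8 * (1 + 2 * ln (real n))) * real n powr (1 - \<delta>)
        * (real (card A) + real (card B)) + real n powr (1 - \<delta>) * real (card A)"
proof -
  define x where "x = real n"
  have x: "1 < x" using n by (simp add: x_def)
  define D where "D = rough_upto (x powr (2 * \<delta>)) (x powr (1 - \<delta>))"
  define m where "m = nat \<lceil>x powr (2 * \<delta>)\<rceil>"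
  define R where "R = nat \<lfloor>x powr (1 - \<delta>)\<rfloor>"
  define Z where "Z = {(a, b). a \<in> A \<and> b \<in> B \<and> a + b = 0}"
  have fin: "finite A" "finite B" using A B finite_subset by auto
  have finAB: "finite {(a, b). a \<in> A \<and> b \<in> B \<and> P a b}" for P
    by (rule finite_subset[of _ "A \<times> B"]) (use fin in auto)
  have p1: "1 \<le> x powr (2 * \<delta>)" "1 \<le> x powr (1 - \<delta>)" using x \<delta> by (auto intro!: ge_one_powr_ge_zero)
  have m: "1 \<le> m" "x powr (2 * \<delta>) \<le> real m" "m \<le> R"
  proof -
    show "x powr (2 * \<delta>) \<le> real m" unfolding m_def by linarith
    then show "1 \<le> m" using p1 by linarith
    show "m \<le> R" unfolding m_def R_def using mR by (intro nat_mono) (simp add: x_def)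
  qed
  have R: "real R \<le> x powr (1 - \<delta>)" using p1 by (simp add: R_def)
  also have "\<dots> \<le> x powr 1" using x \<delta> by (intro powr_mono) auto
  finally have Rx: "real R \<le> x" using x by simp
  have lnR: "0 \<le> ln (real R)" "ln (real R) \<le> ln x" using m Rx x by auto
  have cardZ: "card Z \<le> card A"
  proof -
    have "Z \<subseteq> (\<lambda>a. (a, - a)) ` A" by (auto simp: Z_def)
    then have "card Z \<le> card ((\<lambda>a. (a, - a)) ` A)" using fin by (intro card_mono) auto
    also have "\<dots> \<le> card A" using fin by (intro card_image_le)
    finally show ?thesis .
  qed
  have cnt: "real (card {s \<in> {(a, b). a \<in> A \<and> b \<in> B \<and> a + b \<noteq> 0}. d dvd nat \<bar>fst s + snd s\<bar>})
      = real (card {(a, b). a \<in> A \<and> b \<in> B \<and> int d dvd a + b}) - real (card Z)" for d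
  proof -
    have dv: "d dvd nat \<bar>k\<bar> \<longleftrightarrow> int d dvd k" for k :: int
      by (simp add: int_dvd_int_iff[symmetric])
    have "{(a, b). a \<in> A \<and> b \<in> B \<and> int d dvd a + b}
        = {s \<in> {(a, b). a \<in> A \<and> b \<in> B \<and> a + b \<noteq> 0}. d dvd nat \<bar>fst s + snd s\<bar>} \<union> Z"
      by (auto simp: dv Z_def)
    moreover have "{s \<in> {(a, b). a \<in> A \<and> b \<in> B \<and> a + b \<noteq> 0}. d dvd nat \<bar>fst s + snd s\<bar>} \<inter> Z = {}"
      by (auto simp: Z_def)
    ultimately have "card {(a, b). a \<in> A \<and> b \<in> B \<and> int d dvd a + b}
        = card {s \<in> {(a, b). a \<in> A \<and> b \<in> B \<and> a + b \<noteq> 0}. d dvd nat \<bar>fst s + snd s\<bar>} + card Z"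
      using finAB unfolding Z_def by (simp only:) (intro card_Un_disjoint, auto)
    then show ?thesis by simp
  qed
  have "(\<Sum>d\<in>D. \<bar>real (card {s \<in> {(a, b). a \<in> A \<and> b \<in> B \<and> a + b \<noteq> 0}. d dvd nat \<bar>fst s + snd s\<bar>})
        - real (card A) * real (card B) / real d\<bar>)
    \<le> (\<Sum>d\<in>D. \<bar>real (card {(a, b). a \<in> A \<and> b \<in> B \<and> int d dvd a + b})
        - real (card A) * real (card B) / real d\<bar> + real (card A))"
    unfolding cnt using cardZ by (intro sum_mono) linarith
  also have "\<dots> = (\<Sum>d\<in>D. \<bar>real (card {(a, b). a \<in> A \<and> b \<in> B \<and> int d dvd a + b})
        - real (card A) * real (card B) / real d\<bar>) + real (card D) * real (card A)"
    by (simp add: sum.distrib)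
  also have "\<dots> \<le> (1 + ln (real R)) * ((2 * real n + 1) / real m + 8 * (1 + 2 * ln (real R)) * real R)
        * (real (card A) + real (card B)) + x powr (1 - \<delta>) * real (card A)"
  proof (intro add_mono mult_right_mono sum_card_dvd_deviation_le A B m)
    show "D \<subseteq> {1..R}"
      unfolding D_def R_def rough_upto_def by (auto simp: le_nat_floor Suc_le_eq)
    show "real (card D) \<le> x powr (1 - \<delta>)" unfolding D_def using p1 by (intro card_rough_upto_le) auto
    fix d p :: nat assume "d \<in> D" "prime p" "p dvd d"
    then have "x powr (2 * \<delta>) < real p" by (auto simp: D_def rough_upto_def)
    then show "m \<le> p" unfolding m_def by linarith
  qed auto
  also have "\<dots> \<le> (1 + ln x) * ((3 + 8 * (1 + 2 * ln x)) * x powr (1 - \<delta>))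
        * (real (card A) + real (card B)) + x powr (1 - \<delta>) * real (card A)"
  proof (intro add_right_mono mult_right_mono mult_mono)
    \<comment> \<open>Here roughness pays: \<open>m\<close> is at least
      \<open>x powr (2 * \<delta>)\<close>, and \<open>2 * n + 1 <= 3 * n\<close>.\<close>
    have "(2 * real n + 1) / real m \<le> (3 * x) / x powr (2 * \<delta>)"
      using m x p1 by (intro frac_le) (auto simp: x_def)
    also have "\<dots> = 3 * x powr (1 - 2 * \<delta>)" using x by (simp add: powr_diff)
    also have "\<dots> \<le> 3 * x powr (1 - \<delta>)" using x \<delta> by (intro mult_left_mono powr_mono) auto
    finally have "(2 * real n + 1) / real m \<le> 3 * x powr (1 - \<delta>)" .
    moreover have "8 * (1 + 2 * ln (real R)) * real R \<le> 8 * (1 + 2 * ln x) * x powr (1 - \<delta>)"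
      using lnR R by (intro mult_mono) auto
    ultimately show "(2 * real n + 1) / real m + 8 * (1 + 2 * ln (real R)) * real R
        \<le> (3 + 8 * (1 + 2 * ln x)) * x powr (1 - \<delta>)" by (simp add: distrib_right)
  qed (use lnR in auto)
  finally show ?thesis unfolding D_def x_def by (simp only: mult.assoc)
qed

text \<open>The symmetric interval is chosen so that \<open>B\<close> may be replaced by
  \<open>-B\<close>, which turns sums into differences.\<close>

lemma smooth_sums_count:
  fixes \<theta> \<gamma> :: real
  assumes \<theta>: "0 < \<theta>" "\<theta> \<le> 1" and \<gamma>: "0 < \<gamma>"
  obtains \<nu> :: real where "0 < \<nu>" "\<nu> < 1"
    "\<forall>\<^sub>F x::nat in at_top. \<forall>A B :: int set.
       A \<subseteq> {- int x..int x} \<longrightarrow> B \<subseteq> {- int x..int x} \<longrightarrow>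
       real (card A) > real x powr \<nu> \<longrightarrow> real (card B) > real x powr \<nu> \<longrightarrow>
       \<bar>real (card {(a, b). a \<in> A \<and> b \<in> B \<and> smooth (real x powr \<theta>) (a + b)})
          - dickman (1 / \<theta>) * real (card A) * real (card B)\<bar>
         < \<gamma> * real (card A) * real (card B)"
proof -
  \<comment> \<open>One quarter each for the pairs, for the integers up to \<open>x\<close>, and for
    the convergence to \<open>dickman\<close>; the last quarter makes the inequality strict.\<close>
  define \<gamma>' where "\<gamma>' = \<gamma> / 4"
  have \<gamma>': "0 < \<gamma>'" using \<gamma> by (simp add: \<gamma>'_def)
  obtain \<delta> \<eta> where \<delta>: "0 < \<delta>" "\<delta> \<le> 1 / 8" and \<eta>: "0 < \<eta>"
    and ev: "eventually (\<lambda>x::real. \<forall>(S :: (int \<times> int) set) f X. finite S \<longrightarrow> 0 \<le> X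
        \<longrightarrow> (\<forall>s\<in>S. 0 < f s \<and> real (f s) \<le> 2 * x)
        \<longrightarrow> (\<Sum>d\<in>rough_upto (x powr (2 * \<delta>)) (x powr (1 - \<delta>)).
              \<bar>real (card {s\<in>S. d dvd f s}) - X / real d\<bar>) \<le> \<eta> * X
        \<longrightarrow> \<bar>real (card {s\<in>S. \<forall>p. prime p \<longrightarrow> p dvd f s \<longrightarrow> real p \<le> x powr \<theta>})
              - X * sieve_main (x powr \<theta>) (x powr (1 - \<delta>))\<bar> \<le> \<gamma>' * X) at_top"
    using sieve_transfer_eventually[OF \<theta> \<gamma>'] by blast
  \<comment> \<open>The deviation is \<open>x powr (1 - \<delta>)\<close> up to logarithms, times
    \<open>|A| + |B|\<close>. Any exponent strictly between \<open>1 - \<delta>\<close> and 1 makes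
    it negligible against \<open>|A| * |B|\<close>.\<close>
  define \<nu> where "\<nu> = 1 - \<delta> / 2"
  have \<nu>: "0 < \<nu>" "\<nu> < 1" using \<delta> by (auto simp: \<nu>_def)
  note nat_ev = eventually_compose_filterlim[OF _ filterlim_real_sequentially]
  have 1: "eventually (\<lambda>n::nat. \<forall>(S :: (int \<times> int) set) f X. finite S \<longrightarrow> 0 \<le> X
        \<longrightarrow> (\<forall>s\<in>S. 0 < f s \<and> real (f s) \<le> 2 * real n)
        \<longrightarrow> (\<Sum>d\<in>rough_upto (real n powr (2 * \<delta>)) (real n powr (1 - \<delta>)).
              \<bar>real (card {s\<in>S. d dvd f s}) - X / real d\<bar>) \<le> \<eta> * X
        \<longrightarrow> \<bar>real (card {s\<in>S. \<forall>p. prime p \<longrightarrow> p dvd f s \<longrightarrow> real p \<le> real n powr \<theta>})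
              - X * sieve_main (real n powr \<theta>) (real n powr (1 - \<delta>))\<bar> \<le> \<gamma>' * X) at_top"
    by (rule nat_ev[OF ev])
  have "eventually (\<lambda>x::real. \<bar>smooth_density \<theta> x - dickman (1 / \<theta>)\<bar> < \<gamma>') at_top"
    using tendstoD[OF smooth_density_tendsto_dickman[OF \<theta>(1)] \<gamma>'] by (simp add: dist_real_def)
  from nat_ev[OF this]
  have 2: "eventually (\<lambda>n::nat. \<bar>smooth_density \<theta> (real n) - dickman (1 / \<theta>)\<bar> < \<gamma>') at_top" .
  have "eventually (\<lambda>x::real. x powr (1 - \<delta>) \<le> \<eta> * x) at_top"
    using \<delta> \<eta> by real_asymp
  from nat_ev[OF this] have 3: "eventually (\<lambda>n::nat. real n powr (1 - \<delta>) \<le> \<eta> * real n) at_top" .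
  \<comment> \<open>The 2 pays for the rounding up and down in
    \<open>pair_deviation_le\<close>.\<close>
  have "eventually (\<lambda>x::real. x powr (2 * \<delta>) + 2 \<le> x powr (1 - \<delta>)) at_top"
    using \<delta> by real_asymp
  from nat_ev[OF this] have 4: "eventually (\<lambda>n::nat. real n powr (2 * \<delta>) + 2 \<le> real n powr (1 - \<delta>)) at_top" .
  have "eventually (\<lambda>x::real. (2 * ((1 + ln x) * (3 + 8 * (1 + 2 * ln x)) * x powr (1 - \<delta>)) + x powr (1 - \<delta>))
      \<le> \<eta> * x powr (1 - \<delta> / 2)) at_top"
    using \<delta> \<eta> by real_asymp
  from nat_ev[OF this]
  have 5: "eventually (\<lambda>n::nat. (2 * ((1 + ln (real n)) * (3 + 8 * (1 + 2 * ln (real n))) * real n powr (1 - \<delta>))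
      + real n powr (1 - \<delta>)) \<le> \<eta> * real n powr (1 - \<delta> / 2)) at_top" .
  have "\<forall>\<^sub>F x::nat in at_top. \<forall>A B :: int set.
       A \<subseteq> {- int x..int x} \<longrightarrow> B \<subseteq> {- int x..int x} \<longrightarrow>
       real (card A) > real x powr \<nu> \<longrightarrow> real (card B) > real x powr \<nu> \<longrightarrow>
       \<bar>real (card {(a, b). a \<in> A \<and> b \<in> B \<and> smooth (real x powr \<theta>) (a + b)})
          - dickman (1 / \<theta>) * real (card A) * real (card B)\<bar>
         < \<gamma> * real (card A) * real (card B)"
    using 1 2 3 4 5 eventually_gt_at_top[of "1::nat"]
  proof eventually_elim
    case (elim n)
    define x where "x = real n"
    define M where "M = sieve_main (x powr \<theta>) (x powr (1 - \<delta>))"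
    have x: "1 < x" using elim(6) by (simp add: x_def)
    have transfer: "\<bar>real (card {s\<in>S. \<forall>p. prime p \<longrightarrow> p dvd f s \<longrightarrow> real p \<le> x powr \<theta>}) - X * M\<bar> \<le> \<gamma>' * X"
      if "finite S" "0 \<le> X" "\<And>s. s \<in> S \<Longrightarrow> 0 < f s \<and> real (f s) \<le> 2 * x"
        "(\<Sum>d\<in>rough_upto (x powr (2 * \<delta>)) (x powr (1 - \<delta>)). \<bar>real (card {s\<in>S. d dvd f s}) - X / real d\<bar>) \<le> \<eta> * X"
      for S :: "(int \<times> int) set" and f X
      using elim(1) that unfolding x_def M_def by blast
    \<comment> \<open>The same main term \<open>M\<close> governs the integers up to
      \<open>n\<close>, coded as pairs \<open>(k, 0)\<close> to fit the type in
      \<open>transfer\<close>; there each modulus deviates by at most 1. Their smooth density is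
      known, which pins down \<open>M\<close>.\<close>
    have M: "\<bar>M - dickman (1 / \<theta>)\<bar> < 2 * \<gamma>'"
    proof -
      define S where "S = (\<lambda>k. (int k, 0::int)) ` {1..n}"
      define f where "f s = nat (fst s)" for s :: "int \<times> int"
      have cardS: "card {s\<in>S. P (f s)} = card {k\<in>{1..n}. P k}" for P
      proof -
        have "{s\<in>S. P (f s)} = (\<lambda>k. (int k, 0)) ` {k\<in>{1..n}. P k}"
          by (auto simp: S_def f_def)
        then show ?thesis by (simp add: card_image inj_on_def)
      qed
      have "\<bar>real (card {s\<in>S. \<forall>p. prime p \<longrightarrow> p dvd f s \<longrightarrow> real p \<le> x powr \<theta>}) - x * M\<bar> \<le> \<gamma>' * x"
      proof (rule transfer[where S = S and f = f and X = x])
        have "(\<Sum>d\<in>rough_upto (x powr (2 * \<delta>)) (x powr (1 - \<delta>)). \<bar>real (card {s\<in>S. d dvd f s}) - x / real d\<bar>)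
            \<le> (\<Sum>d\<in>rough_upto (x powr (2 * \<delta>)) (x powr (1 - \<delta>)). 1)"
          unfolding x_def cardS[of "\<lambda>k. _ dvd k"]
          by (intro sum_mono card_multiples_deviation) (auto simp: rough_upto_def)
        also have "\<dots> \<le> x powr (1 - \<delta>)" by (simp add: card_rough_upto_le)
        also have "\<dots> \<le> \<eta> * x" using elim(3) by (simp add: x_def)
        finally show "(\<Sum>d\<in>rough_upto (x powr (2 * \<delta>)) (x powr (1 - \<delta>)). \<bar>real (card {s\<in>S. d dvd f s}) - x / real d\<bar>) \<le> \<eta> * x" .
      qed (use x in \<open>auto simp: S_def f_def x_def\<close>)
      also have "card {s\<in>S. \<forall>p. prime p \<longrightarrow> p dvd f s \<longrightarrow> real p \<le> x powr \<theta>} = smooth_count x (x powr \<theta>)"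
        unfolding cardS[of "\<lambda>k. \<forall>p. prime p \<longrightarrow> p dvd k \<longrightarrow> real p \<le> x powr \<theta>"] smooth_count_eq
        by (rule arg_cong[of _ _ card]) (auto simp: x_def)
      also have "real (smooth_count x (x powr \<theta>)) = x * smooth_density \<theta> x"
        using x by (simp add: smooth_density_def)
      also have "x * smooth_density \<theta> x - x * M = x * (smooth_density \<theta> x - M)"
        by (simp add: right_diff_distrib)
      finally have "x * \<bar>smooth_density \<theta> x - M\<bar> \<le> x * \<gamma>'"
        using x by (simp add: abs_mult mult.commute)
      then have "\<bar>smooth_density \<theta> x - M\<bar> \<le> \<gamma>'" using x by simp
      then show ?thesis using elim(2) by (simp add: x_def)
    qed
    show ?case
    proof (intro allI impI)
      fix A B :: "int set"
      assume A: "A \<subseteq> {- int n..int n}" and B: "B \<subseteq> {- int n..int n}"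
        and cA: "real (card A) > real n powr \<nu>" and cB: "real (card B) > real n powr \<nu>"
      define X where "X = real (card A) * real (card B)"
      define S where "S = {(a, b). a \<in> A \<and> b \<in> B \<and> a + b \<noteq> 0}"
      define f where "f s = nat \<bar>fst s + snd s\<bar>" for s :: "int \<times> int"
      have fin: "finite A" "finite B" using A B finite_subset by auto
      have finS: "finite S" unfolding S_def
        by (rule finite_subset[of _ "A \<times> B"]) (use fin in auto)
      have nu0: "0 < real n powr \<nu>" using x by (simp add: x_def)
      have X: "0 < X" using cA cB nu0 unfolding X_def by (intro mult_pos_pos) linarith+
      have dev: "(\<Sum>d\<in>rough_upto (x powr (2 * \<delta>)) (x powr (1 - \<delta>)). \<bar>real (card {s\<in>S. d dvd f s}) - X / real d\<bar>) \<le> \<eta> * X"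
      proof -
        define W where "W = (1 + ln x) * (3 + 8 * (1 + 2 * ln x)) * x powr (1 - \<delta>)"
        have W: "0 \<le> W" using x by (simp add: W_def)
        have "(\<Sum>d\<in>rough_upto (x powr (2 * \<delta>)) (x powr (1 - \<delta>)). \<bar>real (card {s\<in>S. d dvd f s}) - X / real d\<bar>)
            \<le> W * (real (card A) + real (card B)) + x powr (1 - \<delta>) * real (card A)"
          unfolding S_def f_def X_def W_def x_def
          by (rule pair_deviation_le[OF A B \<delta>]) (use elim(4,6) in linarith)+
        \<comment> \<open>Multiplying the deviation by \<open>x powr \<nu>\<close> converts each of
          \<open>|A|\<close> and \<open>|B|\<close> into \<open>X\<close>; the factor is cancelled
          at the end.\<close>
        moreover have "x powr \<nu> * real (card A) \<le> X" "x powr \<nu> * real (card B) \<le> X"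
          using cA cB unfolding X_def x_def
          by (simp_all add: mult.commute[of _ "real (card A)"] mult_left_mono mult_right_mono)
        ultimately have "x powr \<nu> * (\<Sum>d\<in>rough_upto (x powr (2 * \<delta>)) (x powr (1 - \<delta>)). \<bar>real (card {s\<in>S. d dvd f s}) - X / real d\<bar>)
            \<le> W * (X + X) + x powr (1 - \<delta>) * X"
        proof -
          assume a: "(\<Sum>d\<in>rough_upto (x powr (2 * \<delta>)) (x powr (1 - \<delta>)). \<bar>real (card {s\<in>S. d dvd f s}) - X / real d\<bar>)
              \<le> W * (real (card A) + real (card B)) + x powr (1 - \<delta>) * real (card A)"
            and b: "x powr \<nu> * real (card A) \<le> X" "x powr \<nu> * real (card B) \<le> X"
          have "x powr \<nu> * (\<Sum>d\<in>rough_upto (x powr (2 * \<delta>)) (x powr (1 - \<delta>)). \<bar>real (card {s\<in>S. d dvd f s}) - X / real d\<bar>)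
              \<le> x powr \<nu> * (W * (real (card A) + real (card B)) + x powr (1 - \<delta>) * real (card A))"
            using a by (intro mult_left_mono) auto
          also have "\<dots> = W * (x powr \<nu> * real (card A) + x powr \<nu> * real (card B)) + x powr (1 - \<delta>) * (x powr \<nu> * real (card A))"
            by (simp add: algebra_simps)
          also have "\<dots> \<le> W * (X + X) + x powr (1 - \<delta>) * X"
            using b W by (intro add_mono mult_left_mono) auto
          finally show ?thesis .
        qed
        also have "\<dots> = (2 * W + x powr (1 - \<delta>)) * X" by (simp add: algebra_simps)
        also have "\<dots> \<le> (\<eta> * x powr \<nu>) * X"
          using elim(5) X unfolding W_def \<nu>_def x_def by (intro mult_right_mono) auto
        finally have "x powr \<nu> * (\<Sum>d\<in>rough_upto (x powr (2 * \<delta>)) (x powr (1 - \<delta>)). \<bar>real (card {s\<in>S. d dvd f s}) - X / real d\<bar>)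
            \<le> x powr \<nu> * (\<eta> * X)" by (simp add: mult_ac)
        then show ?thesis using nu0 by (simp add: x_def)
      qed
      have "\<bar>real (card {s\<in>S. \<forall>p. prime p \<longrightarrow> p dvd f s \<longrightarrow> real p \<le> x powr \<theta>}) - X * M\<bar> \<le> \<gamma>' * X"
      proof (rule transfer[OF finS _ _ dev])
        fix s assume "s \<in> S"
        then show "0 < f s \<and> real (f s) \<le> 2 * x" using A B by (fastforce simp: S_def f_def x_def)
      qed (use X in auto)
      \<comment> \<open>The removed pairs with sum 0 are not missed, as 0 is not smooth.\<close>
      moreover have "{s\<in>S. \<forall>p. prime p \<longrightarrow> p dvd f s \<longrightarrow> real p \<le> x powr \<theta>}
          = {(a, b). a \<in> A \<and> b \<in> B \<and> smooth (x powr \<theta>) (a + b)}"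
      proof -
        have "(\<forall>p. prime p \<longrightarrow> p dvd f s \<longrightarrow> real p \<le> x powr \<theta>) \<longleftrightarrow> smooth (x powr \<theta>) (fst s + snd s)" for s
          unfolding f_def smooth_int_iff[symmetric] using smooth_abs[of _ "fst s + snd s"] by simp
        then show ?thesis using not_smooth_0 by (auto simp: S_def)
      qed
      ultimately have "\<bar>real (card {(a, b). a \<in> A \<and> b \<in> B \<and> smooth (x powr \<theta>) (a + b)}) - X * M\<bar> \<le> \<gamma>' * X"
        by simp
      moreover have "\<bar>X * M - X * dickman (1 / \<theta>)\<bar> \<le> 2 * (\<gamma>' * X)"
      proof -
        have "\<bar>X * M - X * dickman (1 / \<theta>)\<bar> \<le> X * (2 * \<gamma>')"
          unfolding right_diff_distrib[symmetric] abs_mult using M X by (intro mult_mono) auto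
        then show ?thesis by (simp only: mult_ac)
      qed
      moreover have "\<gamma> * X = 4 * (\<gamma>' * X)" "0 < \<gamma>' * X" using X \<gamma>' by (auto simp: \<gamma>'_def)
      ultimately have "\<bar>real (card {(a, b). a \<in> A \<and> b \<in> B \<and> smooth (x powr \<theta>) (a + b)}) - X * dickman (1 / \<theta>)\<bar> < \<gamma> * X"
        by linarith
      then show "\<bar>real (card {(a, b). a \<in> A \<and> b \<in> B \<and> smooth (real n powr \<theta>) (a + b)})
          - dickman (1 / \<theta>) * real (card A) * real (card B)\<bar> < \<gamma> * real (card A) * real (card B)"
        by (simp add: X_def x_def mult_ac)
    qed
  qed
  then show ?thesis using that \<nu> by blast
qed

theorem theorem4:
  fixes \<theta> \<gamma> :: real
  assumes "0 < \<theta>" and "\<theta> \<le> 1" and "\<gamma> > 0"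
  shows "(\<exists>\<nu>::real. 0 < \<nu> \<and> \<nu> < 1 \<and>
           (\<forall>\<^sub>F x::nat in at_top. \<forall>A B :: int set.
              A \<subseteq> {1..int x} \<longrightarrow> B \<subseteq> {1..int x} \<longrightarrow>
              real (card A) > real x powr \<nu> \<longrightarrow> real (card B) > real x powr \<nu> \<longrightarrow>
              \<bar>real (card {(a, b). a \<in> A \<and> b \<in> B \<and> smooth (real x powr \<theta>) (a + b)})
                 - dickman (1 / \<theta>) * real (card A) * real (card B)\<bar>
                < \<gamma> * real (card A) * real (card B)))
       \<and> (\<exists>\<nu>::real. 0 < \<nu> \<and> \<nu> < 1 \<and>
           (\<forall>\<^sub>F x::nat in at_top. \<forall>A B :: int set.
              A \<subseteq> {1..int x} \<longrightarrow> B \<subseteq> {1..int x} \<longrightarrow>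
              real (card A) > real x powr \<nu> \<longrightarrow> real (card B) > real x powr \<nu> \<longrightarrow>
              \<bar>real (card {(a, b). a \<in> A \<and> b \<in> B \<and> smooth (real x powr \<theta>) (a - b)})
                 - dickman (1 / \<theta>) * real (card A) * real (card B)\<bar>
                < \<gamma> * real (card A) * real (card B)))"
proof -
  obtain \<nu> :: real where \<nu>: "0 < \<nu>" "\<nu> < 1"
    and ev: "\<forall>\<^sub>F x::nat in at_top. \<forall>A B :: int set.
       A \<subseteq> {- int x..int x} \<longrightarrow> B \<subseteq> {- int x..int x} \<longrightarrow>
       real (card A) > real x powr \<nu> \<longrightarrow> real (card B) > real x powr \<nu> \<longrightarrow>
       \<bar>real (card {(a, b). a \<in> A \<and> b \<in> B \<and> smooth (real x powr \<theta>) (a + b)})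
          - dickman (1 / \<theta>) * real (card A) * real (card B)\<bar>
         < \<gamma> * real (card A) * real (card B)"
    using smooth_sums_count[OF assms] by blast
  have sub: "A \<subseteq> {- int x..int x}" if "A \<subseteq> {1..int x}" for A x using that by auto
  show ?thesis
  proof (intro conjI exI[of _ \<nu>] \<nu>)
    show "\<forall>\<^sub>F x::nat in at_top. \<forall>A B :: int set.
              A \<subseteq> {1..int x} \<longrightarrow> B \<subseteq> {1..int x} \<longrightarrow>
              real (card A) > real x powr \<nu> \<longrightarrow> real (card B) > real x powr \<nu> \<longrightarrow>
              \<bar>real (card {(a, b). a \<in> A \<and> b \<in> B \<and> smooth (real x powr \<theta>) (a + b)})
                 - dickman (1 / \<theta>) * real (card A) * real (card B)\<bar>
                < \<gamma> * real (card A) * real (card B)"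
      using ev by eventually_elim (use sub in blast)
    show "\<forall>\<^sub>F x::nat in at_top. \<forall>A B :: int set.
              A \<subseteq> {1..int x} \<longrightarrow> B \<subseteq> {1..int x} \<longrightarrow>
              real (card A) > real x powr \<nu> \<longrightarrow> real (card B) > real x powr \<nu> \<longrightarrow>
              \<bar>real (card {(a, b). a \<in> A \<and> b \<in> B \<and> smooth (real x powr \<theta>) (a - b)})
                 - dickman (1 / \<theta>) * real (card A) * real (card B)\<bar>
                < \<gamma> * real (card A) * real (card B)"
      using ev
    proof eventually_elim
      case (elim x)
      show ?case
      proof (intro allI impI)
        fix A B :: "int set"
        assume A: "A \<subseteq> {1..int x}" and B: "B \<subseteq> {1..int x}"
          and cA: "real (card A) > real x powr \<nu>" and cB: "real (card B) > real x powr \<nu>"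
        \<comment> \<open>Differences \<open>a - b\<close> are sums with elements of
          \<open>-B\<close>, which has the same size and lies in the symmetric interval; so the same
          \<open>\<nu>\<close> works.\<close>
        have cB': "card (uminus ` B) = card B" by (simp add: card_image)
        have "uminus ` B \<subseteq> {- int x..int x}" using B by auto
        then have "\<bar>real (card {(a, b). a \<in> A \<and> b \<in> uminus ` B \<and> smooth (real x powr \<theta>) (a + b)})
            - dickman (1 / \<theta>) * real (card A) * real (card B)\<bar> < \<gamma> * real (card A) * real (card B)"
          using elim[rule_format, OF sub[OF A], of "uminus ` B"] cA cB unfolding cB' by blast
        moreover have "{(a, b). a \<in> A \<and> b \<in> uminus ` B \<and> smooth (real x powr \<theta>) (a + b)}
            = (\<lambda>(a, b). (a, - b)) ` {(a, b). a \<in> A \<and> b \<in> B \<and> smooth (real x powr \<theta>) (a - b)}"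
          by force
        moreover have "inj_on (\<lambda>(a, b). (a, - b)) {(a, b). a \<in> A \<and> b \<in> B \<and> smooth (real x powr \<theta>) (a - b)}"
          by (auto simp: inj_on_def)
        ultimately show "\<bar>real (card {(a, b). a \<in> A \<and> b \<in> B \<and> smooth (real x powr \<theta>) (a - b)})
                 - dickman (1 / \<theta>) * real (card A) * real (card B)\<bar>
                < \<gamma> * real (card A) * real (card B)"
          by (simp add: card_image)
      qed
    qed
  qed
qed

end
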